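(* Let $(\boldsymbol{X},\boldsymbol{T})$ and $(\boldsymbol{Y},\boldsymbol{R})$ be nonautonomous dynamical systems, $Z\subset X_0$ and $W\subset Y_0$. Suppose that $\boldsymbol{f}\in\boldsymbol{C}(\boldsymbol{X},\mathbb{R})$ and $\boldsymbol{g}\in\boldsymbol{C}(\boldsymbol{Y},\mathbb{R})$ are both equicontinuous, and assume that sums of a pressure of $(\boldsymbol{T},\boldsymbol{f},Z)$ and a pressure of $(\boldsymbol{R},\boldsymbol{g},W)$ are well defined, i.e. not of the form $\infty-\infty$. (1) If $P^{\mathrm{B}}(\boldsymbol{T},\boldsymbol{f},Z)=P^{\mathrm{P}}(\boldsymbol{T},\boldsymbol{f},Z)$ or $P^{\mathrm{B}}(\boldsymbol{R},\boldsymbol{g},W)=P^{\mathrm{P}}(\boldsymbol{R},\boldsymbol{g},W)$, then $$P^{\mathrm{B}}(\boldsymbol{T}\times\boldsymbol{R},\boldsymbol{f}\dotplus\boldsymbol{g},Z\times W)=P^{\mathrm{B}}(\boldsymbol{T},\boldsymbol{f},Z)+P^{\mathrm{B}}(\boldsymbol{R},\boldsymbol{g},W),$$ $$P^{\mathrm{P}}(\boldsymbol{T}\times\boldsymbol{R},\boldsymbol{f}\dotplus\boldsymbol{g},Z\times W)=P^{\mathrm{P}}(\boldsymbol{T},\boldsymbol{f},Z)+P^{\mathrm{P}}(\boldsymbol{R},\boldsymbol{g},W).$$ (2) If $P^{\mathrm{L}}(\boldsymbol{T},\boldsymbol{f},Z)=P^{\mathrm{U}}(\boldsymbol{T},\boldsymbol{f},Z)$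 or $P^{\mathrm{L}}(\boldsymbol{R},\boldsymbol{g},W)=P^{\mathrm{U}}(\boldsymbol{R},\boldsymbol{g},W)$, then $$P^{\mathrm{L}}(\boldsymbol{T}\times\boldsymbol{R},\boldsymbol{f}\dotplus\boldsymbol{g},Z\times W)=P^{\mathrm{L}}(\boldsymbol{T},\boldsymbol{f},Z)+P^{\mathrm{L}}(\boldsymbol{R},\boldsymbol{g},W),$$ $$P^{\mathrm{U}}(\boldsymbol{T}\times\boldsymbol{R},\boldsymbol{f}\dotplus\boldsymbol{g},Z\times W)=P^{\mathrm{U}}(\boldsymbol{T},\boldsymbol{f},Z)+P^{\mathrm{U}}(\boldsymbol{R},\boldsymbol{g},W).$$
   Context: A nonautonomous dynamical system (NDS) $(\boldsymbol{X},\boldsymbol{T})$ consists of a sequence $\boldsymbol{X}=\{X_k\}_{k=0}^\infty$ of compact metric spaces $(X_k,d_k)$ and a sequence $\boldsymbol{T}=\{T_k\}_{k=0}^\infty$ of continuous maps $T_k:X_k\to X_{k+1}$. Write $\boldsymbol{T}^0=\mathrm{id}_{X_0}$ and $\boldsymbol{T}^j=T_{j-1}\circ\cdots\circ T_0:X_0\to X_j$. For $n\ge 1$ the $n$-th Bowen metric on $X_0$ is $d_n^{\boldsymbol{T}}(x,y)=\max_{0\le j\le n-1}d_j(\boldsymbol{T}^jx,\boldsymbol{T}^jy)$; $B_n^{\boldsymbol{T}}(x,\varepsilon)$ and $\overline{B}_n^{\boldsymbol{T}}(x,\varepsilon)$ are the open ($<\varepsilon$) and closed ($\le\varepsilon$)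 balls of this metric. $\boldsymbol{C}(\boldsymbol{X},\mathbb{R})=\prod_{k\ge 0}C(X_k,\mathbb{R})$ is the set of sequences $\boldsymbol{f}=\{f_k\}_{k=0}^\infty$ of continuous functions $f_k:X_k\to\mathbb{R}$, and $S_n^{\boldsymbol{T}}\boldsymbol{f}=\sum_{j=0}^{n-1}f_j\circ\boldsymbol{T}^j$. $\boldsymbol{f}$ is equicontinuous if for every $\varepsilon>0$ there is $\delta>0$ such that for all $k\ge0$ and $x,y\in X_k$ with $d_k(x,y)<\delta$ we have $|f_k(x)-f_k(y)|<\varepsilon$. Products. $\boldsymbol{X}\times\boldsymbol{Y}=\{X_k\times Y_k\}_{k\ge0}$ with metrics $\max\{d_{X_k}(x_1,x_2),d_{Y_k}(y_1,y_2)\}$; $\boldsymbol{T}\times\boldsymbol{R}=\{T_k\times R_k\}_{k\ge0}$ with $(T_k\times R_k)(x,y)=(T_kx,R_ky)$; $\boldsymbol{f}\dotplus\boldsymbol{g}=\{f_k\dotplus g_k\}_{k\ge0}$ with $(f_k\dotplus g_k)(x,y)=f_k(x)+g_k(y)$. Lower and upper pressures. For $Z\subset X_0$, $n\ge1$, $\varepsilon>0$: $F\subset X_0$ is $(n,\varepsilon)$-spanning for $Z$ if for every $x\in Z$ there is $y\in F$ with $d_n^{\boldsymbol{T}}(x,y)\le\varepsilon$; $E\subset Z$ is $(n,\varepsilon)$-separated for $Z$ if $d_n^{\boldsymbol{T}}(x,y)>\varepsilon$ for all distinct $x,y\in E$. Let $Q_n(\boldsymbol{T},\boldsymbol{f},Z,\varepsilon)=\inf_F\sum_{x\in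 F}e^{S_n^{\boldsymbol{T}}\boldsymbol{f}(x)}$ over $(n,\varepsilon)$-spanning sets $F$ for $Z$ and $P_n(\boldsymbol{T},\boldsymbol{f},Z,\varepsilon)=\sup_E\sum_{x\in E}e^{S_n^{\boldsymbol{T}}\boldsymbol{f}(x)}$ over $(n,\varepsilon)$-separated sets $E$ for $Z$. Let $\underline{Q}(\boldsymbol{T},\boldsymbol{f},Z,\varepsilon)$, $\overline{Q}(\boldsymbol{T},\boldsymbol{f},Z,\varepsilon)$ be the $\liminf$, $\limsup$ as $n\to\infty$ of $\frac1n\log Q_n(\boldsymbol{T},\boldsymbol{f},Z,\varepsilon)$, and $\underline{P}(\boldsymbol{T},\boldsymbol{f},Z,\varepsilon)$, $\overline{P}(\boldsymbol{T},\boldsymbol{f},Z,\varepsilon)$ those of $\frac1n\log P_n(\boldsymbol{T},\boldsymbol{f},Z,\varepsilon)$ ($\log 0=-\infty$). Then $\underline{Q},\overline{Q},\underline{P},\overline{P}(\boldsymbol{T},\boldsymbol{f},Z)$ are the (monotone) limits of these as $\varepsilon\to0$. When $\underline{Q}=\underline{P}$ at $(\boldsymbol{T},\boldsymbol{f},Z)$ the common value is denoted $P^{\mathrm{L}}(\boldsymbol{T},\boldsymbol{f},Z)$; when $\overline{Q}=\overline{P}$ the common value is denoted $P^{\mathrm{U}}(\boldsymbol{T},\boldsymbol{f},Z)$. Both equalities hold whenever $\boldsymbol{f}$ is equicontinuous. Bowen pressure. For $s\in\mathbb{R}$, $N>0$, $\varepsilon>0$ let $\mathscr{R}^s_{N,\varepsilon}(\boldsymbol{T},\boldsymbol{f},Z)=\inf\sum_i\exp(-n_is+S_{n_i}^{\boldsymbol{T}}\boldsymbol{f}(x_i))$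 over all countable families $\{B_{n_i}^{\boldsymbol{T}}(x_i,\varepsilon)\}_i$ with $n_i\ge N$, $x_i\in X_0$, covering $Z$. Put $\mathscr{R}^s_\varepsilon=\lim_{N\to\infty}\mathscr{R}^s_{N,\varepsilon}$, $P^{\mathrm{B}}(\boldsymbol{T},\boldsymbol{f},Z,\varepsilon)=\inf\{s:\mathscr{R}^s_\varepsilon(\boldsymbol{T},\boldsymbol{f},Z)=0\}=\sup\{s:\mathscr{R}^s_\varepsilon(\boldsymbol{T},\boldsymbol{f},Z)=+\infty\}$, and $P^{\mathrm{B}}(\boldsymbol{T},\boldsymbol{f},Z)=\lim_{\varepsilon\to0}P^{\mathrm{B}}(\boldsymbol{T},\boldsymbol{f},Z,\varepsilon)$. Packing pressure. Let $\mathscr{P}^s_{N,\varepsilon}(\boldsymbol{T},\boldsymbol{f},Z)=\sup\sum_i\exp(-n_is+S_{n_i}^{\boldsymbol{T}}\boldsymbol{f}(x_i))$ over all (at most) countable pairwise disjoint families $\{\overline{B}_{n_i}^{\boldsymbol{T}}(x_i,\varepsilon)\}_i$ with $x_i\in Z$, $n_i\ge N$. Put $\mathscr{P}^s_{\infty,\varepsilon}=\lim_{N\to\infty}\mathscr{P}^s_{N,\varepsilon}$, $\mathscr{P}^s_\varepsilon(\boldsymbol{T},\boldsymbol{f},Z)=\inf\{\sum_{i=1}^\infty\mathscr{P}^s_{\infty,\varepsilon}(\boldsymbol{T},\boldsymbol{f},Z_i):\bigcup_iZ_i\supset Z\}$, $P^{\mathrm{P}}(\boldsymbol{T},\boldsymbol{f},Z,\varepsilon)=\inf\{s:\mathscr{P}^s_\varepsilon(\boldsymbol{T},\boldsymbol{f},Z)=0\}=\sup\{s:\mathscr{P}^s_\varepsilon(\boldsymbol{T},\boldsymbol{f},Z)=+\infty\}$,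 and $P^{\mathrm{P}}(\boldsymbol{T},\boldsymbol{f},Z)=\lim_{\varepsilon\to0}P^{\mathrm{P}}(\boldsymbol{T},\boldsymbol{f},Z,\varepsilon)$. All pressures take values in $\mathbb{R}\cup\{\pm\infty\}$. *)

theory Defs
  imports "HOL-Analysis.Analysis"
begin

text \<open>The spaces of a system are carriers \<open>mspace (X k)\<close> inside one ambient type; since the
  carriers and metrics are arbitrary, this covers every sequence of compact metric spaces.
  Functions are only constrained on the carriers.\<close>

definition nds :: "(nat \<Rightarrow> 'a metric) \<Rightarrow> (nat \<Rightarrow> 'a \<Rightarrow> 'a) \<Rightarrow> bool" where
  "nds X T \<longleftrightarrow>
     (\<forall>k. compact_space (mtopology_of (X k)) \<and>
          continuous_map (mtopology_of (X k)) (mtopology_of (X (Suc k))) (T k))"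

primrec orbit_map :: "(nat \<Rightarrow> 'a \<Rightarrow> 'a) \<Rightarrow> nat \<Rightarrow> 'a \<Rightarrow> 'a" where
  "orbit_map T 0 = id"
| "orbit_map T (Suc j) = T j \<circ> orbit_map T j"

text \<open>Only meaningful for \<open>n \<ge> 1\<close>: for \<open>n = 0\<close> it is the maximum of the empty set.\<close>

definition bowen_dist ::
    "(nat \<Rightarrow> 'a metric) \<Rightarrow> (nat \<Rightarrow> 'a \<Rightarrow> 'a) \<Rightarrow> nat \<Rightarrow> 'a \<Rightarrow> 'a \<Rightarrow> real" where
  "bowen_dist X T n x y =
     Max ((\<lambda>j. mdist (X j) (orbit_map T j x) (orbit_map T j y)) ` {..<n})"

definition bowen_ball ::
    "(nat \<Rightarrow> 'a metric) \<Rightarrow> (nat \<Rightarrow> 'a \<Rightarrow> 'a) \<Rightarrow> nat \<Rightarrow> 'a \<Rightarrow> real \<Rightarrow> 'a set" where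
  "bowen_ball X T n x \<epsilon> = {y \<in> mspace (X 0). bowen_dist X T n x y < \<epsilon>}"

definition bowen_cball ::
    "(nat \<Rightarrow> 'a metric) \<Rightarrow> (nat \<Rightarrow> 'a \<Rightarrow> 'a) \<Rightarrow> nat \<Rightarrow> 'a \<Rightarrow> real \<Rightarrow> 'a set" where
  "bowen_cball X T n x \<epsilon> = {y \<in> mspace (X 0). bowen_dist X T n x y \<le> \<epsilon>}"

definition continuous_seqs :: "(nat \<Rightarrow> 'a metric) \<Rightarrow> (nat \<Rightarrow> 'a \<Rightarrow> real) set" where
  "continuous_seqs X = {f. \<forall>k. continuous_map (mtopology_of (X k)) euclideanreal (f k)}"

definition birkhoff_sum ::
    "(nat \<Rightarrow> 'a \<Rightarrow> 'a) \<Rightarrow> (nat \<Rightarrow> 'a \<Rightarrow> real) \<Rightarrow> nat \<Rightarrow> 'a \<Rightarrow> real" where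
  "birkhoff_sum T f n x = (\<Sum>j<n. f j (orbit_map T j x))"

definition equicontinuous_seq ::
    "(nat \<Rightarrow> 'a metric) \<Rightarrow> (nat \<Rightarrow> 'a \<Rightarrow> real) \<Rightarrow> bool" where
  "equicontinuous_seq X f \<longleftrightarrow>
     (\<forall>\<epsilon>>0. \<exists>\<delta>>0. \<forall>k. \<forall>x\<in>mspace (X k). \<forall>y\<in>mspace (X k).
        mdist (X k) x y < \<delta> \<longrightarrow> \<bar>f k x - f k y\<bar> < \<epsilon>)"

text \<open>The library's \<^const>\<open>prod_metric\<close> is the Euclidean product metric; Bowen balls of a product
  system are products of Bowen balls only for the maximum metric.\<close>

definition max_metric :: "'a metric \<Rightarrow> 'b metric \<Rightarrow> ('a \<times> 'b) metric" where
  "max_metric m1 m2 =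
     metric (mspace m1 \<times> mspace m2,
             \<lambda>(x, y) (x', y'). max (mdist m1 x x') (mdist m2 y y'))"

lemma Metric_space_max_metric:
  "Metric_space (mspace m1 \<times> mspace m2)
     (\<lambda>(x, y) (x', y'). max (mdist m1 x x') (mdist m2 y y'))"
proof
  fix p q :: "'a \<times> 'b"
  show "0 \<le> (\<lambda>(x, y) (x', y'). max (mdist m1 x x') (mdist m2 y y')) p q"
    by (auto simp: le_max_iff_disj split: prod.splits)
  show "(\<lambda>(x, y) (x', y'). max (mdist m1 x x') (mdist m2 y y')) p q =
        (\<lambda>(x, y) (x', y'). max (mdist m1 x x') (mdist m2 y y')) q p"
    by (auto simp: mdist_commute split: prod.splits)
next
  fix p q :: "'a \<times> 'b"
  assume "p \<in> mspace m1 \<times> mspace m2" "q \<in> mspace m1 \<times> mspace m2"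
  then obtain x y x' y' where p: "p = (x, y)" "x \<in> mspace m1" "y \<in> mspace m2"
    and q: "q = (x', y')" "x' \<in> mspace m1" "y' \<in> mspace m2" by auto
  have "0 \<le> mdist m1 x x'" "0 \<le> mdist m2 y y'" by auto
  then have "max (mdist m1 x x') (mdist m2 y y') = 0 \<longleftrightarrow>
      mdist m1 x x' = 0 \<and> mdist m2 y y' = 0" by linarith
  then show "((\<lambda>(x, y) (x', y'). max (mdist m1 x x') (mdist m2 y y')) p q = 0) = (p = q)"
    using p q by simp
next
  fix p q r :: "'a \<times> 'b"
  assume "p \<in> mspace m1 \<times> mspace m2" "q \<in> mspace m1 \<times> mspace m2"
    "r \<in> mspace m1 \<times> mspace m2"
  then obtain x y x' y' x'' y'' where p: "p = (x, y)" "x \<in> mspace m1" "y \<in> mspace m2"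
    and q: "q = (x', y')" "x' \<in> mspace m1" "y' \<in> mspace m2"
    and r: "r = (x'', y'')" "x'' \<in> mspace m1" "y'' \<in> mspace m2" by auto
  have "mdist m1 x x'' \<le> mdist m1 x x' + mdist m1 x' x''"
    "mdist m2 y y'' \<le> mdist m2 y y' + mdist m2 y' y''"
    using p q r by (auto intro: mdist_triangle)
  then show "(\<lambda>(x, y) (x', y'). max (mdist m1 x x') (mdist m2 y y')) p r \<le>
      (\<lambda>(x, y) (x', y'). max (mdist m1 x x') (mdist m2 y y')) p q +
      (\<lambda>(x, y) (x', y'). max (mdist m1 x x') (mdist m2 y y')) q r"
    using p q r by simp linarith
qed

lemma mspace_max_metric [simp]: "mspace (max_metric m1 m2) = mspace m1 \<times> mspace m2"
  by (simp add: max_metric_def Metric_space.mspace_metric Metric_space_max_metric)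

lemma mdist_max_metric [simp]:
  "mdist (max_metric m1 m2) (x, y) (x', y') = max (mdist m1 x x') (mdist m2 y y')"
  by (simp add: max_metric_def Metric_space.mdist_metric Metric_space_max_metric)

definition prod_spaces ::
    "(nat \<Rightarrow> 'a metric) \<Rightarrow> (nat \<Rightarrow> 'b metric) \<Rightarrow> nat \<Rightarrow> ('a \<times> 'b) metric" where
  "prod_spaces X Y k = max_metric (X k) (Y k)"

definition prod_maps ::
    "(nat \<Rightarrow> 'a \<Rightarrow> 'a) \<Rightarrow> (nat \<Rightarrow> 'b \<Rightarrow> 'b) \<Rightarrow> nat \<Rightarrow> 'a \<times> 'b \<Rightarrow> 'a \<times> 'b" where
  "prod_maps T R k = map_prod (T k) (R k)"

definition dotplus ::
    "(nat \<Rightarrow> 'a \<Rightarrow> real) \<Rightarrow> (nat \<Rightarrow> 'b \<Rightarrow> real) \<Rightarrow> nat \<Rightarrow> 'a \<times> 'b \<Rightarrow> real" where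
  "dotplus f g k = (\<lambda>(x, y). f k x + g k y)"

definition spanning ::
    "(nat \<Rightarrow> 'a metric) \<Rightarrow> (nat \<Rightarrow> 'a \<Rightarrow> 'a) \<Rightarrow> 'a set \<Rightarrow> nat \<Rightarrow> real \<Rightarrow> 'a set \<Rightarrow> bool" where
  "spanning X T Z n \<epsilon> F \<longleftrightarrow>
     F \<subseteq> mspace (X 0) \<and> (\<forall>x\<in>Z. \<exists>y\<in>F. bowen_dist X T n x y \<le> \<epsilon>)"

definition separated ::
    "(nat \<Rightarrow> 'a metric) \<Rightarrow> (nat \<Rightarrow> 'a \<Rightarrow> 'a) \<Rightarrow> 'a set \<Rightarrow> nat \<Rightarrow> real \<Rightarrow> 'a set \<Rightarrow> bool" where
  "separated X T Z n \<epsilon> E \<longleftrightarrow>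
     E \<subseteq> Z \<and> (\<forall>x\<in>E. \<forall>y\<in>E. x \<noteq> y \<longrightarrow> bowen_dist X T n x y > \<epsilon>)"

definition Q_sum ::
    "(nat \<Rightarrow> 'a metric) \<Rightarrow> (nat \<Rightarrow> 'a \<Rightarrow> 'a) \<Rightarrow> (nat \<Rightarrow> 'a \<Rightarrow> real) \<Rightarrow> 'a set \<Rightarrow> nat \<Rightarrow> real \<Rightarrow> ennreal"
  where
  "Q_sum X T f Z n \<epsilon> =
     (INF F\<in>{F. spanning X T Z n \<epsilon> F}.
        \<Sum>\<^sub>\<infinity>x\<in>F. ennreal (exp (birkhoff_sum T f n x)))"

definition P_sum ::
    "(nat \<Rightarrow> 'a metric) \<Rightarrow> (nat \<Rightarrow> 'a \<Rightarrow> 'a) \<Rightarrow> (nat \<Rightarrow> 'a \<Rightarrow> real) \<Rightarrow> 'a set \<Rightarrow> nat \<Rightarrow> real \<Rightarrow> ennreal"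
  where
  "P_sum X T f Z n \<epsilon> =
     (SUP E\<in>{E. separated X T Z n \<epsilon> E}.
        \<Sum>\<^sub>\<infinity>x\<in>E. ennreal (exp (birkhoff_sum T f n x)))"

definition log_ennreal :: "ennreal \<Rightarrow> ereal" where
  "log_ennreal a =
     (if a = 0 then - \<infinity> else if a = \<infinity> then \<infinity> else ereal (ln (enn2real a)))"

definition lower_Q ::
    "(nat \<Rightarrow> 'a metric) \<Rightarrow> (nat \<Rightarrow> 'a \<Rightarrow> 'a) \<Rightarrow> (nat \<Rightarrow> 'a \<Rightarrow> real) \<Rightarrow> 'a set \<Rightarrow> ereal" where
  "lower_Q X T f Z =
     Lim (at_right 0)
       (\<lambda>\<epsilon>. liminf (\<lambda>n. ereal (1 / real n) * log_ennreal (Q_sum X T f Z n \<epsilon>)))"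

definition upper_Q ::
    "(nat \<Rightarrow> 'a metric) \<Rightarrow> (nat \<Rightarrow> 'a \<Rightarrow> 'a) \<Rightarrow> (nat \<Rightarrow> 'a \<Rightarrow> real) \<Rightarrow> 'a set \<Rightarrow> ereal" where
  "upper_Q X T f Z =
     Lim (at_right 0)
       (\<lambda>\<epsilon>. limsup (\<lambda>n. ereal (1 / real n) * log_ennreal (Q_sum X T f Z n \<epsilon>)))"

definition lower_P ::
    "(nat \<Rightarrow> 'a metric) \<Rightarrow> (nat \<Rightarrow> 'a \<Rightarrow> 'a) \<Rightarrow> (nat \<Rightarrow> 'a \<Rightarrow> real) \<Rightarrow> 'a set \<Rightarrow> ereal" where
  "lower_P X T f Z =
     Lim (at_right 0)
       (\<lambda>\<epsilon>. liminf (\<lambda>n. ereal (1 / real n) * log_ennreal (P_sum X T f Z n \<epsilon>)))"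

definition upper_P ::
    "(nat \<Rightarrow> 'a metric) \<Rightarrow> (nat \<Rightarrow> 'a \<Rightarrow> 'a) \<Rightarrow> (nat \<Rightarrow> 'a \<Rightarrow> real) \<Rightarrow> 'a set \<Rightarrow> ereal" where
  "upper_P X T f Z =
     Lim (at_right 0)
       (\<lambda>\<epsilon>. limsup (\<lambda>n. ereal (1 / real n) * log_ennreal (P_sum X T f Z n \<epsilon>)))"

text \<open>The common value of the spanning and separated pressures; unspecified if they differ (they
  agree for equicontinuous potentials).\<close>

definition lower_pressure ::
    "(nat \<Rightarrow> 'a metric) \<Rightarrow> (nat \<Rightarrow> 'a \<Rightarrow> 'a) \<Rightarrow> (nat \<Rightarrow> 'a \<Rightarrow> real) \<Rightarrow> 'a set \<Rightarrow> ereal" where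
  "lower_pressure X T f Z = (THE p. lower_Q X T f Z = p \<and> lower_P X T f Z = p)"

definition upper_pressure ::
    "(nat \<Rightarrow> 'a metric) \<Rightarrow> (nat \<Rightarrow> 'a \<Rightarrow> 'a) \<Rightarrow> (nat \<Rightarrow> 'a \<Rightarrow> real) \<Rightarrow> 'a set \<Rightarrow> ereal" where
  "upper_pressure X T f Z = (THE p. upper_Q X T f Z = p \<and> upper_P X T f Z = p)"

text \<open>At most countable families are indexed by arbitrary sets \<open>I\<close> of natural numbers; the empty
  family is allowed.\<close>

definition weighted_sum ::
    "(nat \<Rightarrow> 'a \<Rightarrow> 'a) \<Rightarrow> (nat \<Rightarrow> 'a \<Rightarrow> real) \<Rightarrow> real \<Rightarrow> nat set \<Rightarrow> (nat \<Rightarrow> nat) \<Rightarrow> (nat \<Rightarrow> 'a) \<Rightarrow> ennreal"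
  where
  "weighted_sum T f s I n x =
     (\<Sum>\<^sub>\<infinity>i\<in>I. ennreal (exp (- real (n i) * s + birkhoff_sum T f (n i) (x i))))"

definition bowen_pre ::
    "(nat \<Rightarrow> 'a metric) \<Rightarrow> (nat \<Rightarrow> 'a \<Rightarrow> 'a) \<Rightarrow> (nat \<Rightarrow> 'a \<Rightarrow> real) \<Rightarrow> 'a set \<Rightarrow> real \<Rightarrow> nat \<Rightarrow> real
      \<Rightarrow> ennreal" where
  "bowen_pre X T f Z s N \<epsilon> =
     Inf {weighted_sum T f s I n x | I n x.
            (\<forall>i\<in>I. N \<le> n i \<and> x i \<in> mspace (X 0)) \<and>
            Z \<subseteq> (\<Union>i\<in>I. bowen_ball X T (n i) (x i) \<epsilon>)}"

definition bowen_measure ::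
    "(nat \<Rightarrow> 'a metric) \<Rightarrow> (nat \<Rightarrow> 'a \<Rightarrow> 'a) \<Rightarrow> (nat \<Rightarrow> 'a \<Rightarrow> real) \<Rightarrow> 'a set \<Rightarrow> real \<Rightarrow> real \<Rightarrow> ennreal"
  where
  "bowen_measure X T f Z s \<epsilon> = lim (\<lambda>N. bowen_pre X T f Z s N \<epsilon>)"

definition bowen_pressure ::
    "(nat \<Rightarrow> 'a metric) \<Rightarrow> (nat \<Rightarrow> 'a \<Rightarrow> 'a) \<Rightarrow> (nat \<Rightarrow> 'a \<Rightarrow> real) \<Rightarrow> 'a set \<Rightarrow> ereal" where
  "bowen_pressure X T f Z =
     Lim (at_right 0) (\<lambda>\<epsilon>. Inf {ereal s | s. bowen_measure X T f Z s \<epsilon> = 0})"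

definition packing_pre ::
    "(nat \<Rightarrow> 'a metric) \<Rightarrow> (nat \<Rightarrow> 'a \<Rightarrow> 'a) \<Rightarrow> (nat \<Rightarrow> 'a \<Rightarrow> real) \<Rightarrow> 'a set \<Rightarrow> real \<Rightarrow> nat \<Rightarrow> real
      \<Rightarrow> ennreal" where
  "packing_pre X T f Z s N \<epsilon> =
     Sup {weighted_sum T f s I n x | I n x.
            (\<forall>i\<in>I. N \<le> n i \<and> x i \<in> Z) \<and>
            disjoint_family_on (\<lambda>i. bowen_cball X T (n i) (x i) \<epsilon>) I}"

definition packing_premeasure ::
    "(nat \<Rightarrow> 'a metric) \<Rightarrow> (nat \<Rightarrow> 'a \<Rightarrow> 'a) \<Rightarrow> (nat \<Rightarrow> 'a \<Rightarrow> real) \<Rightarrow> 'a set \<Rightarrow> real \<Rightarrow> real \<Rightarrow> ennreal"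
  where
  "packing_premeasure X T f Z s \<epsilon> = lim (\<lambda>N. packing_pre X T f Z s N \<epsilon>)"

definition packing_measure ::
    "(nat \<Rightarrow> 'a metric) \<Rightarrow> (nat \<Rightarrow> 'a \<Rightarrow> 'a) \<Rightarrow> (nat \<Rightarrow> 'a \<Rightarrow> real) \<Rightarrow> 'a set \<Rightarrow> real \<Rightarrow> real \<Rightarrow> ennreal"
  where
  "packing_measure X T f Z s \<epsilon> =
     Inf {\<Sum>i. packing_premeasure X T f (A i) s \<epsilon> | A :: nat \<Rightarrow> 'a set.
            (\<forall>i. A i \<subseteq> mspace (X 0)) \<and> Z \<subseteq> (\<Union>i. A i)}"

definition packing_pressure ::
    "(nat \<Rightarrow> 'a metric) \<Rightarrow> (nat \<Rightarrow> 'a \<Rightarrow> 'a) \<Rightarrow> (nat \<Rightarrow> 'a \<Rightarrow> real) \<Rightarrow> 'a set \<Rightarrow> ereal" where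
  "packing_pressure X T f Z =
     Lim (at_right 0) (\<lambda>\<epsilon>. Inf {ereal s | s. packing_measure X T f Z s \<epsilon> = 0})"

text \<open>\<^typ>\<open>ereal\<close> assigns a value to \<open>\<infinity> - \<infinity>\<close>, so well-definedness of a sum must be stated.\<close>

definition sum_defined :: "ereal \<Rightarrow> ereal \<Rightarrow> bool" where
  "sum_defined a b \<longleftrightarrow> \<not> (a = \<infinity> \<and> b = - \<infinity>) \<and> \<not> (a = - \<infinity> \<and> b = \<infinity>)"

end

theory Submission
  imports Defs
begin

text \<open>
  Compactness enters only through total boundedness of the Bowen metrics. A product system again has
  this property, its Bowen balls are products of balls of the same level, and weights multiply.

  Spanning sets of the factors multiply to spanning sets, and separated sets to separated sets, so the
  lower and upper pressures reduce to rates of submultiplicative and supermultiplicative sequences;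
  equicontinuity identifies the spanning and the separated rate.

  For the Bowen and packing pressures there are four inequalities:
  \<open>P\<^sup>B(Z) + P\<^sup>B(W) \<le> P\<^sup>B(Z \<times> W) \<le> P\<^sup>B(Z) + P\<^sup>P(W)\<close> and
  \<open>P\<^sup>B(Z) + P\<^sup>P(W) \<le> P\<^sup>P(Z \<times> W) \<le> P\<^sup>P(Z) + P\<^sup>P(W)\<close>.
  All four work level by level: at a fixed level \<open>n\<close> the balls of a maximal separated set, enlarged by a
  constant factor, form a cover, so coverings and packings at level \<open>n\<close> compare with bounded loss.
  Passing from mixed levels to a single one costs a factor \<open>exp (n \<eta>)\<close>, that is, an arbitrarily small
  change of the exponent. The two lower bounds look at sections: for each \<open>x \<in> Z\<close>, the section at \<open>x\<close> of
  a cover (or of a countable decomposition) of \<open>Z \<times> W\<close> is one of \<open>W\<close>, which forces a definite weight at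
  some level, and the points sharing this level are then covered in \<open>Z\<close>.
\<close>

subsection \<open>Sums in the extended nonnegative reals and limits of scales\<close>

text \<open>One cover or packing may mix infinitely many levels, while balls of a product arise only
  from factors of equal level. A bound \<open>C\<close> at each level does not sum up; after the
  exponent is raised by \<open>\<eta>\<close>, however, level \<open>n\<close> gains the factor
  \<open>exp (- real n * \<eta>)\<close>, and the resulting geometric tail even tends to 0. So the
  arguments trade in strict inequalities between exponents: \<open>\<eta>\<close> is a third of the
  available gap, because at most three losses occur, namely summation over levels, oscillation of
  Birkhoff sums, and the search for a heavy level in a section. Reals strictly above or below the
  pressures also cover infinite pressures. No measure is constructed on the sets: in a section, a
  tail of total share below 1 forces some level to be heavy. The two bounds that mix a Bowen and a
  packing pressure are not symmetric in the factors, hence the exchange of factors near the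
  end.\<close>

lemma sum_le_infsum_ennreal:
  fixes h :: "'i \<Rightarrow> ennreal"
  assumes "finite F" "F \<subseteq> A"
  shows "sum h F \<le> infsum h A"
  using assms by (subst nonneg_infsum_complete) (auto intro: SUP_upper)

lemma infsum_mono_set_ennreal:
  fixes h :: "'i \<Rightarrow> ennreal"
  assumes "A \<subseteq> B"
  shows "infsum h A \<le> infsum h B"
  using assms by (intro infsum_mono_neutral nonneg_summable_on_complete) auto

text \<open>The sets may overlap: each element of a finite subset is charged to one index
  \<open>c x\<close> whose set contains it, and an infinite sum is the supremum of its finite
  ones.\<close>

lemma infsum_UNION_le_ennreal:
  fixes h :: "'i \<Rightarrow> ennreal"
  shows "infsum h (\<Union>j\<in>J. A j) \<le> (\<Sum>\<^sub>\<infinity>j\<in>J. infsum h (A j))"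
proof (rule infsum_le_finite_sums)
  fix F assume F: "finite F" "F \<subseteq> (\<Union>j\<in>J. A j)"
  then have "\<forall>x\<in>F. \<exists>j. j \<in> J \<and> x \<in> A j" by auto
  then obtain c where c: "\<And>x. x \<in> F \<Longrightarrow> c x \<in> J \<and> x \<in> A (c x)" by metis
  have "sum h F = (\<Sum>j\<in>c ` F. sum h {x \<in> F. c x = j})"
    using F(1) by (rule sum.image_gen)
  also have "\<dots> \<le> (\<Sum>j\<in>c ` F. infsum h (A j))"
  proof (intro sum_mono sum_le_infsum_ennreal)
    show "finite {x \<in> F. c x = j}" for j using F(1) by simp
    show "{x \<in> F. c x = j} \<subseteq> A j" for j using c by blast
  qed
  also have "\<dots> \<le> (\<Sum>\<^sub>\<infinity>j\<in>J. infsum h (A j))"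
    using F(1) c by (intro sum_le_infsum_ennreal) auto
  finally show "sum h F \<le> (\<Sum>\<^sub>\<infinity>j\<in>J. infsum h (A j))" .
qed (auto intro: nonneg_summable_on_complete)

text \<open>Serves to add up the parts of one cover that belong to different points of a separated
  set.\<close>

lemma sum_infsum_disjoint_le_ennreal:
  fixes h :: "'i \<Rightarrow> ennreal"
  assumes "finite E" "disjoint_family_on A E" "(\<Union>z\<in>E. A z) \<subseteq> I"
  shows "(\<Sum>z\<in>E. infsum h (A z)) \<le> infsum h I"
proof -
  have "(\<Sum>z\<in>E. infsum h (A z)) = infsum h (\<Union>z\<in>E. A z)"
    using assms(1,2)
  proof (induction E)
    case (insert z E)
    have "A z \<inter> (\<Union>z\<in>E. A z) = {}"
      using insert.hyps disjoint_family_onD[OF insert.prems, of z] by fastforce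
    moreover have "disjoint_family_on A E"
      using insert.prems by (auto simp: disjoint_family_on_def)
    ultimately show ?case
      using insert by (simp add: infsum_Un_disjoint[OF nonneg_summable_on_complete nonneg_summable_on_complete])
  qed simp
  then show ?thesis
    using assms(3) by (simp add: infsum_mono_set_ennreal)
qed

lemma infsum_cmult_le_ennreal:
  fixes h :: "'i \<Rightarrow> ennreal"
  shows "(\<Sum>\<^sub>\<infinity>i\<in>A. c * h i) \<le> c * infsum h A"
proof (rule infsum_le_finite_sums)
  fix F assume "finite F" "F \<subseteq> A"
  then show "(\<Sum>i\<in>F. c * h i) \<le> c * infsum h A"
    by (simp flip: sum_distrib_left add: mult_left_mono sum_le_infsum_ennreal)
qed (auto intro: nonneg_summable_on_complete)

lemma infsum_image_le_ennreal:
  fixes h :: "'i \<Rightarrow> ennreal"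
  shows "infsum h (c ` J) \<le> (\<Sum>\<^sub>\<infinity>j\<in>J. h (c j))"
  using infsum_UNION_le_ennreal[of h "\<lambda>j. {c j}" J] by (simp add: UNION_singleton_eq_range)

text \<open>The sum is a supremum of finite sums, and multiplication by a constant,
  \<open>top\<close> included, commutes with suprema in \<open>ennreal\<close>.\<close>

lemma cmult_infsum_le_ennreal:
  fixes h :: "'i \<Rightarrow> ennreal"
  shows "c * infsum h A \<le> (\<Sum>\<^sub>\<infinity>i\<in>A. c * h i)"
proof -
  have "c * infsum h A = (SUP F\<in>{F. finite F \<and> F \<subseteq> A}. c * sum h F)"
    by (subst nonneg_infsum_complete) (auto simp: SUP_mult_left_ennreal)
  also have "\<dots> \<le> (\<Sum>\<^sub>\<infinity>i\<in>A. c * h i)"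
    by (rule SUP_least) (auto simp: sum_distrib_left intro: sum_le_infsum_ennreal)
  finally show ?thesis .
qed

lemma infsum_Times_le_ennreal:
  fixes a :: "'i \<Rightarrow> ennreal" and b :: "'j \<Rightarrow> ennreal"
  shows "(\<Sum>\<^sub>\<infinity>(x, y)\<in>A \<times> B. a x * b y) \<le> infsum a A * infsum b B"
proof -
  have "A \<times> B = (\<Union>x\<in>A. Pair x ` B)" by auto
  then have "(\<Sum>\<^sub>\<infinity>(x, y)\<in>A \<times> B. a x * b y) \<le> (\<Sum>\<^sub>\<infinity>x\<in>A. \<Sum>\<^sub>\<infinity>p\<in>Pair x ` B. a (fst p) * b (snd p))"
    using infsum_UNION_le_ennreal[of "\<lambda>p. a (fst p) * b (snd p)" "\<lambda>x. Pair x ` B" A]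
    by (simp add: case_prod_unfold)
  also have "\<dots> \<le> (\<Sum>\<^sub>\<infinity>x\<in>A. infsum b B * a x)"
  proof (rule infsum_mono)
    fix x assume "x \<in> A"
    have "(\<Sum>\<^sub>\<infinity>p\<in>Pair x ` B. a (fst p) * b (snd p)) \<le> (\<Sum>\<^sub>\<infinity>y\<in>B. a x * b y)"
      using infsum_image_le_ennreal[of "\<lambda>p. a (fst p) * b (snd p)" "Pair x" B] by simp
    also have "\<dots> \<le> a x * infsum b B" by (rule infsum_cmult_le_ennreal)
    finally show "(\<Sum>\<^sub>\<infinity>p\<in>Pair x ` B. a (fst p) * b (snd p)) \<le> infsum b B * a x"
      by (simp add: mult.commute)
  qed (rule nonneg_summable_on_complete, simp)+
  also have "\<dots> \<le> infsum b B * infsum a A" by (rule infsum_cmult_le_ennreal)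
  finally show ?thesis by (simp add: mult.commute)
qed

lemma less_infsum_ennrealD:
  fixes h :: "'i \<Rightarrow> ennreal"
  assumes "a < infsum h A"
  shows "\<exists>F. finite F \<and> F \<subseteq> A \<and> a < sum h F"
  using assms by (subst (asm) nonneg_infsum_complete) (auto simp: less_SUP_iff)

lemma exp_mult_ennreal: "ennreal (exp a) * ennreal (exp b) = ennreal (exp (a + b))"
  by (simp add: exp_add ennreal_mult)

text \<open>The price of gathering all levels from \<open>N\<close> on: a bound valid at each single
  level becomes a bound for all of them together, times this tail, once the exponent is raised by
  \<open>\<eta>\<close>.\<close>

definition exp_tail :: "real \<Rightarrow> nat \<Rightarrow> ennreal" where
  "exp_tail \<eta> N = (\<Sum>\<^sub>\<infinity>n\<in>{N..}. ennreal (exp (- real n * \<eta>)))"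

lemma exp_tail_le:
  assumes "\<eta> > 0"
  shows "exp_tail \<eta> N \<le> ennreal (exp (- \<eta>) ^ N / (1 - exp (- \<eta>)))"
  unfolding exp_tail_def
proof (rule infsum_le_finite_sums)
  define r where "r = exp (- \<eta>)"
  have r: "0 < r" "r < 1" using assms by (auto simp: r_def)
  have rn: "exp (- real n * \<eta>) = r ^ n" for n
    by (simp add: r_def exp_of_nat_mult[symmetric])
  fix F :: "nat set" assume F: "finite F" "F \<subseteq> {N..}"
  then obtain M where M: "F \<subseteq> {N..<N + M}"
    by (metis F atLeastLessThan_iff atLeast_iff finite_nat_set_iff_bounded le_add2 order_less_le_trans subset_eq)
  have "(\<Sum>n\<in>F. exp (- real n * \<eta>)) \<le> (\<Sum>n\<in>{N..<N+M}. r ^ n)"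
    unfolding rn using M r by (intro sum_mono2) auto
  also have "\<dots> = r ^ N * (\<Sum>n<M. r ^ n)"
    by (subst sum.atLeastLessThan_shift_0) (simp add: power_add sum_distrib_left atLeast0LessThan)
  also have "\<dots> = r ^ N * ((1 - r ^ M) / (1 - r))"
    using r by (simp add: sum_gp_strict)
  also have "\<dots> \<le> r ^ N * (1 / (1 - r))"
    using r by (intro mult_left_mono divide_right_mono) auto
  finally show "(\<Sum>n\<in>F. ennreal (exp (- real n * \<eta>))) \<le> ennreal (exp (- \<eta>) ^ N / (1 - exp (- \<eta>)))"
    by (simp add: sum_nonneg ennreal_leI r_def)
qed (auto intro: nonneg_summable_on_complete)

lemma exp_tail_tendsto_0:
  assumes "\<eta> > 0"
  shows "exp_tail \<eta> \<longlonglongrightarrow> 0"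
proof (rule tendsto_sandwich[where f = "\<lambda>_. 0"])
  show "\<forall>\<^sub>F N in sequentially. exp_tail \<eta> N \<le> ennreal (exp (- \<eta>) ^ N / (1 - exp (- \<eta>)))"
    using exp_tail_le[OF assms] by simp
  have "(\<lambda>N. exp (- \<eta>) ^ N / (1 - exp (- \<eta>))) \<longlonglongrightarrow> 0 / (1 - exp (- \<eta>))"
    using assms by (intro tendsto_intros LIMSEQ_power_zero) auto
  then show "(\<lambda>N. ennreal (exp (- \<eta>) ^ N / (1 - exp (- \<eta>)))) \<longlonglongrightarrow> 0"
    using tendsto_ennrealI by fastforce
qed auto

lemma exp_tail_finite: "\<eta> > 0 \<Longrightarrow> exp_tail \<eta> N < \<infinity>"
  using exp_tail_le[of \<eta> N] by (metis ennreal_less_top infinity_ennreal_def order_le_less_trans)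

lemma exp_tail_less:
  assumes "\<eta> > 0" "c > 0"
  shows "\<exists>N0. \<forall>N\<ge>N0. exp_tail \<eta> N < c"
  using order_tendstoD(2)[OF exp_tail_tendsto_0[OF assms(1)] assms(2)]
  by (simp add: eventually_sequentially)

text \<open>\<open>Lim\<close> is a definite description. Monotonicity in the scale shows that the
  limit exists, so that every pressure becomes a supremum over scales.\<close>

lemma Lim_at_right_0_antimono:
  fixes \<phi> :: "real \<Rightarrow> ereal"
  assumes "\<And>a b. 0 < a \<Longrightarrow> a \<le> b \<Longrightarrow> \<phi> b \<le> \<phi> a"
  shows "Lim (at_right 0) \<phi> = (SUP \<epsilon>\<in>{0<..}. \<phi> \<epsilon>)"
proof (rule tendsto_Lim)
  show "(\<phi> \<longlongrightarrow> (SUP \<epsilon>\<in>{0<..}. \<phi> \<epsilon>)) (at_right 0)"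
  proof (rule order_tendstoI)
    fix a assume "a < (SUP \<epsilon>\<in>{0<..}. \<phi> \<epsilon>)"
    then obtain e where e: "e > 0" "a < \<phi> e" by (auto simp: less_SUP_iff)
    have "\<forall>\<^sub>F x in at_right 0. x \<in> {0<..<e}"
      using e by (intro eventually_at_right_real)
    then show "\<forall>\<^sub>F x in at_right 0. a < \<phi> x"
      by eventually_elim (use e assms in \<open>force intro: less_le_trans\<close>)
  next
    fix a assume a: "(SUP \<epsilon>\<in>{0<..}. \<phi> \<epsilon>) < a"
    have "\<forall>\<^sub>F x::real in at_right 0. x \<in> {0<..<1}"
      by (intro eventually_at_right_real) auto
    then show "\<forall>\<^sub>F x in at_right 0. \<phi> x < a"
      by eventually_elim (use a in \<open>auto intro: le_less_trans[OF SUP_upper]\<close>)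
  qed
qed simp

text \<open>Upper bounds for a product are proved only for reals strictly above the two pressures.
  If one pressure is \<open>- \<infinity>\<close>, its real bound can be taken arbitrarily low, so
  the sum of the bounds still gets below every \<open>u\<close> above \<open>a + b\<close>.\<close>

lemma le_add_erealI:
  fixes a b c :: ereal
  assumes "sum_defined a b"
    and "\<And>s t. a < ereal s \<Longrightarrow> b < ereal t \<Longrightarrow> c \<le> ereal (s + t)"
  shows "c \<le> a + b"
proof (cases "a + b = \<infinity>")
  case False
  show ?thesis
  proof (rule dense_ge)
    fix u assume u: "a + b < u"
    show "c \<le> u"
    proof (cases u)
      case (real r)
      have ab: "a \<noteq> \<infinity>" "b \<noteq> \<infinity>" using False by auto
      have "\<exists>s t. a < ereal s \<and> b < ereal t \<and> s + t \<le> r"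
      proof (cases a)
        case a: (real a')
        show ?thesis
        proof (cases b)
          case (real b')
          then show ?thesis using a u \<open>u = ereal r\<close>
            by (intro exI[of _ "a' + (r - a' - b')/2"] exI[of _ "b' + (r - a' - b')/2"]) (auto simp: field_simps)
        next
          case MInf
          then show ?thesis using a by (intro exI[of _ "a' + 1"] exI[of _ "r - a' - 1"]) auto
        qed (use ab in auto)
      next
        case MInf
        then obtain t where "b < ereal t" using ab by (metis less_PInf_Ex_of_nat ereal_infty_less(1))
        then show ?thesis using MInf by (intro exI[of _ "r - t"] exI[of _ t]) auto
      qed (use ab in auto)
      then show ?thesis using assms(2) real by (meson ereal_less_eq(3) order.trans)
    qed (use u in auto)
  qed
qed auto

lemma add_le_erealI:
  fixes a b c :: ereal
  assumes "sum_defined a b"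
    and "\<And>s t. ereal s < a \<Longrightarrow> ereal t < b \<Longrightarrow> ereal (s + t) \<le> c"
  shows "a + b \<le> c"
proof -
  have "- c \<le> - a + - b"
  proof (rule le_add_erealI)
    show "sum_defined (- a) (- b)"
      using assms(1) by (auto simp: sum_defined_def ereal_uminus_eq_reorder)
    fix s t assume "- a < ereal s" "- b < ereal t"
    then have "ereal (- s) < a" "ereal (- t) < b"
      by (auto simp: ereal_uminus_less_reorder simp flip: uminus_ereal.simps)
    then have "ereal (- s + - t) \<le> c" by (rule assms(2))
    then show "- c \<le> ereal (s + t)"
      using ereal_uminus_le_reorder[of c "ereal (s + t)"] by simp
  qed
  \<comment> \<open>In \<open>ereal\<close>, \<open>\<infinity> + - \<infinity>\<close> is
    \<open>\<infinity>\<close>, so negation distributes over the sum only because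
    \<open>sum_defined\<close> excludes opposite infinities.\<close>
  also have "- a + - b = - (a + b)"
    using assms(1) by (cases a; cases b) (auto simp: sum_defined_def)
  finally show ?thesis by simp
qed

subsection \<open>Bowen metrics, separated sets and products\<close>

lemma mdist_self: "x \<in> mspace m \<Longrightarrow> mdist m x x = 0"
  by simp

lemma bowen_dist_le_iff:
  "n \<ge> 1 \<Longrightarrow> bowen_dist X T n x y \<le> e \<longleftrightarrow>
     (\<forall>j<n. mdist (X j) (orbit_map T j x) (orbit_map T j y) \<le> e)"
  unfolding bowen_dist_def by (subst Max_le_iff) (auto simp: lessThan_empty_iff)

lemma bowen_dist_less_iff:
  "n \<ge> 1 \<Longrightarrow> bowen_dist X T n x y < e \<longleftrightarrow>
     (\<forall>j<n. mdist (X j) (orbit_map T j x) (orbit_map T j y) < e)"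
  unfolding bowen_dist_def by (subst Max_less_iff) (auto simp: lessThan_empty_iff)

lemma bowen_dist_commute: "bowen_dist X T n x y = bowen_dist X T n y x"
  unfolding bowen_dist_def by (simp add: mdist_commute)

lemma bowen_ball_mono: "e \<le> e' \<Longrightarrow> bowen_ball X T n x e \<subseteq> bowen_ball X T n x e'"
  by (auto simp: bowen_ball_def)

lemma bowen_cball_mono: "e \<le> e' \<Longrightarrow> bowen_cball X T n x e \<subseteq> bowen_cball X T n x e'"
  by (auto simp: bowen_cball_def)

text \<open>Total boundedness of the Bowen metrics is all that the argument uses of compactness; unlike
  \<^const>\<open>nds\<close>, it passes to product systems by an easy argument.\<close>

locale bowen_system =
  fixes X :: "nat \<Rightarrow> 'a metric" and T :: "nat \<Rightarrow> 'a \<Rightarrow> 'a"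
  assumes map_in: "x \<in> mspace (X k) \<Longrightarrow> T k x \<in> mspace (X (Suc k))"
    and finite_spanning: "n \<ge> 1 \<Longrightarrow> \<epsilon> > 0 \<Longrightarrow> \<exists>F. finite F \<and> spanning X T (mspace (X 0)) n \<epsilon> F"
begin

lemma orbit_in: "x \<in> mspace (X 0) \<Longrightarrow> orbit_map T j x \<in> mspace (X j)"
  by (induction j) (auto intro: map_in)

lemma bowen_dist_triangle:
  assumes "n \<ge> 1" "x \<in> mspace (X 0)" "y \<in> mspace (X 0)" "z \<in> mspace (X 0)"
    and "bowen_dist X T n x y \<le> a" "bowen_dist X T n y z \<le> b"
  shows "bowen_dist X T n x z \<le> a + b"
  unfolding bowen_dist_le_iff[OF assms(1)]
proof (intro allI impI)
  fix j assume "j < n"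
  then have "mdist (X j) (orbit_map T j x) (orbit_map T j y) \<le> a"
    "mdist (X j) (orbit_map T j y) (orbit_map T j z) \<le> b"
    using assms by (auto simp: bowen_dist_le_iff)
  moreover have "mdist (X j) (orbit_map T j x) (orbit_map T j z) \<le>
    mdist (X j) (orbit_map T j x) (orbit_map T j y) + mdist (X j) (orbit_map T j y) (orbit_map T j z)"
    using assms by (intro mdist_triangle orbit_in)
  ultimately show "mdist (X j) (orbit_map T j x) (orbit_map T j z) \<le> a + b" by linarith
qed

lemma bowen_dist_self: "n \<ge> 1 \<Longrightarrow> x \<in> mspace (X 0) \<Longrightarrow> e \<ge> 0 \<Longrightarrow> bowen_dist X T n x x \<le> e"
  using mdist_self[OF orbit_in] by (simp add: bowen_dist_le_iff)

text \<open>Two points of \<open>E\<close> near the same point of an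
  \<open>\<epsilon> / 2\<close>-spanning set have Bowen distance at most \<open>\<epsilon>\<close>,
  hence are equal. So one finite spanning set bounds the size of every separated set.\<close>

lemma separated_card_bound:
  assumes "n \<ge> 1" "\<epsilon> > 0"
  shows "\<exists>K. \<forall>E. separated X T (mspace (X 0)) n \<epsilon> E \<longrightarrow> finite E \<and> card E \<le> K"
proof -
  from finite_spanning[OF assms(1), of "\<epsilon> / 2"] assms(2)
  obtain F where F: "finite F" "spanning X T (mspace (X 0)) n (\<epsilon> / 2) F" by auto
  have "finite E \<and> card E \<le> card F" if E: "separated X T (mspace (X 0)) n \<epsilon> E" for E
  proof -
    have "\<forall>x\<in>E. \<exists>y. y \<in> F \<and> bowen_dist X T n x y \<le> \<epsilon> / 2"
    proof
      fix x assume "x \<in> E"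
      then have "x \<in> mspace (X 0)" using E by (auto simp: separated_def)
      then show "\<exists>y. y \<in> F \<and> bowen_dist X T n x y \<le> \<epsilon> / 2"
        using F(2) by (auto simp: spanning_def)
    qed
    then obtain c where c: "\<And>x. x \<in> E \<Longrightarrow> c x \<in> F \<and> bowen_dist X T n x (c x) \<le> \<epsilon> / 2"
      by metis
    have "inj_on c E"
    proof (rule inj_onI)
      fix x y assume xy: "x \<in> E" "y \<in> E" "c x = c y"
      have m: "x \<in> mspace (X 0)" "y \<in> mspace (X 0)" "c x \<in> mspace (X 0)"
        using E F(2) c xy by (auto simp: separated_def spanning_def)
      have "bowen_dist X T n (c x) y \<le> \<epsilon> / 2"
        using c[OF xy(2)] xy(3) by (metis bowen_dist_commute)
      then have "bowen_dist X T n x y \<le> \<epsilon> / 2 + \<epsilon> / 2"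
        using c[OF xy(1)] m assms(1) by (intro bowen_dist_triangle[of n x "c x" y]) auto
      then show "x = y" using E xy unfolding separated_def by force
    qed
    then show ?thesis using c F(1) by (metis card_inj_on_le finite_imageD finite_subset image_subsetI)
  qed
  then show ?thesis by blast
qed

text \<open>A separated set of largest size exists because the sizes are bounded; a point farther
  than \<open>\<epsilon>\<close> from all its members could be added to it.\<close>

lemma ex_maximal_separated:
  assumes "n \<ge> 1" "\<epsilon> > 0" "A \<subseteq> mspace (X 0)"
  shows "\<exists>E. finite E \<and> separated X T A n \<epsilon> E \<and> (\<forall>x\<in>A. \<exists>y\<in>E. bowen_dist X T n x y \<le> \<epsilon>)"
proof -
  obtain K where K: "\<And>E. separated X T (mspace (X 0)) n \<epsilon> E \<Longrightarrow> finite E \<and> card E \<le> K"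
    using separated_card_bound[OF assms(1,2)] by blast
  have K': "finite E \<and> card E \<le> K" if "separated X T A n \<epsilon> E" for E
    using that assms(3) by (intro K) (auto simp: separated_def)
  have "separated X T A n \<epsilon> {}" by (simp add: separated_def)
  then obtain E where E: "separated X T A n \<epsilon> E"
    and max: "\<And>E'. separated X T A n \<epsilon> E' \<Longrightarrow> card E' \<le> card E"
    using ex_has_greatest_nat[of "separated X T A n \<epsilon>" "{}" card "Suc K"] K'
    by (metis less_Suc_eq_le)
  have "\<exists>y\<in>E. bowen_dist X T n x y \<le> \<epsilon>" if x: "x \<in> A" for x
  proof (rule ccontr)
    assume neg: "\<not> ?thesis"
    then have "separated X T A n \<epsilon> (insert x E)"
    proof -
      have "bowen_dist X T n x y > \<epsilon>" "bowen_dist X T n y x > \<epsilon>" if "y \<in> E" for y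
        using neg that bowen_dist_commute[of X T n y x] by (auto simp: not_le)
      then show ?thesis using E x by (auto simp: separated_def)
    qed
    \<comment> \<open>A member is within \<open>\<epsilon>\<close> of itself, so inserting
      \<open>x\<close> really increases the cardinality.\<close>
    moreover have "x \<notin> E"
      using neg bowen_dist_self[of n x \<epsilon>] assms x by auto
    ultimately show False using max[of "insert x E"] K'[OF E] by simp
  qed
  then show ?thesis using E K' by blast
qed

lemma separated_disjoint:
  assumes "n \<ge> 1" "separated X T (mspace (X 0)) n (2 * \<epsilon>) E"
  shows "disjoint_family_on (\<lambda>x. bowen_cball X T n x \<epsilon>) E"
proof (unfold disjoint_family_on_def, intro ballI impI equals0I)
  fix x y z assume xy: "x \<in> E" "y \<in> E" "x \<noteq> y" and z: "z \<in> bowen_cball X T n x \<epsilon> \<inter> bowen_cball X T n y \<epsilon>"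
  have "bowen_dist X T n x y \<le> \<epsilon> + \<epsilon>"
    using assms xy z unfolding bowen_cball_def separated_def
    by (intro bowen_dist_triangle[of n x z y]) (auto simp: bowen_dist_commute[of X T n z])
  then show False using assms(2) xy by (force simp: separated_def)
qed

text \<open>The scale \<open>2 * \<epsilon>\<close> does both jobs: separation keeps the closed
  \<open>\<epsilon>\<close>-balls disjoint, and maximality makes the closed
  \<open>2 * \<epsilon>\<close>-balls cover \<open>A\<close>. This is why open covering balls are
  later given the radius \<open>3 * \<epsilon>\<close>.\<close>

lemma ex_maximal_packing:
  assumes "n \<ge> 1" "\<epsilon> > 0" "A \<subseteq> mspace (X 0)"
  shows "\<exists>E. finite E \<and> E \<subseteq> A \<and> disjoint_family_on (\<lambda>x. bowen_cball X T n x \<epsilon>) E \<and>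
    (\<forall>x\<in>A. \<exists>y\<in>E. bowen_dist X T n y x \<le> 2 * \<epsilon>)"
proof -
  obtain E where E: "finite E" "separated X T A n (2 * \<epsilon>) E"
    "\<forall>x\<in>A. \<exists>y\<in>E. bowen_dist X T n x y \<le> 2 * \<epsilon>"
    using ex_maximal_separated[of n "2 * \<epsilon>" A] assms by auto
  have "separated X T (mspace (X 0)) n (2 * \<epsilon>) E" using E(2) assms(3) by (auto simp: separated_def)
  then show ?thesis
    using E separated_disjoint[OF assms(1)] by (metis separated_def bowen_dist_commute)
qed

text \<open>\<open>\<delta>\<close> does not depend on \<open>n\<close>, since equicontinuity is
  uniform in the level; the error \<open>real n * \<eta>\<close> is what a shift of the exponent by
  \<open>\<eta>\<close> absorbs.\<close>

lemma equicontinuous_birkhoff: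
  assumes "equicontinuous_seq X f" "\<eta> > 0"
  shows "\<exists>\<delta>>0. \<forall>n x y. n \<ge> 1 \<longrightarrow> x \<in> mspace (X 0) \<longrightarrow> y \<in> mspace (X 0) \<longrightarrow>
    bowen_dist X T n x y < \<delta> \<longrightarrow> \<bar>birkhoff_sum T f n x - birkhoff_sum T f n y\<bar> \<le> real n * \<eta>"
proof -
  obtain \<delta> where \<delta>: "\<delta> > 0"
    "\<And>k x y. x \<in> mspace (X k) \<Longrightarrow> y \<in> mspace (X k) \<Longrightarrow> mdist (X k) x y < \<delta> \<Longrightarrow> \<bar>f k x - f k y\<bar> < \<eta>"
    using assms unfolding equicontinuous_seq_def by meson
  have "\<bar>birkhoff_sum T f n x - birkhoff_sum T f n y\<bar> \<le> real n * \<eta>"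
    if "n \<ge> 1" "x \<in> mspace (X 0)" "y \<in> mspace (X 0)" "bowen_dist X T n x y < \<delta>" for n x y
  proof -
    have "\<bar>birkhoff_sum T f n x - birkhoff_sum T f n y\<bar>
        = \<bar>\<Sum>j<n. f j (orbit_map T j x) - f j (orbit_map T j y)\<bar>"
      by (simp add: birkhoff_sum_def sum_subtractf)
    also have "\<dots> \<le> (\<Sum>j<n. \<bar>f j (orbit_map T j x) - f j (orbit_map T j y)\<bar>)" by (rule sum_abs)
    also have "\<dots> \<le> (\<Sum>j<n. \<eta>)"
      using that by (intro sum_mono less_imp_le \<delta>(2) orbit_in) (auto simp: bowen_dist_less_iff)
    finally show ?thesis by simp
  qed
  then show ?thesis using \<delta>(1) by blast
qed

end

lemma nds_bowen_system:
  assumes "nds X T"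
  shows "bowen_system X T"
proof
  have cm: "continuous_map (mtopology_of (X k)) (mtopology_of (X (Suc k))) (T k)" for k
    using assms by (simp add: nds_def)
  show map_in: "T k x \<in> mspace (X (Suc k))" if "x \<in> mspace (X k)" for x k
    using continuous_map_image_subset_topspace[OF cm[of k]] that by auto
  have co: "continuous_map (mtopology_of (X 0)) (mtopology_of (X j)) (orbit_map T j)" for j
    by (induction j) (auto simp del: o_apply intro: continuous_map_compose cm)
  have o_in: "orbit_map T j x \<in> mspace (X j)" if "x \<in> mspace (X 0)" for j x
    using that by (induction j) (auto intro: map_in)
  fix n :: nat and \<epsilon> :: real assume n: "n \<ge> 1" "\<epsilon> > 0"
  \<comment> \<open>The open Bowen ball, written as a finite intersection of preimages of open
    balls, so that its openness follows from continuity of the orbit maps. Compactness then leaves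
    finitely many centres; \<open>n \<ge> 1\<close> keeps the intersection nonempty as a
    family.\<close>
  define U where "U x = (\<Inter>j\<in>{..<n}. {y \<in> topspace (mtopology_of (X 0)).
      orbit_map T j y \<in> mball_of (X j) (orbit_map T j x) \<epsilon>})" for x
  have op: "openin (mtopology_of (X 0)) (U x)" for x
    unfolding U_def using n(1)
    by (intro openin_INT2 openin_continuous_map_preimage[OF co]) 
       (auto simp: lessThan_empty_iff mtopology_of_def mball_of_def Metric_space.openin_mball)
  have "compactin (mtopology_of (X 0)) (mspace (X 0))"
    using assms by (simp add: nds_def flip: compact_space_def topspace_mtopology_of)
  moreover have "mspace (X 0) \<subseteq> \<Union>(U ` mspace (X 0))"
  proof
    fix x assume x: "x \<in> mspace (X 0)"
    then have "x \<in> U x" using n by (auto simp: U_def o_in mdist_self)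
    then show "x \<in> \<Union>(U ` mspace (X 0))" using x by blast
  qed
  moreover have "\<forall>V\<in>U ` mspace (X 0). openin (mtopology_of (X 0)) V" using op by blast
  ultimately obtain \<F> where \<F>: "finite \<F>" "\<F> \<subseteq> U ` mspace (X 0)" "mspace (X 0) \<subseteq> \<Union>\<F>"
    unfolding compactin_def by (elim conjE allE[of _ "U ` mspace (X 0)"]) auto
  then obtain F where F: "F \<subseteq> mspace (X 0)" "finite F" "\<F> = U ` F"
    by (metis finite_subset_image)
  have "spanning X T (mspace (X 0)) n \<epsilon> F"
    unfolding spanning_def
  proof (intro conjI ballI F(1))
    fix x assume "x \<in> mspace (X 0)"
    then obtain y where y: "y \<in> F" "x \<in> U y" using \<F>(3) F(3) by auto
    then have "bowen_dist X T n x y \<le> \<epsilon>"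
      using n unfolding bowen_dist_le_iff[OF n(1)] U_def
      by (auto simp: mdist_commute intro: less_imp_le)
    then show "\<exists>y\<in>F. bowen_dist X T n x y \<le> \<epsilon>" using y(1) by blast
  qed
  then show "\<exists>F. finite F \<and> spanning X T (mspace (X 0)) n \<epsilon> F" using F(2) by blast
qed

section \<open>Product systems\<close>

lemma mspace_prod_spaces [simp]: "mspace (prod_spaces X Y k) = mspace (X k) \<times> mspace (Y k)"
  by (simp add: prod_spaces_def)

lemma orbit_map_prod [simp]:
  "orbit_map (prod_maps T R) j (x, y) = (orbit_map T j x, orbit_map R j y)"
  by (induction j) (auto simp: prod_maps_def)

lemma birkhoff_sum_prod:
  "birkhoff_sum (prod_maps T R) (dotplus f g) n (x, y) = birkhoff_sum T f n x + birkhoff_sum R g n y"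
  by (simp add: birkhoff_sum_def dotplus_def sum.distrib)

lemma bowen_dist_prod_le_iff:
  "n \<ge> 1 \<Longrightarrow> bowen_dist (prod_spaces X Y) (prod_maps T R) n (x, y) (x', y') \<le> e \<longleftrightarrow>
     bowen_dist X T n x x' \<le> e \<and> bowen_dist Y R n y y' \<le> e"
  by (auto simp: bowen_dist_le_iff prod_spaces_def)

lemma bowen_dist_prod_less_iff:
  "n \<ge> 1 \<Longrightarrow> bowen_dist (prod_spaces X Y) (prod_maps T R) n (x, y) (x', y') < e \<longleftrightarrow>
     bowen_dist X T n x x' < e \<and> bowen_dist Y R n y y' < e"
  by (auto simp: bowen_dist_less_iff prod_spaces_def)

lemma bowen_ball_prod:
  "n \<ge> 1 \<Longrightarrow> bowen_ball (prod_spaces X Y) (prod_maps T R) n (x, y) e =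
     bowen_ball X T n x e \<times> bowen_ball Y R n y e"
  by (auto simp: bowen_ball_def bowen_dist_prod_less_iff)

lemma bowen_cball_prod:
  "n \<ge> 1 \<Longrightarrow> bowen_cball (prod_spaces X Y) (prod_maps T R) n (x, y) e =
     bowen_cball X T n x e \<times> bowen_cball Y R n y e"
  by (auto simp: bowen_cball_def bowen_dist_prod_le_iff)

lemma bowen_system_prod:
  assumes "bowen_system X T" "bowen_system Y R"
  shows "bowen_system (prod_spaces X Y) (prod_maps T R)"
proof
  interpret A: bowen_system X T by fact
  interpret B: bowen_system Y R by fact
  show "prod_maps T R k p \<in> mspace (prod_spaces X Y (Suc k))" if "p \<in> mspace (prod_spaces X Y k)" for p k
    using that by (auto simp: prod_maps_def intro: A.map_in B.map_in)
  fix n :: nat and \<epsilon> :: real assume n: "n \<ge> 1" "\<epsilon> > 0"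
  obtain F G where "finite F" "finite G" "spanning X T (mspace (X 0)) n \<epsilon> F" "spanning Y R (mspace (Y 0)) n \<epsilon> G"
    using A.finite_spanning[OF n] B.finite_spanning[OF n] by blast
  then have "finite (F \<times> G) \<and> spanning (prod_spaces X Y) (prod_maps T R) (mspace (prod_spaces X Y 0)) n \<epsilon> (F \<times> G)"
    using n by (fastforce simp: spanning_def bowen_dist_prod_le_iff)
  then show "\<exists>F. finite F \<and> spanning (prod_spaces X Y) (prod_maps T R) (mspace (prod_spaces X Y 0)) n \<epsilon> F"
    by blast
qed

lemma equicontinuous_dotplus:
  assumes "equicontinuous_seq X f" "equicontinuous_seq Y g"
  shows "equicontinuous_seq (prod_spaces X Y) (dotplus f g)"
  unfolding equicontinuous_seq_def
proof (intro allI impI)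
  fix e :: real assume e: "e > 0"
  obtain d1 where d1: "d1 > 0" "\<And>k x y. x \<in> mspace (X k) \<Longrightarrow> y \<in> mspace (X k) \<Longrightarrow> mdist (X k) x y < d1 \<Longrightarrow> \<bar>f k x - f k y\<bar> < e / 2"
    using assms(1) e unfolding equicontinuous_seq_def by (meson half_gt_zero)
  obtain d2 where d2: "d2 > 0" "\<And>k x y. x \<in> mspace (Y k) \<Longrightarrow> y \<in> mspace (Y k) \<Longrightarrow> mdist (Y k) x y < d2 \<Longrightarrow> \<bar>g k x - g k y\<bar> < e / 2"
    using assms(2) e unfolding equicontinuous_seq_def by (meson half_gt_zero)
  have "\<bar>dotplus f g k p - dotplus f g k q\<bar> < e"
    if pq: "p \<in> mspace (prod_spaces X Y k)" "q \<in> mspace (prod_spaces X Y k)"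
      "mdist (prod_spaces X Y k) p q < min d1 d2" for k p q
  proof -
    obtain x y x' y' where [simp]: "p = (x, y)" "q = (x', y')" by (meson surj_pair)
    have "\<bar>f k x - f k x'\<bar> < e / 2"
      by (rule d1(2)) (use pq in \<open>auto simp: prod_spaces_def\<close>)
    moreover have "\<bar>g k y - g k y'\<bar> < e / 2"
      by (rule d2(2)) (use pq in \<open>auto simp: prod_spaces_def\<close>)
    ultimately show ?thesis
      using abs_triangle_ineq[of "f k x - f k x'" "g k y - g k y'"] by (simp add: dotplus_def algebra_simps)
  qed
  then show "\<exists>\<delta>>0. \<forall>k. \<forall>x\<in>mspace (prod_spaces X Y k). \<forall>y\<in>mspace (prod_spaces X Y k).
      mdist (prod_spaces X Y k) x y < \<delta> \<longrightarrow> \<bar>dotplus f g k x - dotplus f g k y\<bar> < e"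
    using d1(1) d2(1) by (metis min_less_iff_conj)
qed

subsection \<open>Exponential growth rates\<close>

text \<open>The shape shared by \<open>lower_Q\<close> and \<open>lower_P\<close>, with an array
  \<open>A n \<epsilon>\<close> in place of the sums; growth estimates are then proved once for
  spanning and separated sums alike.\<close>

definition lower_rate :: "(nat \<Rightarrow> real \<Rightarrow> ennreal) \<Rightarrow> ereal" where
  "lower_rate A = Lim (at_right 0) (\<lambda>\<epsilon>. liminf (\<lambda>n. ereal (1 / real n) * log_ennreal (A n \<epsilon>)))"

definition upper_rate :: "(nat \<Rightarrow> real \<Rightarrow> ennreal) \<Rightarrow> ereal" where
  "upper_rate A = Lim (at_right 0) (\<lambda>\<epsilon>. limsup (\<lambda>n. ereal (1 / real n) * log_ennreal (A n \<epsilon>)))"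

definition scale_antimono :: "(nat \<Rightarrow> real \<Rightarrow> ennreal) \<Rightarrow> bool" where
  "scale_antimono A \<longleftrightarrow> (\<forall>n\<ge>1. \<forall>a b. 0 < a \<longrightarrow> a \<le> b \<longrightarrow> A n b \<le> A n a)"

text \<open>With its mirror image \<open>less_log_ennreal_rate_iff\<close> this removes the
  logarithms: rates are compared through \<open>exp (real n * s)\<close>, the values 0 and
  \<open>top\<close> included.\<close>

lemma log_ennreal_rate_less_iff:
  assumes "n \<ge> 1"
  shows "ereal (1 / real n) * log_ennreal a < ereal s \<longleftrightarrow> a < ennreal (exp (real n * s))"
proof (cases a)
  case (real r)
  show ?thesis
  proof (cases "r = 0")
    case False
    then have "1 / real n * ln r < s \<longleftrightarrow> r < exp (real n * s)"
      using assms real ln_less_cancel_iff[of r "exp (real n * s)"] by (auto simp: field_simps)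
    then show ?thesis using False real by (auto simp: log_ennreal_def ennreal_less_iff)
  qed (use assms real in \<open>auto simp: log_ennreal_def\<close>)
next
  case top
  then show ?thesis using assms by (auto simp: log_ennreal_def)
qed

lemma less_log_ennreal_rate_iff:
  assumes "n \<ge> 1"
  shows "ereal s < ereal (1 / real n) * log_ennreal a \<longleftrightarrow> ennreal (exp (real n * s)) < a"
proof (cases a)
  case (real r)
  show ?thesis
  proof (cases "r = 0")
    case False
    then have "s < 1 / real n * ln r \<longleftrightarrow> exp (real n * s) < r"
      using assms real ln_less_cancel_iff[of "exp (real n * s)" r] by (auto simp: field_simps)
    then show ?thesis using False real by (auto simp: log_ennreal_def ennreal_less_iff)
  qed (use assms real in \<open>auto simp: log_ennreal_def\<close>)
next
  case top
  then show ?thesis using assms by (auto simp: log_ennreal_def)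
qed

lemma log_ennreal_rate_mono:
  assumes "a \<le> b"
  shows "ereal (1 / real n) * log_ennreal a \<le> ereal (1 / real n) * log_ennreal b"
proof (rule ereal_mult_left_mono)
  show "log_ennreal a \<le> log_ennreal b"
  proof (rule ccontr)
    assume "\<not> ?thesis"
    then obtain s where "log_ennreal b < ereal s" "ereal s < log_ennreal a"
      using ereal_dense2[of "log_ennreal b" "log_ennreal a"] by (auto simp: not_le)
    then have "b < ennreal (exp s)" "ennreal (exp s) < a"
      using log_ennreal_rate_less_iff[of 1 b s] less_log_ennreal_rate_iff[of 1 s a]
      by (simp_all flip: one_ereal_def)
    then show False using assms by simp
  qed
qed auto

lemma lower_rate_SUP:
  assumes "scale_antimono A"
  shows "lower_rate A = (SUP \<epsilon>\<in>{0<..}. liminf (\<lambda>n. ereal (1 / real n) * log_ennreal (A n \<epsilon>)))"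
  unfolding lower_rate_def
proof (rule Lim_at_right_0_antimono, rule Liminf_mono)
  fix a b :: real assume "0 < a" "a \<le> b"
  with assms show "\<forall>\<^sub>F n in sequentially.
      ereal (1 / real n) * log_ennreal (A n b) \<le> ereal (1 / real n) * log_ennreal (A n a)"
    by (intro eventually_sequentiallyI[of 1] log_ennreal_rate_mono) (auto simp: scale_antimono_def)
qed

lemma upper_rate_SUP:
  assumes "scale_antimono A"
  shows "upper_rate A = (SUP \<epsilon>\<in>{0<..}. limsup (\<lambda>n. ereal (1 / real n) * log_ennreal (A n \<epsilon>)))"
  unfolding upper_rate_def
proof (rule Lim_at_right_0_antimono, rule Limsup_mono)
  fix a b :: real assume "0 < a" "a \<le> b"
  with assms show "\<forall>\<^sub>F n in sequentially.
      ereal (1 / real n) * log_ennreal (A n b) \<le> ereal (1 / real n) * log_ennreal (A n a)"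
    by (intro eventually_sequentiallyI[of 1] log_ennreal_rate_mono) (auto simp: scale_antimono_def)
qed

lemma liminf_lessD:
  fixes u :: "nat \<Rightarrow> ereal"
  assumes "liminf u < s"
  shows "\<exists>\<^sub>F n in sequentially. u n < s"
proof (rule ccontr)
  assume "\<not> ?thesis"
  then have "\<forall>\<^sub>F n in sequentially. s \<le> u n" by (simp add: not_frequently not_less)
  then have "s \<le> liminf u" by (rule Liminf_bounded)
  then show False using assms by simp
qed

lemma less_limsupD:
  fixes u :: "nat \<Rightarrow> ereal"
  assumes "s < limsup u"
  shows "\<exists>\<^sub>F n in sequentially. s < u n"
proof (rule ccontr)
  assume "\<not> ?thesis"
  then have "\<forall>\<^sub>F n in sequentially. u n \<le> s" by (simp add: not_frequently not_less)
  then have "limsup u \<le> s" by (rule Limsup_bounded)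
  then show False using assms by simp
qed

lemma eventually_pos_nat: "\<forall>\<^sub>F n::nat in sequentially. n \<ge> 1"
  by (rule eventually_ge_at_top)

text \<open>A rate is a supremum over scales, so an upper bound holds at every scale, whereas a
  lower bound, as in \<open>less_lower_rateD\<close>, is visible only at all sufficiently small
  scales. The lower rate yields infinitely many levels from above and all large levels from below;
  the upper rate does the reverse.\<close>

lemma lower_rate_lessD:
  assumes "scale_antimono A" "lower_rate A < ereal s" "\<epsilon> > 0"
  shows "\<exists>\<^sub>F n in sequentially. n \<ge> 1 \<and> A n \<epsilon> < ennreal (exp (real n * s))"
proof -
  have "liminf (\<lambda>n. ereal (1 / real n) * log_ennreal (A n \<epsilon>)) < ereal s"
  proof (rule le_less_trans[OF _ assms(2)])
    show "liminf (\<lambda>n. ereal (1 / real n) * log_ennreal (A n \<epsilon>)) \<le> lower_rate A"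
      unfolding lower_rate_SUP[OF assms(1)] by (rule SUP_upper) (use assms(3) in simp)
  qed
  from frequently_eventually_frequently[OF liminf_lessD[OF this] eventually_pos_nat]
  show ?thesis by (rule frequently_elim1) (metis log_ennreal_rate_less_iff)
qed

lemma upper_rate_lessD:
  assumes "scale_antimono A" "upper_rate A < ereal s" "\<epsilon> > 0"
  shows "\<forall>\<^sub>F n in sequentially. n \<ge> 1 \<and> A n \<epsilon> < ennreal (exp (real n * s))"
proof -
  have "limsup (\<lambda>n. ereal (1 / real n) * log_ennreal (A n \<epsilon>)) < ereal s"
  proof (rule le_less_trans[OF _ assms(2)])
    show "limsup (\<lambda>n. ereal (1 / real n) * log_ennreal (A n \<epsilon>)) \<le> upper_rate A"
      unfolding upper_rate_SUP[OF assms(1)] by (rule SUP_upper) (use assms(3) in simp)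
  qed
  from eventually_conj[OF Limsup_lessD[OF this] eventually_pos_nat]
  show ?thesis by (rule eventually_mono) (metis log_ennreal_rate_less_iff)
qed

lemma less_lower_rateD:
  assumes "scale_antimono A" "ereal s < lower_rate A"
  shows "\<exists>\<epsilon>0>0. \<forall>\<epsilon>. 0 < \<epsilon> \<and> \<epsilon> \<le> \<epsilon>0 \<longrightarrow> (\<forall>\<^sub>F n in sequentially. n \<ge> 1 \<and> ennreal (exp (real n * s)) < A n \<epsilon>)"
proof -
  obtain \<epsilon>0 where e0: "\<epsilon>0 > 0" "ereal s < liminf (\<lambda>n. ereal (1 / real n) * log_ennreal (A n \<epsilon>0))"
    using assms(2) unfolding lower_rate_SUP[OF assms(1)] by (auto simp: less_SUP_iff)
  have "\<forall>\<^sub>F n in sequentially. n \<ge> 1 \<and> ennreal (exp (real n * s)) < A n \<epsilon>0"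
    using eventually_conj[OF less_LiminfD[OF e0(2)] eventually_pos_nat]
    by (rule eventually_mono) (metis less_log_ennreal_rate_iff)
  then have "\<forall>\<^sub>F n in sequentially. n \<ge> 1 \<and> ennreal (exp (real n * s)) < A n \<epsilon>" if "0 < \<epsilon>" "\<epsilon> \<le> \<epsilon>0" for \<epsilon>
    by (rule eventually_mono) (use assms(1) that in \<open>auto simp: scale_antimono_def intro: less_le_trans\<close>)
  then show ?thesis using e0(1) by blast
qed

lemma less_upper_rateD:
  assumes "scale_antimono A" "ereal s < upper_rate A"
  shows "\<exists>\<epsilon>0>0. \<forall>\<epsilon>. 0 < \<epsilon> \<and> \<epsilon> \<le> \<epsilon>0 \<longrightarrow> (\<exists>\<^sub>F n in sequentially. n \<ge> 1 \<and> ennreal (exp (real n * s)) < A n \<epsilon>)"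
proof -
  obtain \<epsilon>0 where e0: "\<epsilon>0 > 0" "ereal s < limsup (\<lambda>n. ereal (1 / real n) * log_ennreal (A n \<epsilon>0))"
    using assms(2) unfolding upper_rate_SUP[OF assms(1)] by (auto simp: less_SUP_iff)
  have "\<exists>\<^sub>F n in sequentially. n \<ge> 1 \<and> ennreal (exp (real n * s)) < A n \<epsilon>0"
    using frequently_eventually_frequently[OF less_limsupD[OF e0(2)] eventually_pos_nat]
    by (rule frequently_elim1) (metis less_log_ennreal_rate_iff)
  then have "\<exists>\<^sub>F n in sequentially. n \<ge> 1 \<and> ennreal (exp (real n * s)) < A n \<epsilon>" if "0 < \<epsilon>" "\<epsilon> \<le> \<epsilon>0" for \<epsilon>
    by (rule frequently_elim1) (use assms(1) that in \<open>auto simp: scale_antimono_def intro: less_le_trans\<close>)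
  then show ?thesis using e0(1) by blast
qed

lemma lower_rate_leI:
  assumes "scale_antimono A"
    and "\<And>\<epsilon>. \<epsilon> > 0 \<Longrightarrow> \<exists>\<^sub>F n in sequentially. n \<ge> 1 \<and> A n \<epsilon> \<le> ennreal (exp (real n * s))"
  shows "lower_rate A \<le> ereal s"
  unfolding lower_rate_SUP[OF assms(1)]
proof (rule SUP_least, rule ccontr)
  fix \<epsilon> :: real assume e': "\<epsilon> \<in> {0<..}"
    and this': "\<not> liminf (\<lambda>n. ereal (1 / real n) * log_ennreal (A n \<epsilon>)) \<le> ereal s"
  have e: "\<epsilon> > 0" using e' by simp
  from this' have "\<forall>\<^sub>F n in sequentially. ereal s < ereal (1 / real n) * log_ennreal (A n \<epsilon>)"
    by (intro less_LiminfD) (simp add: not_le)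
  from frequently_eventually_frequently[OF assms(2)[OF e] this]
  have "\<exists>\<^sub>F n::nat in sequentially. False"
    by (rule frequently_elim1) (metis less_log_ennreal_rate_iff not_less)
  then show False by simp
qed

lemma upper_rate_leI:
  assumes "scale_antimono A"
    and "\<And>\<epsilon>. \<epsilon> > 0 \<Longrightarrow> \<forall>\<^sub>F n in sequentially. n \<ge> 1 \<and> A n \<epsilon> \<le> ennreal (exp (real n * s))"
  shows "upper_rate A \<le> ereal s"
  unfolding upper_rate_SUP[OF assms(1)]
proof (rule SUP_least, rule ccontr)
  fix \<epsilon> :: real assume e': "\<epsilon> \<in> {0<..}"
    and this': "\<not> limsup (\<lambda>n. ereal (1 / real n) * log_ennreal (A n \<epsilon>)) \<le> ereal s"
  have e: "\<epsilon> > 0" using e' by simp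
  from this' have "\<exists>\<^sub>F n in sequentially. ereal s < ereal (1 / real n) * log_ennreal (A n \<epsilon>)"
    by (intro less_limsupD) (simp add: not_le)
  from frequently_eventually_frequently[OF this assms(2)[OF e]]
  have "\<exists>\<^sub>F n::nat in sequentially. False"
    by (rule frequently_elim1) (metis less_log_ennreal_rate_iff not_less)
  then show False by simp
qed

lemma le_lower_rateI:
  assumes "scale_antimono A" "\<epsilon> > 0"
    and "\<forall>\<^sub>F n in sequentially. n \<ge> 1 \<and> ennreal (exp (real n * s)) \<le> A n \<epsilon>"
  shows "ereal s \<le> lower_rate A"
proof (rule ccontr)
  assume "\<not> ?thesis"
  then have "\<exists>\<^sub>F n in sequentially. n \<ge> 1 \<and> A n \<epsilon> < ennreal (exp (real n * s))"
    using assms by (intro lower_rate_lessD) (auto simp: not_le)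
  from frequently_eventually_frequently[OF this assms(3)]
  have "\<exists>\<^sub>F n::nat in sequentially. False" by (rule frequently_elim1) auto
  then show False by simp
qed

lemma le_upper_rateI:
  assumes "scale_antimono A" "\<epsilon> > 0"
    and "\<exists>\<^sub>F n in sequentially. n \<ge> 1 \<and> ennreal (exp (real n * s)) \<le> A n \<epsilon>"
  shows "ereal s \<le> upper_rate A"
proof (rule ccontr)
  assume "\<not> ?thesis"
  then have "\<forall>\<^sub>F n in sequentially. n \<ge> 1 \<and> A n \<epsilon> < ennreal (exp (real n * s))"
    using assms by (intro upper_rate_lessD) (auto simp: not_le)
  from frequently_eventually_frequently[OF assms(3) this]
  have "\<exists>\<^sub>F n::nat in sequentially. False" by (rule frequently_elim1) auto
  then show False by simp
qed

text \<open>A bound on a lower rate holds only at infinitely many levels, so the other factor must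
  be controlled at all large ones: the upper rate of \<open>A\<close> meets the lower rate of
  \<open>B\<close>. The strict bounds \<open>a\<close> and \<open>b\<close> stand for near-optimal
  spanning sets, as an infimum need not be attained.\<close>

lemma
  assumes anti: "scale_antimono A" "scale_antimono B" "scale_antimono C"
    and le: "\<And>n \<epsilon> a b. n \<ge> 1 \<Longrightarrow> \<epsilon> > 0 \<Longrightarrow> A n \<epsilon> < a \<Longrightarrow> B n \<epsilon> < b \<Longrightarrow> C n \<epsilon> \<le> a * b"
  shows lower_rate_mult_le:
      "sum_defined (upper_rate A) (lower_rate B) \<Longrightarrow> lower_rate C \<le> upper_rate A + lower_rate B"
    and upper_rate_mult_le:
      "sum_defined (upper_rate A) (upper_rate B) \<Longrightarrow> upper_rate C \<le> upper_rate A + upper_rate B"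
proof -
  have key: "n \<ge> 1 \<and> C n \<epsilon> \<le> ennreal (exp (real n * (s + t)))"
    if "\<epsilon> > 0" "n \<ge> 1 \<and> A n \<epsilon> < ennreal (exp (real n * s))" "n \<ge> 1 \<and> B n \<epsilon> < ennreal (exp (real n * t))"
    for n \<epsilon> s t
    using le[of n \<epsilon> "ennreal (exp (real n * s))" "ennreal (exp (real n * t))"] that
    by (simp add: exp_mult_ennreal distrib_left)
  show "lower_rate C \<le> upper_rate A + lower_rate B" if "sum_defined (upper_rate A) (lower_rate B)"
  proof (rule le_add_erealI[OF that], rule lower_rate_leI[OF anti(3)])
    fix s t \<epsilon> assume "upper_rate A < ereal s" "lower_rate B < ereal t" "(\<epsilon>::real) > 0"
    from frequently_eventually_frequently[OF lower_rate_lessD[OF anti(2) this(2,3)]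
        upper_rate_lessD[OF anti(1) this(1,3)]]
    show "\<exists>\<^sub>F n in sequentially. n \<ge> 1 \<and> C n \<epsilon> \<le> ennreal (exp (real n * (s + t)))"
      by (rule frequently_elim1) (use key \<open>\<epsilon> > 0\<close> in blast)
  qed
  show "upper_rate C \<le> upper_rate A + upper_rate B" if "sum_defined (upper_rate A) (upper_rate B)"
  proof (rule le_add_erealI[OF that], rule upper_rate_leI[OF anti(3)])
    fix s t \<epsilon> assume "upper_rate A < ereal s" "upper_rate B < ereal t" "(\<epsilon>::real) > 0"
    from eventually_conj[OF upper_rate_lessD[OF anti(1) this(1,3)]
        upper_rate_lessD[OF anti(2) this(2,3)]]
    show "\<forall>\<^sub>F n in sequentially. n \<ge> 1 \<and> C n \<epsilon> \<le> ennreal (exp (real n * (s + t)))"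
      by (rule eventually_mono) (use key \<open>\<epsilon> > 0\<close> in blast)
  qed
qed

text \<open>Dual to the previous pair: now the lower rate of \<open>A\<close> controls all large
  levels, among them the infinitely many supplied by the upper rate of \<open>B\<close>. Both bounds
  persist at the common scale \<open>min a b\<close>.\<close>

lemma
  assumes anti: "scale_antimono A" "scale_antimono B" "scale_antimono C"
    and ge: "\<And>n \<epsilon> a b. n \<ge> 1 \<Longrightarrow> \<epsilon> > 0 \<Longrightarrow> a < A n \<epsilon> \<Longrightarrow> b < B n \<epsilon> \<Longrightarrow> a * b \<le> C n \<epsilon>"
  shows lower_rate_mult_ge:
      "sum_defined (lower_rate A) (lower_rate B) \<Longrightarrow> lower_rate A + lower_rate B \<le> lower_rate C"
    and upper_rate_mult_ge:
      "sum_defined (lower_rate A) (upper_rate B) \<Longrightarrow> lower_rate A + upper_rate B \<le> upper_rate C"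
proof -
  have key: "n \<ge> 1 \<and> ennreal (exp (real n * (s + t))) \<le> C n \<epsilon>"
    if "\<epsilon> > 0" "n \<ge> 1 \<and> ennreal (exp (real n * s)) < A n \<epsilon>" "n \<ge> 1 \<and> ennreal (exp (real n * t)) < B n \<epsilon>"
    for n \<epsilon> s t
    using ge[of n \<epsilon> "ennreal (exp (real n * s))" "ennreal (exp (real n * t))"] that
    by (simp add: exp_mult_ennreal distrib_left)
  show "lower_rate A + lower_rate B \<le> lower_rate C" if "sum_defined (lower_rate A) (lower_rate B)"
  proof (rule add_le_erealI[OF that])
    fix s t assume "ereal s < lower_rate A" "ereal t < lower_rate B"
    from less_lower_rateD[OF anti(1) this(1)] less_lower_rateD[OF anti(2) this(2)]
    obtain a b where ab: "a > 0" "b > 0"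
      "\<And>\<epsilon>. 0 < \<epsilon> \<and> \<epsilon> \<le> a \<Longrightarrow> \<forall>\<^sub>F n in sequentially. n \<ge> 1 \<and> ennreal (exp (real n * s)) < A n \<epsilon>"
      "\<And>\<epsilon>. 0 < \<epsilon> \<and> \<epsilon> \<le> b \<Longrightarrow> \<forall>\<^sub>F n in sequentially. n \<ge> 1 \<and> ennreal (exp (real n * t)) < B n \<epsilon>"
      by blast
    have pos: "min a b > 0" using ab by auto
    have "\<forall>\<^sub>F n in sequentially. n \<ge> 1 \<and> ennreal (exp (real n * (s + t))) \<le> C n (min a b)"
    proof (rule eventually_mono)
      show "\<forall>\<^sub>F n in sequentially. (n \<ge> 1 \<and> ennreal (exp (real n * s)) < A n (min a b)) \<and>
          (n \<ge> 1 \<and> ennreal (exp (real n * t)) < B n (min a b))"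
        using pos by (intro eventually_conj ab(3,4)) auto
    qed (use key[OF pos] in blast)
    then show "ereal (s + t) \<le> lower_rate C" by (rule le_lower_rateI[OF anti(3) pos])
  qed
  show "lower_rate A + upper_rate B \<le> upper_rate C" if "sum_defined (lower_rate A) (upper_rate B)"
  proof (rule add_le_erealI[OF that])
    fix s t assume "ereal s < lower_rate A" "ereal t < upper_rate B"
    from less_lower_rateD[OF anti(1) this(1)] less_upper_rateD[OF anti(2) this(2)]
    obtain a b where ab: "a > 0" "b > 0"
      "\<And>\<epsilon>. 0 < \<epsilon> \<and> \<epsilon> \<le> a \<Longrightarrow> \<forall>\<^sub>F n in sequentially. n \<ge> 1 \<and> ennreal (exp (real n * s)) < A n \<epsilon>"
      "\<And>\<epsilon>. 0 < \<epsilon> \<and> \<epsilon> \<le> b \<Longrightarrow> \<exists>\<^sub>F n in sequentially. n \<ge> 1 \<and> ennreal (exp (real n * t)) < B n \<epsilon>"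
      by blast
    have pos: "min a b > 0" using ab by auto
    have "\<exists>\<^sub>F n in sequentially. n \<ge> 1 \<and> ennreal (exp (real n * (s + t))) \<le> C n (min a b)"
    proof (rule frequently_elim1)
      show "\<exists>\<^sub>F n in sequentially. (n \<ge> 1 \<and> ennreal (exp (real n * t)) < B n (min a b)) \<and>
          (n \<ge> 1 \<and> ennreal (exp (real n * s)) < A n (min a b))"
        using pos by (intro frequently_eventually_frequently ab(3,4)) auto
    qed (use key[OF pos] in blast)
    then show "ereal (s + t) \<le> upper_rate C" by (rule le_upper_rateI[OF anti(3) pos])
  qed
qed

text \<open>A factor 2 in the scale is invisible after the limit in \<open>\<epsilon>\<close>, and a
  factor \<open>exp (n \<eta>)\<close> moves a rate by at most \<open>\<eta>\<close>, so neither can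
  separate the two rates.\<close>

lemma
  assumes anti: "scale_antimono Q" "scale_antimono P"
    and QP: "\<And>n \<epsilon>. n \<ge> 1 \<Longrightarrow> \<epsilon> > 0 \<Longrightarrow> Q n \<epsilon> \<le> P n \<epsilon>"
    and PQ: "\<And>\<eta>. \<eta> > 0 \<Longrightarrow> \<exists>\<delta>>0. \<forall>n \<epsilon>. n \<ge> 1 \<and> 0 < \<epsilon> \<and> \<epsilon> < \<delta> \<longrightarrow>
        ennreal (exp (- (real n * \<eta>))) * P n (2 * \<epsilon>) \<le> Q n \<epsilon>"
  shows lower_rate_eqI: "lower_rate Q = lower_rate P"
    and upper_rate_eqI: "upper_rate Q = upper_rate P"
proof -
  have key: "\<exists>\<epsilon>'>0. \<forall>n s. n \<ge> 1 \<and> Q n \<epsilon>' < ennreal (exp (real n * s)) \<longrightarrow>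
      n \<ge> 1 \<and> P n \<epsilon> \<le> ennreal (exp (real n * (s + t)))" if "\<epsilon> > 0" "t > 0" for \<epsilon> t
  proof -
    obtain \<delta> where \<delta>: "\<delta> > 0" "\<And>n \<epsilon>. n \<ge> 1 \<Longrightarrow> 0 < \<epsilon> \<Longrightarrow> \<epsilon> < \<delta> \<Longrightarrow>
        ennreal (exp (- (real n * t))) * P n (2 * \<epsilon>) \<le> Q n \<epsilon>"
      using PQ[OF \<open>t > 0\<close>] by blast
    define \<epsilon>' where "\<epsilon>' = min (\<epsilon> / 2) (\<delta> / 2)"
    have e': "0 < \<epsilon>'" "\<epsilon>' < \<delta>" "2 * \<epsilon>' \<le> \<epsilon>" using \<delta>(1) that by (auto simp: \<epsilon>'_def)
    have "P n \<epsilon> \<le> ennreal (exp (real n * (s + t)))"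
      if n: "n \<ge> 1" "Q n \<epsilon>' < ennreal (exp (real n * s))" for n s
    proof -
      have "P n \<epsilon> \<le> P n (2 * \<epsilon>')" using anti(2) n e' by (auto simp: scale_antimono_def)
      also have "\<dots> = ennreal (exp (real n * t)) * (ennreal (exp (- (real n * t))) * P n (2 * \<epsilon>'))"
        by (simp add: mult.assoc[symmetric] exp_mult_ennreal)
      also have "\<dots> \<le> ennreal (exp (real n * t)) * ennreal (exp (real n * s))"
        using \<delta>(2)[OF n(1) e'(1,2)] n(2) by (intro mult_left_mono) auto
      also have "\<dots> = ennreal (exp (real n * (s + t)))"
        by (simp add: exp_mult_ennreal algebra_simps)
      finally show ?thesis .
    qed
    then show ?thesis using e'(1) by blast
  qed
  have "lower_rate Q \<le> lower_rate P"
    unfolding lower_rate_SUP[OF anti(1)] lower_rate_SUP[OF anti(2)]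
    by (intro SUP_subset_mono order.refl Liminf_mono eventually_sequentiallyI[of 1] log_ennreal_rate_mono)
       (auto intro: QP)
  \<comment> \<open>The summand 0 makes \<open>le_add_erealI\<close> provide an arbitrary
    \<open>t > 0\<close>, which serves as the exponential loss.\<close>
  moreover have "lower_rate P \<le> lower_rate Q + 0"
  proof (rule le_add_erealI, simp add: sum_defined_def, rule lower_rate_leI[OF anti(2)])
    fix s t \<epsilon> assume st: "lower_rate Q < ereal s" "0 < ereal t" "(\<epsilon>::real) > 0"
    then obtain \<epsilon>' where e': "\<epsilon>' > 0" "\<And>n s. n \<ge> 1 \<and> Q n \<epsilon>' < ennreal (exp (real n * s)) \<Longrightarrow>
      n \<ge> 1 \<and> P n \<epsilon> \<le> ennreal (exp (real n * (s + t)))"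
      using key[of \<epsilon> t] by auto
    show "\<exists>\<^sub>F n in sequentially. n \<ge> 1 \<and> P n \<epsilon> \<le> ennreal (exp (real n * (s + t)))"
      using lower_rate_lessD[OF anti(1) st(1) e'(1)] e'(2) by (rule frequently_elim1)
  qed
  ultimately show "lower_rate Q = lower_rate P" by simp
  have "upper_rate Q \<le> upper_rate P"
    unfolding upper_rate_SUP[OF anti(1)] upper_rate_SUP[OF anti(2)]
    by (intro SUP_subset_mono order.refl Limsup_mono eventually_sequentiallyI[of 1] log_ennreal_rate_mono)
       (auto intro: QP)
  moreover have "upper_rate P \<le> upper_rate Q + 0"
  proof (rule le_add_erealI, simp add: sum_defined_def, rule upper_rate_leI[OF anti(2)])
    fix s t \<epsilon> assume st: "upper_rate Q < ereal s" "0 < ereal t" "(\<epsilon>::real) > 0"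
    then obtain \<epsilon>' where e': "\<epsilon>' > 0" "\<And>n s. n \<ge> 1 \<and> Q n \<epsilon>' < ennreal (exp (real n * s)) \<Longrightarrow>
      n \<ge> 1 \<and> P n \<epsilon> \<le> ennreal (exp (real n * (s + t)))"
      using key[of \<epsilon> t] by auto
    show "\<forall>\<^sub>F n in sequentially. n \<ge> 1 \<and> P n \<epsilon> \<le> ennreal (exp (real n * (s + t)))"
      using upper_rate_lessD[OF anti(1) st(1) e'(1)] e'(2) by (rule eventually_mono)
  qed
  ultimately show "upper_rate Q = upper_rate P" by simp
qed

subsection \<open>Lower and upper pressures of products\<close>

lemma exp_birkhoff_prod:
  "ennreal (exp (birkhoff_sum (prod_maps T R) (dotplus f g) n (x, y))) =
     ennreal (exp (birkhoff_sum T f n x)) * ennreal (exp (birkhoff_sum R g n y))"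
  by (simp add: birkhoff_sum_prod exp_mult_ennreal)

lemma scale_antimono_Q_sum: "scale_antimono (Q_sum X T f Z)"
  unfolding scale_antimono_def Q_sum_def
proof (intro allI impI INF_superset_mono order.refl)
  fix n a b assume "(a::real) \<le> b"
  then show "{F. spanning X T Z n a F} \<subseteq> {F. spanning X T Z n b F}"
    unfolding spanning_def by (fastforce intro: order.trans)
qed

lemma scale_antimono_P_sum: "scale_antimono (P_sum X T f Z)"
  unfolding scale_antimono_def P_sum_def
proof (intro allI impI SUP_subset_mono order.refl)
  fix n a b assume "(a::real) \<le> b"
  then show "{F. separated X T Z n b F} \<subseteq> {F. separated X T Z n a F}"
    unfolding separated_def by (auto intro: le_less_trans)
qed

context bowen_system
begin

text \<open>A maximal separated set is spanning, so it competes in the infimum and in the supremum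
  at once.\<close>

lemma Q_sum_le_P_sum:
  assumes "n \<ge> 1" "\<epsilon> > 0" "Z \<subseteq> mspace (X 0)"
  shows "Q_sum X T f Z n \<epsilon> \<le> P_sum X T f Z n \<epsilon>"
proof -
  obtain E where E: "separated X T Z n \<epsilon> E" "\<forall>x\<in>Z. \<exists>y\<in>E. bowen_dist X T n x y \<le> \<epsilon>"
    using ex_maximal_separated[OF assms] by blast
  have "spanning X T Z n \<epsilon> E" using E assms(3) by (auto simp: spanning_def separated_def)
  then show ?thesis unfolding Q_sum_def P_sum_def using E(1) by (intro INF_lower2[OF _ SUP_upper]) auto
qed

text \<open>Sending a point of a \<open>2 * \<epsilon>\<close>-separated set to a nearby point of an
  \<open>\<epsilon>\<close>-spanning set is injective, and equicontinuity limits the change of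
  weight to the factor \<open>exp (real n * \<eta>)\<close>.\<close>

lemma P_sum_le_Q_sum:
  assumes "equicontinuous_seq X f" "Z \<subseteq> mspace (X 0)" "\<eta> > 0"
  shows "\<exists>\<delta>>0. \<forall>n \<epsilon>. n \<ge> 1 \<and> 0 < \<epsilon> \<and> \<epsilon> < \<delta> \<longrightarrow>
    ennreal (exp (- (real n * \<eta>))) * P_sum X T f Z n (2 * \<epsilon>) \<le> Q_sum X T f Z n \<epsilon>"
proof -
  obtain \<delta> where \<delta>: "\<delta> > 0" "\<And>n x y. n \<ge> 1 \<Longrightarrow> x \<in> mspace (X 0) \<Longrightarrow> y \<in> mspace (X 0) \<Longrightarrow>
      bowen_dist X T n x y < \<delta> \<Longrightarrow> \<bar>birkhoff_sum T f n x - birkhoff_sum T f n y\<bar> \<le> real n * \<eta>"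
    using equicontinuous_birkhoff[OF assms(1,3)] by blast
  have "ennreal (exp (- (real n * \<eta>))) * P_sum X T f Z n (2 * \<epsilon>) \<le> Q_sum X T f Z n \<epsilon>"
    if n: "n \<ge> 1" and e: "0 < \<epsilon>" "\<epsilon> < \<delta>" for n \<epsilon>
    unfolding Q_sum_def
  proof (rule INF_greatest)
    fix F assume F: "F \<in> {F. spanning X T Z n \<epsilon> F}"
    let ?h = "\<lambda>x. ennreal (exp (birkhoff_sum T f n x))"
    have "infsum ?h E \<le> ennreal (exp (real n * \<eta>)) * infsum ?h F" if E: "separated X T Z n (2 * \<epsilon>) E" for E
    proof (rule infsum_le_finite_sums)
      have "\<forall>x\<in>E. \<exists>y. y \<in> F \<and> bowen_dist X T n x y \<le> \<epsilon>"
        using F E unfolding spanning_def separated_def by auto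
      then obtain c where c: "\<And>x. x \<in> E \<Longrightarrow> c x \<in> F \<and> bowen_dist X T n x (c x) \<le> \<epsilon>" by metis
      have m: "x \<in> mspace (X 0)" "c x \<in> mspace (X 0)" if "x \<in> E" for x
        using that E F c[OF that] assms(2) by (auto simp: separated_def spanning_def)
      have inj: "inj_on c E"
      proof (rule inj_onI)
        fix x y assume xy: "x \<in> E" "y \<in> E" "c x = c y"
        have "bowen_dist X T n (c x) y \<le> \<epsilon>"
          using c[OF xy(2)] xy(3) by (metis bowen_dist_commute)
        then have "bowen_dist X T n x y \<le> \<epsilon> + \<epsilon>"
          using c[OF xy(1)] m xy n by (intro bowen_dist_triangle[of n x "c x" y]) auto
        then show "x = y" using E xy unfolding separated_def by force
      qed
      fix K assume K: "finite K" "K \<subseteq> E"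
      have "sum ?h K \<le> (\<Sum>x\<in>K. ennreal (exp (real n * \<eta>)) * ?h (c x))"
      proof (rule sum_mono)
        fix x assume "x \<in> K"
        then have x: "x \<in> E" using K by auto
        have "\<bar>birkhoff_sum T f n x - birkhoff_sum T f n (c x)\<bar> \<le> real n * \<eta>"
          using c[OF x] e by (intro \<delta>(2) n m x) auto
        then show "?h x \<le> ennreal (exp (real n * \<eta>)) * ?h (c x)"
          by (simp add: exp_mult_ennreal ennreal_leI)
      qed
      also have "\<dots> = ennreal (exp (real n * \<eta>)) * sum ?h (c ` K)"
        using inj_on_subset[OF inj K(2)] by (simp add: sum.reindex sum_distrib_left del: sum_ennreal)
      also have "\<dots> \<le> ennreal (exp (real n * \<eta>)) * infsum ?h F"
        using K c by (intro mult_left_mono sum_le_infsum_ennreal) auto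
      finally show "sum ?h K \<le> ennreal (exp (real n * \<eta>)) * infsum ?h F" .
    qed (rule nonneg_summable_on_complete, simp)
    then have "P_sum X T f Z n (2 * \<epsilon>) \<le> ennreal (exp (real n * \<eta>)) * infsum ?h F"
      unfolding P_sum_def by (intro SUP_least) auto
    then have "ennreal (exp (- (real n * \<eta>))) * P_sum X T f Z n (2 * \<epsilon>)
        \<le> ennreal (exp (- (real n * \<eta>))) * (ennreal (exp (real n * \<eta>)) * infsum ?h F)"
      by (rule mult_left_mono) simp
    also have "\<dots> = infsum ?h F"
      by (simp add: mult.assoc[symmetric] exp_mult_ennreal)
    finally show "ennreal (exp (- (real n * \<eta>))) * P_sum X T f Z n (2 * \<epsilon>) \<le> infsum ?h F" .
  qed
  then show ?thesis using \<delta>(1) by blast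
qed

lemma
  assumes "equicontinuous_seq X f" "Z \<subseteq> mspace (X 0)"
  shows lower_rate_Q_eq_P: "lower_rate (Q_sum X T f Z) = lower_rate (P_sum X T f Z)"
    and upper_rate_Q_eq_P: "upper_rate (Q_sum X T f Z) = upper_rate (P_sum X T f Z)"
  using assms
  by (auto intro!: lower_rate_eqI upper_rate_eqI scale_antimono_Q_sum scale_antimono_P_sum
      Q_sum_le_P_sum P_sum_le_Q_sum simp del: One_nat_def)

text \<open>The definite descriptions have a value because the spanning and the separated rate
  coincide.\<close>

lemma
  assumes "equicontinuous_seq X f" "Z \<subseteq> mspace (X 0)"
  shows lower_pressure_eq_Q: "lower_pressure X T f Z = lower_rate (Q_sum X T f Z)"
    and upper_pressure_eq_Q: "upper_pressure X T f Z = upper_rate (Q_sum X T f Z)"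
  unfolding lower_pressure_def upper_pressure_def lower_Q_def lower_P_def upper_Q_def upper_P_def
    lower_rate_def[symmetric] upper_rate_def[symmetric]
    lower_rate_Q_eq_P[OF assms] upper_rate_Q_eq_P[OF assms]
  by simp_all

end

lemma Q_sum_prod_le:
  assumes "n \<ge> 1" "Q_sum X T f Z n \<epsilon> < a" "Q_sum Y R g W n \<epsilon> < b"
  shows "Q_sum (prod_spaces X Y) (prod_maps T R) (dotplus f g) (Z \<times> W) n \<epsilon> \<le> a * b"
proof -
  obtain F G where F: "spanning X T Z n \<epsilon> F" "(\<Sum>\<^sub>\<infinity>x\<in>F. ennreal (exp (birkhoff_sum T f n x))) < a"
    and G: "spanning Y R W n \<epsilon> G" "(\<Sum>\<^sub>\<infinity>y\<in>G. ennreal (exp (birkhoff_sum R g n y))) < b"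
    using assms(2,3) unfolding Q_sum_def by (auto simp: INF_less_iff)
  have "spanning (prod_spaces X Y) (prod_maps T R) (Z \<times> W) n \<epsilon> (F \<times> G)"
    using F(1) G(1) assms(1) by (fastforce simp: spanning_def bowen_dist_prod_le_iff)
  then have "Q_sum (prod_spaces X Y) (prod_maps T R) (dotplus f g) (Z \<times> W) n \<epsilon>
      \<le> (\<Sum>\<^sub>\<infinity>p\<in>F \<times> G. ennreal (exp (birkhoff_sum (prod_maps T R) (dotplus f g) n p)))"
    unfolding Q_sum_def by (intro INF_lower) simp
  also have "\<dots> = (\<Sum>\<^sub>\<infinity>(x, y)\<in>F \<times> G. ennreal (exp (birkhoff_sum T f n x)) * ennreal (exp (birkhoff_sum R g n y)))"
    by (intro infsum_cong) (auto simp: exp_birkhoff_prod)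
  also have "\<dots> \<le> (\<Sum>\<^sub>\<infinity>x\<in>F. ennreal (exp (birkhoff_sum T f n x))) * (\<Sum>\<^sub>\<infinity>y\<in>G. ennreal (exp (birkhoff_sum R g n y)))"
    by (rule infsum_Times_le_ennreal)
  also have "\<dots> \<le> a * b" using F(2) G(2) by (intro mult_mono) auto
  finally show ?thesis .
qed

lemma P_sum_prod_ge:
  assumes "n \<ge> 1" "a < P_sum X T f Z n \<epsilon>" "b < P_sum Y R g W n \<epsilon>"
  shows "a * b \<le> P_sum (prod_spaces X Y) (prod_maps T R) (dotplus f g) (Z \<times> W) n \<epsilon>"
proof -
  let ?h = "\<lambda>x. ennreal (exp (birkhoff_sum T f n x))" and ?k = "\<lambda>y. ennreal (exp (birkhoff_sum R g n y))"
  let ?m = "\<lambda>p. ennreal (exp (birkhoff_sum (prod_maps T R) (dotplus f g) n p))"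
  obtain E0 D0 where E0: "separated X T Z n \<epsilon> E0" "a < infsum ?h E0"
    and D0: "separated Y R W n \<epsilon> D0" "b < infsum ?k D0"
    using assms(2,3) unfolding P_sum_def by (auto simp: less_SUP_iff)
  \<comment> \<open>Finite subsets still exceed \<open>a\<close> and \<open>b\<close>, and they turn
    the product of the sums into a finite double sum.\<close>
  obtain E D where E: "finite E" "E \<subseteq> E0" "a < sum ?h E" and D: "finite D" "D \<subseteq> D0" "b < sum ?k D"
    using less_infsum_ennrealD[OF E0(2)] less_infsum_ennrealD[OF D0(2)] by blast
  have sep: "separated (prod_spaces X Y) (prod_maps T R) (Z \<times> W) n \<epsilon> (E \<times> D)"
    unfolding separated_def
  proof (intro conjI ballI impI)
    show "E \<times> D \<subseteq> Z \<times> W" using E0 D0 E D by (auto simp: separated_def)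
    fix p q assume pq: "p \<in> E \<times> D" "q \<in> E \<times> D" "p \<noteq> q"
    obtain x y x' y' where [simp]: "p = (x, y)" "q = (x', y')" by (meson surj_pair)
    \<comment> \<open>Distinct pairs differ in some coordinate, and for the maximum metric
      separation in that coordinate suffices.\<close>
    have "\<not> (bowen_dist X T n x x' \<le> \<epsilon> \<and> bowen_dist Y R n y y' \<le> \<epsilon>)"
    proof (cases "x = x'")
      case True
      then have "y \<noteq> y'" "y \<in> D0" "y' \<in> D0" using pq D by auto
      then show ?thesis using D0(1) by (auto simp: separated_def not_le)
    next
      case False
      moreover have "x \<in> E0" "x' \<in> E0" using pq E by auto
      ultimately show ?thesis using E0(1) by (auto simp: separated_def not_le)
    qed
    then show "\<epsilon> < bowen_dist (prod_spaces X Y) (prod_maps T R) n p q"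
      using bowen_dist_prod_le_iff[OF assms(1), of X Y T R x y x' y' \<epsilon>] by (simp flip: not_le)
  qed
  have "a * b \<le> sum ?h E * sum ?k D" using E(3) D(3) by (intro mult_mono) auto
  also have "\<dots> = sum ?m (E \<times> D)"
    unfolding sum_product sum.cartesian_product by (intro sum.cong) (auto simp only: exp_birkhoff_prod)
  also have "\<dots> = infsum ?m (E \<times> D)" using E(1) D(1) by (simp add: infsum_finite)
  also have "\<dots> \<le> P_sum (prod_spaces X Y) (prod_maps T R) (dotplus f g) (Z \<times> W) n \<epsilon>"
    unfolding P_sum_def using sep by (intro SUP_upper) simp
  finally show ?thesis .
qed

text \<open>The equality hypothesis enters in the upper bound for the lower pressure and in the
  lower bound for the upper pressure: the factor with equal pressures supplies the control at all
  large levels. If this is the second factor, the summands are exchanged first.\<close>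

lemma
  assumes "bowen_system X T" "bowen_system Y R"
    and "Z \<subseteq> mspace (X 0)" "W \<subseteq> mspace (Y 0)"
    and "equicontinuous_seq X f" "equicontinuous_seq Y g"
    and def: "sum_defined (lower_pressure X T f Z) (lower_pressure Y R g W)"
      "sum_defined (upper_pressure X T f Z) (upper_pressure Y R g W)"
    and eq: "lower_pressure X T f Z = upper_pressure X T f Z \<or>
       lower_pressure Y R g W = upper_pressure Y R g W"
  shows lower_pressure_prod: "lower_pressure (prod_spaces X Y) (prod_maps T R) (dotplus f g) (Z \<times> W)
        = lower_pressure X T f Z + lower_pressure Y R g W" (is ?L)
    and upper_pressure_prod: "upper_pressure (prod_spaces X Y) (prod_maps T R) (dotplus f g) (Z \<times> W)
        = upper_pressure X T f Z + upper_pressure Y R g W" (is ?U)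
proof -
  interpret A: bowen_system X T by fact
  interpret B: bowen_system Y R by fact
  interpret C: bowen_system "prod_spaces X Y" "prod_maps T R" by (rule bowen_system_prod) fact+
  have eqC: "equicontinuous_seq (prod_spaces X Y) (dotplus f g)" by (rule equicontinuous_dotplus) fact+
  have ZW: "Z \<times> W \<subseteq> mspace (prod_spaces X Y 0)" using assms(3,4) by auto
  note Q = A.lower_pressure_eq_Q[OF assms(5,3)] A.upper_pressure_eq_Q[OF assms(5,3)]
    B.lower_pressure_eq_Q[OF assms(6,4)] B.upper_pressure_eq_Q[OF assms(6,4)]
    C.lower_pressure_eq_Q[OF eqC ZW] C.upper_pressure_eq_Q[OF eqC ZW]
  note P = A.lower_rate_Q_eq_P[OF assms(5,3)] A.upper_rate_Q_eq_P[OF assms(5,3)]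
    B.lower_rate_Q_eq_P[OF assms(6,4)] B.upper_rate_Q_eq_P[OF assms(6,4)]
    C.lower_rate_Q_eq_P[OF eqC ZW] C.upper_rate_Q_eq_P[OF eqC ZW]
  note anti = scale_antimono_Q_sum scale_antimono_P_sum
  have Qle: "Q_sum (prod_spaces X Y) (prod_maps T R) (dotplus f g) (Z \<times> W) n \<epsilon> \<le> b * a"
    if "n \<ge> 1" "Q_sum Y R g W n \<epsilon> < b" "Q_sum X T f Z n \<epsilon> < a" for n \<epsilon> a b
    using Q_sum_prod_le[OF that(1,3,2)] by (simp add: mult.commute)
  have Pge: "b * a \<le> P_sum (prod_spaces X Y) (prod_maps T R) (dotplus f g) (Z \<times> W) n \<epsilon>"
    if "n \<ge> 1" "b < P_sum Y R g W n \<epsilon>" "a < P_sum X T f Z n \<epsilon>" for n \<epsilon> a b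
    using P_sum_prod_ge[OF that(1,3,2)] by (simp add: mult.commute)
  show ?L
  proof (rule antisym)
    show "lower_pressure (prod_spaces X Y) (prod_maps T R) (dotplus f g) (Z \<times> W)
        \<le> lower_pressure X T f Z + lower_pressure Y R g W"
      using eq
    proof
      assume eq: "lower_pressure X T f Z = upper_pressure X T f Z"
      show ?thesis
        using def(1) unfolding eq unfolding Q
        by (intro lower_rate_mult_le anti Q_sum_prod_le)
    next
      assume eq: "lower_pressure Y R g W = upper_pressure Y R g W"
      show ?thesis
        using def(1) unfolding eq unfolding Q
        by (subst add.commute, intro lower_rate_mult_le anti Qle) (auto simp: sum_defined_def)
    qed
    show "lower_pressure X T f Z + lower_pressure Y R g W
        \<le> lower_pressure (prod_spaces X Y) (prod_maps T R) (dotplus f g) (Z \<times> W)"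
      using def(1) unfolding Q P by (intro lower_rate_mult_ge anti P_sum_prod_ge)
  qed
  show ?U
  proof (rule antisym)
    show "upper_pressure X T f Z + upper_pressure Y R g W
        \<le> upper_pressure (prod_spaces X Y) (prod_maps T R) (dotplus f g) (Z \<times> W)"
      using eq
    proof
      assume eq: "lower_pressure X T f Z = upper_pressure X T f Z"
      show ?thesis
        using def(2) unfolding eq[symmetric] unfolding Q P
        by (intro upper_rate_mult_ge anti P_sum_prod_ge)
    next
      assume eq: "lower_pressure Y R g W = upper_pressure Y R g W"
      show ?thesis
        using def(2) unfolding eq[symmetric] unfolding Q P
        by (subst add.commute, intro upper_rate_mult_ge anti Pge) (auto simp: sum_defined_def)
    qed
    show "upper_pressure (prod_spaces X Y) (prod_maps T R) (dotplus f g) (Z \<times> W)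
        \<le> upper_pressure X T f Z + upper_pressure Y R g W"
      using def(2) unfolding Q by (intro upper_rate_mult_le anti Q_sum_prod_le)
  qed
qed

subsection \<open>Bowen and packing pressures\<close>

text \<open>The shape shared by the Bowen and the packing pressure. Only whether
  \<open>M s \<epsilon>\<close> vanishes matters.\<close>

definition crit_limit :: "(real \<Rightarrow> real \<Rightarrow> ennreal) \<Rightarrow> ereal" where
  "crit_limit M = Lim (at_right 0) (\<lambda>\<epsilon>. Inf {ereal s | s. M s \<epsilon> = 0})"

text \<open>Monotonicity in \<open>s\<close> makes the set of exponents with value 0 upward closed;
  monotonicity in \<open>\<epsilon>\<close> makes the critical exponents grow as the scale shrinks,
  so that the limit in \<open>crit_limit\<close> is a supremum.\<close>

definition crit_family :: "(real \<Rightarrow> real \<Rightarrow> ennreal) \<Rightarrow> bool" where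
  "crit_family M \<longleftrightarrow> (\<forall>s s' \<epsilon> \<epsilon>'. s \<le> s' \<longrightarrow> \<epsilon> \<le> \<epsilon>' \<longrightarrow> M s' \<epsilon>' \<le> M s \<epsilon>)"

lemma crit_familyD: "crit_family M \<Longrightarrow> M s \<epsilon> = 0 \<Longrightarrow> s \<le> s' \<Longrightarrow> \<epsilon> \<le> \<epsilon>' \<Longrightarrow> M s' \<epsilon>' = 0"
  unfolding crit_family_def by (metis le_zero_eq)

lemma crit_limit_SUP:
  assumes "crit_family M"
  shows "crit_limit M = (SUP \<epsilon>\<in>{0<..}. Inf {ereal s | s. M s \<epsilon> = 0})"
  unfolding crit_limit_def
  by (rule Lim_at_right_0_antimono, rule Inf_superset_mono) (auto intro: crit_familyD[OF assms])

lemma crit_limit_lessD: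
  assumes "crit_family M" "crit_limit M < ereal s" "\<epsilon> > 0"
  shows "M s \<epsilon> = 0"
proof -
  have "Inf {ereal s | s. M s \<epsilon> = 0} \<le> crit_limit M"
    unfolding crit_limit_SUP[OF assms(1)] by (rule SUP_upper) (use assms(3) in simp)
  then have "Inf {ereal s | s. M s \<epsilon> = 0} < ereal s" using assms(2) by (rule le_less_trans)
  then obtain s' where "M s' \<epsilon> = 0" "s' < s" by (auto simp: Inf_less_iff)
  then show ?thesis using crit_familyD[OF assms(1)] by auto
qed

text \<open>Vanishing passes to larger scales, so arbitrarily small scales are enough. Constructions
  may therefore change the scale by a constant factor.\<close>

lemma crit_limit_leI:
  assumes "crit_family M" "\<And>\<delta>. \<delta> > 0 \<Longrightarrow> \<exists>\<epsilon>>0. \<epsilon> \<le> \<delta> \<and> M s \<epsilon> = 0"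
  shows "crit_limit M \<le> ereal s"
  unfolding crit_limit_SUP[OF assms(1)]
proof (rule SUP_least, rule Inf_lower)
  fix \<delta> :: real assume "\<delta> \<in> {0<..}"
  then obtain \<epsilon> where "\<epsilon> \<le> \<delta>" "M s \<epsilon> = 0" using assms(2)[of \<delta>] by auto
  then show "ereal s \<in> {ereal s | s. M s \<delta> = 0}" using crit_familyD[OF assms(1)] by auto
qed

lemma less_crit_limitD:
  assumes "crit_family M" "ereal s < crit_limit M"
  shows "\<exists>\<epsilon>0>0. \<forall>\<epsilon>>0. \<epsilon> \<le> \<epsilon>0 \<longrightarrow> M s \<epsilon> \<noteq> 0"
  using crit_limit_leI[OF assms(1), of s] assms(2) by (meson not_less)

section \<open>Weights of single balls, and the families behind the two measures\<close>

definition wt :: "(nat \<Rightarrow> 'a \<Rightarrow> 'a) \<Rightarrow> (nat \<Rightarrow> 'a \<Rightarrow> real) \<Rightarrow> real \<Rightarrow> nat \<Rightarrow> 'a \<Rightarrow> ennreal" where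
  "wt T f s n x = ennreal (exp (- real n * s + birkhoff_sum T f n x))"

lemma weighted_sum_wt: "weighted_sum T f s I n x = (\<Sum>\<^sub>\<infinity>i\<in>I. wt T f s (n i) (x i))"
  by (simp add: weighted_sum_def wt_def)

text \<open>A higher exponent gains exactly the factor that makes the levels summable in
  \<open>exp_tail\<close>.\<close>

lemma wt_shift: "wt T f (s + h) n x = ennreal (exp (- real n * h)) * wt T f s n x"
  by (simp add: wt_def exp_mult_ennreal algebra_simps)

text \<open>The exponent of a product may be split in any way; later proofs choose the split to suit
  the factor under estimate.\<close>

lemma wt_prod:
  "wt (prod_maps T R) (dotplus f g) (s + t) n (x, y) = wt T f s n x * wt R g t n y"
  by (simp add: wt_def exp_mult_ennreal birkhoff_sum_prod algebra_simps)

lemma wt_antimono: "s \<le> s' \<Longrightarrow> wt T f s' n x \<le> wt T f s n x"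
  by (auto simp: wt_def intro!: ennreal_leI mult_left_mono)

text \<open>Moving a centre within the range of \<open>equicontinuous_birkhoff\<close> is paid for
  by a shift of the exponent.\<close>

lemma wt_compare:
  assumes "\<bar>birkhoff_sum T f n x - birkhoff_sum T f n y\<bar> \<le> real n * h"
  shows "wt T f (s + h) n x \<le> wt T f s n y"
  using assms by (auto simp: wt_def algebra_simps intro!: ennreal_leI)

text \<open>The covers built below are countable sets of pairs of a level and a centre; an injection
  into \<open>nat\<close> makes them admissible families. Repeated balls merge in such a set, which
  can only lower the sum.\<close>

lemma bowen_pre_le_countable:
  assumes "countable C" "\<And>n x. (n, x) \<in> C \<Longrightarrow> N \<le> n \<and> x \<in> mspace (X 0)"
    and "Z \<subseteq> (\<Union>(n, x)\<in>C. bowen_ball X T n x \<epsilon>)"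
  shows "bowen_pre X T f Z s N \<epsilon> \<le> (\<Sum>\<^sub>\<infinity>(n, x)\<in>C. wt T f s n x)"
proof -
  define e where "e = to_nat_on C"
  define d where "d = from_nat_into C"
  have inj: "inj_on e C" unfolding e_def by (rule inj_on_to_nat_on) fact
  have de [simp]: "d (e p) = p" if "p \<in> C" for p
    using that assms(1) by (simp add: d_def e_def)
  have "bowen_pre X T f Z s N \<epsilon> \<le> weighted_sum T f s (e ` C) (\<lambda>i. fst (d i)) (\<lambda>i. snd (d i))"
    unfolding bowen_pre_def
  proof (intro Inf_lower CollectI exI conjI refl)
    show "\<forall>i\<in>e ` C. N \<le> fst (d i) \<and> snd (d i) \<in> mspace (X 0)"
      using assms(2) by auto
    show "Z \<subseteq> (\<Union>i\<in>e ` C. bowen_ball X T (fst (d i)) (snd (d i)) \<epsilon>)"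
      using assms(3) by (fastforce simp: case_prod_unfold)
  qed simp
  also have "\<dots> = (\<Sum>\<^sub>\<infinity>p\<in>C. wt T f s (fst p) (snd p))"
    unfolding weighted_sum_wt by (subst infsum_reindex[OF inj]) (auto intro!: infsum_cong)
  finally show ?thesis by (simp add: case_prod_unfold)
qed

lemma bowen_pre_lessD:
  assumes "bowen_pre X T f Z s N \<epsilon> < c"
  shows "\<exists>(I :: nat set) n x. (\<forall>i\<in>I. N \<le> n i \<and> x i \<in> mspace (X 0)) \<and>
    Z \<subseteq> (\<Union>i\<in>I. bowen_ball X T (n i) (x i) \<epsilon>) \<and> (\<Sum>\<^sub>\<infinity>i\<in>I. wt T f s (n i) (x i)) < c"
proof -
  obtain v where v: "v < c" "v \<in> {weighted_sum T f s I n x | I n x.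
      (\<forall>i\<in>I. N \<le> n i \<and> x i \<in> mspace (X 0)) \<and> Z \<subseteq> (\<Union>i\<in>I. bowen_ball X T (n i) (x i) \<epsilon>)}"
    using assms unfolding bowen_pre_def Inf_less_iff by auto
  then obtain I n x where "v = weighted_sum T f s I n x" "\<forall>i\<in>I. N \<le> n i \<and> x i \<in> mspace (X 0)"
    "Z \<subseteq> (\<Union>i\<in>I. bowen_ball X T (n i) (x i) \<epsilon>)" by auto
  note Inx = this
  show ?thesis
  proof (intro exI[of _ I] exI[of _ n] exI[of _ x] conjI)
    show "(\<Sum>\<^sub>\<infinity>i\<in>I. wt T f s (n i) (x i)) < c" using Inx(1) v(1) by (simp add: weighted_sum_wt)
  qed (fact Inx)+
qed

lemma packing_pre_ge_finite:
  assumes "finite E" "E \<subseteq> Z" "N \<le> n" "disjoint_family_on (\<lambda>x. bowen_cball X T n x \<epsilon>) E"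
  shows "(\<Sum>x\<in>E. wt T f s n x) \<le> packing_pre X T f Z s N \<epsilon>"
proof -
  define e where "e = to_nat_on E"
  define d where "d = from_nat_into E"
  have cE: "countable E" using assms(1) by (rule countable_finite)
  have inj: "inj_on e E" unfolding e_def by (rule inj_on_to_nat_on) fact
  have de [simp]: "d (e p) = p" if "p \<in> E" for p
    using that cE by (simp add: d_def e_def)
  have "(\<Sum>x\<in>E. wt T f s n x) = weighted_sum T f s (e ` E) (\<lambda>_. n) d"
    unfolding weighted_sum_wt using assms(1)
    by (simp add: infsum_finite sum.reindex[OF inj])
  also have "\<dots> \<le> packing_pre X T f Z s N \<epsilon>"
    unfolding packing_pre_def
  proof (intro Sup_upper CollectI exI conjI refl)
    show "\<forall>i\<in>e ` E. N \<le> n \<and> d i \<in> Z" using assms by auto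
    show "disjoint_family_on (\<lambda>i. bowen_cball X T n (d i) \<epsilon>) (e ` E)"
      using assms(4) by (fastforce simp: disjoint_family_on_def)
  qed simp
  finally show ?thesis .
qed

lemma incseq_bowen_pre: "incseq (\<lambda>N. bowen_pre X T f Z s N \<epsilon>)"
  unfolding bowen_pre_def by (intro incseq_SucI Inf_superset_mono) (force intro: Suc_leD)

lemma decseq_packing_pre: "decseq (\<lambda>N. packing_pre X T f Z s N \<epsilon>)"
  unfolding packing_pre_def by (intro decseq_SucI Sup_subset_mono) (force intro: Suc_leD)

text \<open>Raising \<open>N\<close> leaves fewer families, so the infimum grows, and the supremum
  in \<open>packing_pre\<close> falls. Thus both occurrences of \<open>lim\<close> denote genuine
  limits.\<close>

lemma bowen_measure_SUP: "bowen_measure X T f Z s \<epsilon> = (SUP N. bowen_pre X T f Z s N \<epsilon>)"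
  unfolding bowen_measure_def by (intro limI LIMSEQ_SUP incseq_bowen_pre)

lemma packing_premeasure_INF: "packing_premeasure X T f Z s \<epsilon> = (INF N. packing_pre X T f Z s N \<epsilon>)"
  unfolding packing_premeasure_def by (intro limI LIMSEQ_INF decseq_packing_pre)

lemma bowen_measure_eq_0_iff:
  "bowen_measure X T f Z s \<epsilon> = 0 \<longleftrightarrow> (\<forall>N. bowen_pre X T f Z s N \<epsilon> = 0)"
  unfolding bowen_measure_SUP by (auto simp: SUP_eq_iff bot_ennreal[symmetric] SUP_bot_conv)

text \<open>The values increase with \<open>N\<close>, so the one at a fixed \<open>N\<close> lies
  below \<open>K M\<close> for all large \<open>M\<close>.\<close>

lemma bowen_measure_zeroI:
  assumes "\<And>N. N \<ge> N0 \<Longrightarrow> bowen_pre X T f Z s N \<epsilon> \<le> K N" "K \<longlonglongrightarrow> (0::ennreal)"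
  shows "bowen_measure X T f Z s \<epsilon> = 0"
  unfolding bowen_measure_eq_0_iff
proof
  fix N
  have "bowen_pre X T f Z s N \<epsilon> \<le> 0"
  proof (rule tendsto_lowerbound[OF assms(2)])
    show "\<forall>\<^sub>F M in sequentially. bowen_pre X T f Z s N \<epsilon> \<le> K M"
      using incseqD[OF incseq_bowen_pre[of X T f Z s \<epsilon>]] assms(1)
      by (intro eventually_sequentiallyI[of "max N N0"]) (meson max.bounded_iff order.trans)
  qed simp
  then show "bowen_pre X T f Z s N \<epsilon> = 0" by simp
qed

lemma packing_premeasure_zeroI:
  assumes "\<And>N. N \<ge> N0 \<Longrightarrow> packing_pre X T f Z s N \<epsilon> \<le> K N" "K \<longlonglongrightarrow> (0::ennreal)"
  shows "packing_premeasure X T f Z s \<epsilon> = 0"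
proof -
  have "packing_premeasure X T f Z s \<epsilon> \<le> 0"
  proof (rule tendsto_lowerbound[OF assms(2)])
    show "\<forall>\<^sub>F M in sequentially. packing_premeasure X T f Z s \<epsilon> \<le> K M"
      unfolding packing_premeasure_INF using assms(1)
      by (intro eventually_sequentiallyI[of N0]) (auto intro: INF_lower2)
  qed simp
  then show ?thesis by simp
qed

lemma bowen_pre_antimono:
  assumes "s \<le> s'" "\<epsilon> \<le> \<epsilon>'"
  shows "bowen_pre X T f Z s' N \<epsilon>' \<le> bowen_pre X T f Z s N \<epsilon>"
  unfolding bowen_pre_def[of X T f Z s N \<epsilon>]
proof (rule Inf_greatest, safe)
  fix I and n :: "nat \<Rightarrow> nat" and x
  assume *: "\<forall>i\<in>I. N \<le> n i \<and> x i \<in> mspace (X 0)" "Z \<subseteq> (\<Union>i\<in>I. bowen_ball X T (n i) (x i) \<epsilon>)"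
  have Z: "Z \<subseteq> (\<Union>i\<in>I. bowen_ball X T (n i) (x i) \<epsilon>')"
    using *(2) bowen_ball_mono[OF assms(2), of X T] by blast
  have "bowen_pre X T f Z s' N \<epsilon>' \<le> weighted_sum T f s' I n x"
    unfolding bowen_pre_def by (intro Inf_lower CollectI exI conjI) (rule refl *(1) Z)+
  also have "\<dots> \<le> weighted_sum T f s I n x"
    unfolding weighted_sum_wt by (intro infsum_mono nonneg_summable_on_complete wt_antimono assms) simp_all
  finally show "bowen_pre X T f Z s' N \<epsilon>' \<le> weighted_sum T f s I n x" .
qed

lemma packing_pre_antimono:
  assumes "s \<le> s'" "\<epsilon> \<le> \<epsilon>'"
  shows "packing_pre X T f Z s' N \<epsilon>' \<le> packing_pre X T f Z s N \<epsilon>"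
  unfolding packing_pre_def[of X T f Z s' N \<epsilon>']
proof (rule Sup_least, safe)
  fix I and n :: "nat \<Rightarrow> nat" and x
  assume *: "\<forall>i\<in>I. N \<le> n i \<and> x i \<in> Z" "disjoint_family_on (\<lambda>i. bowen_cball X T (n i) (x i) \<epsilon>') I"
  have disj: "disjoint_family_on (\<lambda>i. bowen_cball X T (n i) (x i) \<epsilon>) I"
    using *(2) by (rule disjoint_family_on_bisimulation) (use bowen_cball_mono[OF assms(2), of X T] in blast)
  have "weighted_sum T f s' I n x \<le> weighted_sum T f s I n x"
    unfolding weighted_sum_wt by (intro infsum_mono nonneg_summable_on_complete wt_antimono assms) simp_all
  also have "\<dots> \<le> packing_pre X T f Z s N \<epsilon>"
    unfolding packing_pre_def by (intro Sup_upper CollectI exI conjI) (rule refl *(1) disj)+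
  finally show "weighted_sum T f s' I n x \<le> packing_pre X T f Z s N \<epsilon>" .
qed

lemma crit_family_bowen: "crit_family (\<lambda>s \<epsilon>. bowen_measure X T f Z s \<epsilon>)"
  unfolding crit_family_def bowen_measure_SUP by (auto intro: SUP_mono' bowen_pre_antimono)

lemma packing_premeasure_antimono:
  "s \<le> s' \<Longrightarrow> \<epsilon> \<le> \<epsilon>' \<Longrightarrow> packing_premeasure X T f Z s' \<epsilon>' \<le> packing_premeasure X T f Z s \<epsilon>"
  unfolding packing_premeasure_INF by (auto intro: INF_mono' packing_pre_antimono)

lemma crit_family_packing: "crit_family (\<lambda>s \<epsilon>. packing_measure X T f Z s \<epsilon>)"
  unfolding crit_family_def packing_measure_def
proof (intro allI impI Inf_mono, safe)
  fix s s' \<epsilon> \<epsilon>' :: real and A :: "nat \<Rightarrow> 'a set"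
  assume *: "s \<le> s'" "\<epsilon> \<le> \<epsilon>'" "\<forall>i. A i \<subseteq> mspace (X 0)" "Z \<subseteq> (\<Union>i. A i)"
  have "(\<Sum>i. packing_premeasure X T f (A i) s' \<epsilon>') \<le> (\<Sum>i. packing_premeasure X T f (A i) s \<epsilon>)"
    using * by (intro suminf_le packing_premeasure_antimono) auto
  then show "\<exists>a\<in>{\<Sum>i. packing_premeasure X T f (A i) s' \<epsilon>' |A. (\<forall>i. A i \<subseteq> mspace (X 0)) \<and> Z \<subseteq> (\<Union>i. A i)}.
       a \<le> (\<Sum>i. packing_premeasure X T f (A i) s \<epsilon>)"
    using * by blast
qed

lemma bowen_pressure_crit: "bowen_pressure X T f Z = crit_limit (\<lambda>s \<epsilon>. bowen_measure X T f Z s \<epsilon>)"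
  by (simp add: bowen_pressure_def crit_limit_def)

lemma packing_pressure_crit: "packing_pressure X T f Z = crit_limit (\<lambda>s \<epsilon>. packing_measure X T f Z s \<epsilon>)"
  by (simp add: packing_pressure_def crit_limit_def)

text \<open>A sum below 1 keeps each piece below 1, and the infimum over starting levels is
  witnessed by some \<open>N i\<close>. The number 1 is a normalisation: any positive bound could be
  had.\<close>

lemma packing_measure_zeroD:
  assumes "packing_measure X T f Z s \<epsilon> = 0"
  obtains A :: "nat \<Rightarrow> 'a set" and N where "\<And>i. A i \<subseteq> mspace (X 0)" "Z \<subseteq> (\<Union>i. A i)"
    "\<And>i. packing_pre X T f (A i) s (N i) \<epsilon> < 1"
proof -
  have "packing_measure X T f Z s \<epsilon> < 1" using assms by simp
  then obtain A :: "nat \<Rightarrow> 'a set" where A: "\<forall>i. A i \<subseteq> mspace (X 0)" "Z \<subseteq> (\<Union>i. A i)"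
    "(\<Sum>i. packing_premeasure X T f (A i) s \<epsilon>) < 1"
    unfolding packing_measure_def Inf_less_iff by blast
  have "\<exists>N. packing_pre X T f (A i) s N \<epsilon> < 1" for i
  proof -
    have "packing_premeasure X T f (A i) s \<epsilon> \<le> (\<Sum>i. packing_premeasure X T f (A i) s \<epsilon>)"
      using sum_le_suminf[of "\<lambda>i. packing_premeasure X T f (A i) s \<epsilon>" "{i}"] by auto
    then show ?thesis
      using A(3) unfolding packing_premeasure_INF by (meson INF_less_iff le_less_trans UNIV_I)
  qed
  then obtain N where "\<And>i. packing_pre X T f (A i) s (N i) \<epsilon> < 1" by metis
  then show ?thesis using A that by blast
qed

lemma packing_measure_zeroI:
  fixes A :: "nat \<Rightarrow> 'a set"
  assumes "\<And>i. A i \<subseteq> mspace (X 0)" "Z \<subseteq> (\<Union>i. A i)"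
    and "\<And>i. packing_premeasure X T f (A i) s \<epsilon> = 0"
  shows "packing_measure X T f Z s \<epsilon> = 0"
proof -
  have "packing_measure X T f Z s \<epsilon> \<le> (\<Sum>i. packing_premeasure X T f (A i) s \<epsilon>)"
    unfolding packing_measure_def using assms by (intro Inf_lower) blast
  then show ?thesis using assms(3) by simp
qed

lemma ennreal_zeroI_mult:
  fixes a K :: ennreal
  assumes "K < \<infinity>" "\<And>c::real. c > 0 \<Longrightarrow> a \<le> ennreal c * K"
  shows "a = 0"
proof -
  obtain k where k: "K = ennreal k" "k \<ge> 0" using assms(1) by (cases K) auto
  have "a \<le> 0 + ennreal e" if "e > 0" for e
  proof -
    \<comment> \<open>The denominator \<open>k + 1\<close> is positive even when
      \<open>K = 0\<close>.\<close>
    have "a \<le> ennreal (e / (k + 1)) * K" using that k by (intro assms(2)) auto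
    also have "\<dots> = ennreal (e / (k + 1) * k)" unfolding k(1) using k(2) that by (intro ennreal_mult[symmetric]) auto
    also have "\<dots> \<le> ennreal e" using k(2) that mult_left_mono[of k "k + 1" e]
      by (intro ennreal_leI) (simp add: divide_le_eq)
    finally show ?thesis by simp
  qed
  then have "a \<le> 0" by (rule ennreal_le_epsilon)
  then show ?thesis by simp
qed

text \<open>The set \<open>A j\<close> gets a cover of weight below \<open>c * exp (- j)\<close>.
  The budgets add up to \<open>c * exp_tail 1 0\<close>, and \<open>c\<close> is arbitrary.\<close>

lemma bowen_measure_countable_UN:
  fixes A :: "nat \<Rightarrow> 'a set"
  assumes "\<And>j. bowen_measure X T f (A j) s \<epsilon> = 0" "Z \<subseteq> (\<Union>j. A j)"
  shows "bowen_measure X T f Z s \<epsilon> = 0"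
  unfolding bowen_measure_eq_0_iff
proof
  fix N
  show "bowen_pre X T f Z s N \<epsilon> = 0"
  proof (rule ennreal_zeroI_mult[of "exp_tail 1 0"])
    show "exp_tail 1 0 < \<infinity>" by (rule exp_tail_finite) simp
    fix c :: real assume c: "c > 0"
    define C where "C j I n x \<longleftrightarrow> (\<forall>i\<in>I. N \<le> n i \<and> x i \<in> mspace (X 0)) \<and>
        A j \<subseteq> (\<Union>i\<in>I. bowen_ball X T (n i) (x i) \<epsilon>) \<and>
        (\<Sum>\<^sub>\<infinity>i\<in>I. wt T f s (n i) (x i)) < ennreal c * ennreal (exp (- real j * 1))"
      for j and I :: "nat set" and n x
    have "\<exists>I n x. C j I n x" for j
    proof -
      have "bowen_pre X T f (A j) s N \<epsilon> < ennreal c * ennreal (exp (- real j * 1))"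
        using assms(1) c by (simp add: bowen_measure_eq_0_iff flip: ennreal_mult)
      then show ?thesis unfolding C_def by (rule bowen_pre_lessD)
    qed
    then obtain I n x where "\<And>j. C j (I j) (n j) (x j)" by metis
    note P = this[unfolded C_def]
    define D where "D j = (\<lambda>i. (n j i, x j i)) ` I j" for j
    have "bowen_pre X T f Z s N \<epsilon> \<le> (\<Sum>\<^sub>\<infinity>(n, x)\<in>(\<Union>j. D j). wt T f s n x)"
    proof (rule bowen_pre_le_countable)
      show "countable (\<Union>j. D j)" by (auto simp: D_def intro!: countable_UN)
      show "N \<le> n \<and> x \<in> mspace (X 0)" if "(n, x) \<in> (\<Union>j. D j)" for n x
        using that P by (auto simp: D_def)
      show "Z \<subseteq> (\<Union>(n, x)\<in>(\<Union>j. D j). bowen_ball X T n x \<epsilon>)"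
      proof
        fix z assume "z \<in> Z"
        then obtain j where "z \<in> A j" using assms(2) by auto
        then obtain i where "i \<in> I j" "z \<in> bowen_ball X T (n j i) (x j i) \<epsilon>" using P[of j] by auto
        then show "z \<in> (\<Union>(n, x)\<in>(\<Union>j. D j). bowen_ball X T n x \<epsilon>)" by (force simp: D_def)
      qed
    qed
    also have "\<dots> \<le> (\<Sum>\<^sub>\<infinity>j\<in>UNIV. \<Sum>\<^sub>\<infinity>(n, x)\<in>D j. wt T f s n x)"
      by (rule infsum_UNION_le_ennreal)
    also have "\<dots> \<le> (\<Sum>\<^sub>\<infinity>j\<in>UNIV. ennreal c * ennreal (exp (- real j * 1)))"
    proof (rule infsum_mono)
      fix j
      have "(\<Sum>\<^sub>\<infinity>(n, x)\<in>D j. wt T f s n x) \<le> (\<Sum>\<^sub>\<infinity>i\<in>I j. wt T f s (n j i) (x j i))"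
        unfolding D_def using infsum_image_le_ennreal[of "\<lambda>(n, x). wt T f s n x" "\<lambda>i. (n j i, x j i)" "I j"]
        by simp
      also have "\<dots> \<le> ennreal c * ennreal (exp (- real j * 1))" using P[of j] by auto
      finally show "(\<Sum>\<^sub>\<infinity>(n, x)\<in>D j. wt T f s n x) \<le> ennreal c * ennreal (exp (- real j * 1))" .
    qed (rule nonneg_summable_on_complete, simp)+
    also have "\<dots> \<le> ennreal c * (\<Sum>\<^sub>\<infinity>j\<in>UNIV. ennreal (exp (- real j * 1)))"
      by (rule infsum_cmult_le_ennreal)
    also have "\<dots> = ennreal c * exp_tail 1 0" by (simp add: exp_tail_def atLeast_0)
    finally show "bowen_pre X T f Z s N \<epsilon> \<le> ennreal c * exp_tail 1 0" .
  qed
qed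

text \<open>\<open>A n\<close> collects the points treated at level \<open>n\<close>, at cost at
  most \<open>C\<close>; the shift \<open>h\<close> of the exponent makes the costs of all levels
  summable.\<close>

lemma bowen_pre_level_le:
  assumes "Z \<subseteq> (\<Union>n\<in>{N..}. A n)"
    and "\<And>n. n \<ge> N \<Longrightarrow> finite (E n) \<and> E n \<subseteq> mspace (X 0) \<and> A n \<subseteq> (\<Union>z\<in>E n. bowen_ball X T n z \<epsilon>)"
    and "\<And>n. n \<ge> N \<Longrightarrow> (\<Sum>z\<in>E n. wt T f s n z) \<le> C"
  shows "bowen_pre X T f Z (s + h) N \<epsilon> \<le> C * exp_tail h N"
proof -
  have "bowen_pre X T f Z (s + h) N \<epsilon> \<le> (\<Sum>\<^sub>\<infinity>(n, x)\<in>(\<Union>n\<in>{N..}. Pair n ` E n). wt T f (s + h) n x)"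
  proof (rule bowen_pre_le_countable)
    show "countable (\<Union>n\<in>{N..}. Pair n ` E n)"
      using assms(2) by (intro countable_UN) (auto intro: countable_finite)
    show "N \<le> n \<and> x \<in> mspace (X 0)" if "(n, x) \<in> (\<Union>n\<in>{N..}. Pair n ` E n)" for n x
      using that assms(2) by auto
    show "Z \<subseteq> (\<Union>(n, x)\<in>(\<Union>n\<in>{N..}. Pair n ` E n). bowen_ball X T n x \<epsilon>)"
    proof
      fix z assume "z \<in> Z"
      then obtain n where n: "n \<ge> N" "z \<in> A n" using assms(1) by auto
      then obtain x where "x \<in> E n" "z \<in> bowen_ball X T n x \<epsilon>" using assms(2)[of n] by auto
      then show "z \<in> (\<Union>(n, x)\<in>(\<Union>n\<in>{N..}. Pair n ` E n). bowen_ball X T n x \<epsilon>)" using n by force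
    qed
  qed
  also have "\<dots> \<le> (\<Sum>\<^sub>\<infinity>n\<in>{N..}. \<Sum>\<^sub>\<infinity>(n, x)\<in>Pair n ` E n. wt T f (s + h) n x)"
    by (rule infsum_UNION_le_ennreal)
  also have "\<dots> \<le> (\<Sum>\<^sub>\<infinity>n\<in>{N..}. C * ennreal (exp (- real n * h)))"
  proof (rule infsum_mono)
    fix n assume "n \<in> {N..}"
    then have n: "n \<ge> N" by simp
    have "(\<Sum>\<^sub>\<infinity>(n, x)\<in>Pair n ` E n. wt T f (s + h) n x) = (\<Sum>x\<in>E n. wt T f (s + h) n x)"
      using assms(2)[OF n] by (simp add: infsum_finite sum.reindex inj_on_def)
    also have "\<dots> = ennreal (exp (- real n * h)) * (\<Sum>x\<in>E n. wt T f s n x)"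
      by (simp add: wt_shift sum_distrib_left)
    also have "\<dots> \<le> ennreal (exp (- real n * h)) * C"
      using assms(3)[OF n] by (rule mult_left_mono) simp
    finally show "(\<Sum>\<^sub>\<infinity>(n, x)\<in>Pair n ` E n. wt T f (s + h) n x) \<le> C * ennreal (exp (- real n * h))"
      by (simp add: mult.commute)
  qed (rule nonneg_summable_on_complete, simp)+
  also have "\<dots> \<le> C * exp_tail h N" unfolding exp_tail_def by (rule infsum_cmult_le_ennreal)
  finally show ?thesis .
qed

text \<open>A packing is sorted by level. Closed balls contain their centres, so within one level
  disjointness makes the centres distinct, and the family becomes a set to which the bound
  \<open>C\<close> applies.\<close>

lemma (in bowen_system) packing_pre_level_le:
  assumes "N \<ge> 1" "A \<subseteq> mspace (X 0)" "\<epsilon> > 0"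
    and "\<And>n E. n \<ge> N \<Longrightarrow> finite E \<Longrightarrow> E \<subseteq> A \<Longrightarrow>
      disjoint_family_on (\<lambda>x. bowen_cball X T n x \<epsilon>) E \<Longrightarrow> (\<Sum>x\<in>E. wt T f s n x) \<le> C"
  shows "packing_pre X T f A (s + h) N \<epsilon> \<le> C * exp_tail h N"
  unfolding packing_pre_def
proof (rule Sup_least, safe)
  fix I and \<nu> :: "nat \<Rightarrow> nat" and x
  assume I: "\<forall>i\<in>I. N \<le> \<nu> i \<and> x i \<in> A" "disjoint_family_on (\<lambda>i. bowen_cball X T (\<nu> i) (x i) \<epsilon>) I"
  define J where "J n = {i \<in> I. \<nu> i = n}" for n
  have "I = (\<Union>n\<in>{N..}. J n)" using I(1) by (auto simp: J_def)
  then have "weighted_sum T f (s + h) I \<nu> x \<le> (\<Sum>\<^sub>\<infinity>n\<in>{N..}. \<Sum>\<^sub>\<infinity>i\<in>J n. wt T f (s + h) (\<nu> i) (x i))"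
    unfolding weighted_sum_wt using infsum_UNION_le_ennreal[of "\<lambda>i. wt T f (s + h) (\<nu> i) (x i)" J "{N..}"] by simp
  also have "\<dots> \<le> (\<Sum>\<^sub>\<infinity>n\<in>{N..}. C * ennreal (exp (- real n * h)))"
  proof (rule infsum_mono)
    fix n assume "n \<in> {N..}"
    then have n: "n \<ge> N" by simp
    show "(\<Sum>\<^sub>\<infinity>i\<in>J n. wt T f (s + h) (\<nu> i) (x i)) \<le> C * ennreal (exp (- real n * h))"
    proof (rule infsum_le_finite_sums)
      fix K assume K: "finite K" "K \<subseteq> J n"
      have ball: "bowen_cball X T n (x i) \<epsilon> \<inter> bowen_cball X T n (x j) \<epsilon> = {}" if "i \<in> K" "j \<in> K" "i \<noteq> j" for i j
        using that K disjoint_family_onD[OF I(2), of i j] by (auto simp: J_def)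
      have center: "x i \<in> bowen_cball X T n (x i) \<epsilon>" if "i \<in> K" for i
      proof -
        have "x i \<in> mspace (X 0)" using that K I(1) assms(2) by (auto simp: J_def)
        then show ?thesis using n assms by (simp add: bowen_cball_def bowen_dist_self)
      qed
      have inj: "inj_on x K"
      proof (rule inj_onI, rule ccontr)
        fix i j assume "i \<in> K" "j \<in> K" "x i = x j" "i \<noteq> j"
        then show False using ball[of i j] center[of i] by simp
      qed
      have "(\<Sum>i\<in>K. wt T f (s + h) (\<nu> i) (x i)) = (\<Sum>i\<in>K. wt T f (s + h) n (x i))"
        using K by (intro sum.cong) (auto simp: J_def)
      also have "\<dots> = ennreal (exp (- real n * h)) * (\<Sum>y\<in>x ` K. wt T f s n y)"
        by (simp add: sum.reindex[OF inj] wt_shift sum_distrib_left)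
      also have "\<dots> \<le> ennreal (exp (- real n * h)) * C"
      proof (rule mult_left_mono[OF assms(4)[OF n]])
        show "x ` K \<subseteq> A" using K I(1) by (auto simp: J_def)
        show "disjoint_family_on (\<lambda>x. bowen_cball X T n x \<epsilon>) (x ` K)"
          unfolding disjoint_family_on_def using ball by fastforce
      qed (use K in auto)
      finally show "(\<Sum>i\<in>K. wt T f (s + h) (\<nu> i) (x i)) \<le> C * ennreal (exp (- real n * h))"
        by (simp add: mult.commute)
    qed (rule nonneg_summable_on_complete, simp)
  qed (rule nonneg_summable_on_complete, simp)+
  also have "\<dots> \<le> C * exp_tail h N" unfolding exp_tail_def by (rule infsum_cmult_le_ennreal)
  finally show "weighted_sum T f (s + h) I \<nu> x \<le> C * exp_tail h N" .
qed

subsection \<open>Bowen and packing pressures of products\<close>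

context
  fixes X :: "nat \<Rightarrow> 'a metric" and T :: "nat \<Rightarrow> 'a \<Rightarrow> 'a"
    and Y :: "nat \<Rightarrow> 'b metric" and R :: "nat \<Rightarrow> 'b \<Rightarrow> 'b"
    and f :: "nat \<Rightarrow> 'a \<Rightarrow> real" and g :: "nat \<Rightarrow> 'b \<Rightarrow> real"
    and Z :: "'a set" and W :: "'b set"
  assumes sysX: "bowen_system X T" and sysY: "bowen_system Y R"
    and ZX: "Z \<subseteq> mspace (X 0)"
begin

interpretation A: bowen_system X T by (rule sysX)
interpretation B: bowen_system Y R by (rule sysY)
interpretation C: bowen_system "prod_spaces X Y" "prod_maps T R" by (rule bowen_system_prod[OF sysX sysY])

private abbreviation (input) "XY \<equiv> prod_spaces X Y"
private abbreviation (input) "TR \<equiv> prod_maps T R"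
private abbreviation (input) "fg \<equiv> dotplus f g"

text \<open>Every ball of a cover of \<open>Z\<close> is multiplied by a maximal packing of a piece
  \<open>A j\<close>, taken at the level of that ball. The packing has weight at most 1, so the
  product cover costs no more than the cover of \<open>Z\<close>, whatever levels occur in
  it.\<close>

lemma bowen_prod_upper:
  assumes "bowen_pressure X T f Z < ereal s" "packing_pressure Y R g W < ereal t"
  shows "bowen_pressure XY TR fg (Z \<times> W) \<le> ereal (s + t)"
  unfolding bowen_pressure_crit
proof (rule crit_limit_leI[OF crit_family_bowen])
  fix \<delta> :: real assume d: "\<delta> > 0"
  \<comment> \<open>The product cover uses balls of radius \<open>3 * \<epsilon>\<close>, which is
    \<open>\<delta>\<close>.\<close>
  define \<epsilon> where "\<epsilon> = \<delta> / 3"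
  have e: "\<epsilon> > 0" using d by (simp add: \<epsilon>_def)
  have BZ: "bowen_measure X T f Z s \<epsilon> = 0"
    using crit_limit_lessD[OF crit_family_bowen assms(1)[unfolded bowen_pressure_crit] e] .
  have PW: "packing_measure Y R g W t \<epsilon> = 0"
    using crit_limit_lessD[OF crit_family_packing assms(2)[unfolded packing_pressure_crit] e] .
  obtain A :: "nat \<Rightarrow> 'b set" and M where A: "\<And>j. A j \<subseteq> mspace (Y 0)" "W \<subseteq> (\<Union>j. A j)"
    "\<And>j. packing_pre Y R g (A j) t (M j) \<epsilon> < 1"
    using packing_measure_zeroD[OF PW] by blast
  have "bowen_measure XY TR fg (Z \<times> A j) (s + t) (3 * \<epsilon>) = 0" for j
  proof (rule bowen_measure_zeroI[where K = "\<lambda>_. 0" and ?N0.0 = "max 1 (M j)"])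
    \<comment> \<open>Levels from \<open>M j\<close> on make the packing bound available; levels
      from 1 on have a genuine Bowen metric.\<close>
    fix N assume N: "N \<ge> max 1 (M j)"
    have "\<exists>E. finite E \<and> E \<subseteq> A j \<and> disjoint_family_on (\<lambda>x. bowen_cball Y R n x \<epsilon>) E \<and>
        (\<forall>y\<in>A j. \<exists>z\<in>E. bowen_dist Y R n z y \<le> 2 * \<epsilon>)" if "n \<ge> N" for n
      using that N e A(1) by (intro B.ex_maximal_packing) auto
    then obtain E where E: "\<And>n. n \<ge> N \<Longrightarrow> finite (E n)" "\<And>n. n \<ge> N \<Longrightarrow> E n \<subseteq> A j"
        "\<And>n. n \<ge> N \<Longrightarrow> disjoint_family_on (\<lambda>x. bowen_cball Y R n x \<epsilon>) (E n)"
        "\<And>n y. n \<ge> N \<Longrightarrow> y \<in> A j \<Longrightarrow> \<exists>z\<in>E n. bowen_dist Y R n z y \<le> 2 * \<epsilon>"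
      by metis
    have E1: "(\<Sum>y\<in>E n. wt R g t n y) \<le> 1" if "n \<ge> N" for n
    proof -
      have "(\<Sum>y\<in>E n. wt R g t n y) \<le> packing_pre Y R g (A j) t (M j) \<epsilon>"
        using that N by (intro packing_pre_ge_finite E) auto
      also have "\<dots> \<le> 1" using A(3)[of j] by simp
      finally show ?thesis .
    qed
    have "bowen_pre XY TR fg (Z \<times> A j) (s + t) N (3 * \<epsilon>) = 0"
    proof (rule ennreal_zeroI_mult[of 1])
      fix c :: real assume c: "c > 0"
      have "bowen_pre X T f Z s N \<epsilon> < ennreal c" using BZ c by (simp add: bowen_measure_eq_0_iff)
      then obtain I :: "nat set" and \<nu> x where I: "\<forall>i\<in>I. N \<le> \<nu> i \<and> x i \<in> mspace (X 0)"
          "Z \<subseteq> (\<Union>i\<in>I. bowen_ball X T (\<nu> i) (x i) \<epsilon>)" "(\<Sum>\<^sub>\<infinity>i\<in>I. wt T f s (\<nu> i) (x i)) < ennreal c"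
        using bowen_pre_lessD[of X T f Z s N \<epsilon> "ennreal c"] by auto
      define D where "D i = (\<lambda>y. (\<nu> i, (x i, y))) ` E (\<nu> i)" for i
      have "bowen_pre XY TR fg (Z \<times> A j) (s + t) N (3 * \<epsilon>) \<le> (\<Sum>\<^sub>\<infinity>(n, p)\<in>(\<Union>i\<in>I. D i). wt TR fg (s + t) n p)"
      proof (rule bowen_pre_le_countable)
        show "countable (\<Union>i\<in>I. D i)"
          using I(1) by (intro countable_UN) (auto simp: D_def intro!: countable_finite E)
        show "N \<le> n \<and> p \<in> mspace (XY 0)" if "(n, p) \<in> (\<Union>i\<in>I. D i)" for n p
          using that I(1) E(2) A(1) by (fastforce simp: D_def)
        show "Z \<times> A j \<subseteq> (\<Union>(n, p)\<in>(\<Union>i\<in>I. D i). bowen_ball XY TR n p (3 * \<epsilon>))"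
        proof (rule subrelI)
          fix z w assume zw: "(z, w) \<in> Z \<times> A j"
          then obtain i where i: "i \<in> I" "z \<in> bowen_ball X T (\<nu> i) (x i) \<epsilon>" using I(2) by auto
          have n: "\<nu> i \<ge> N" "\<nu> i \<ge> 1" using I(1) i N by auto
          then obtain y where y: "y \<in> E (\<nu> i)" "bowen_dist Y R (\<nu> i) y w \<le> 2 * \<epsilon>" using E(4) zw by blast
          have "z \<in> bowen_ball X T (\<nu> i) (x i) (3 * \<epsilon>)" using i(2) e by (auto simp: bowen_ball_def)
          moreover have "w \<in> bowen_ball Y R (\<nu> i) y (3 * \<epsilon>)"
            using y(2) e zw A(1) by (auto simp: bowen_ball_def)
          ultimately have "(z, w) \<in> bowen_ball XY TR (\<nu> i) (x i, y) (3 * \<epsilon>)"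
            using n by (simp add: bowen_ball_prod)
          moreover have "(\<nu> i, (x i, y)) \<in> (\<Union>i\<in>I. D i)" using i(1) y(1) by (auto simp: D_def)
          ultimately show "(z, w) \<in> (\<Union>(n, p)\<in>(\<Union>i\<in>I. D i). bowen_ball XY TR n p (3 * \<epsilon>))" by blast
        qed
      qed
      also have "\<dots> \<le> (\<Sum>\<^sub>\<infinity>i\<in>I. \<Sum>\<^sub>\<infinity>(n, p)\<in>D i. wt TR fg (s + t) n p)"
        by (rule infsum_UNION_le_ennreal)
      also have "\<dots> \<le> (\<Sum>\<^sub>\<infinity>i\<in>I. wt T f s (\<nu> i) (x i))"
      proof (rule infsum_mono)
        fix i assume "i \<in> I"
        then have n: "\<nu> i \<ge> N" using I(1) by auto
        have "(\<Sum>\<^sub>\<infinity>(n, p)\<in>D i. wt TR fg (s + t) n p) = (\<Sum>y\<in>E (\<nu> i). wt T f s (\<nu> i) (x i) * wt R g t (\<nu> i) y)"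
          using E(1)[OF n] by (simp add: D_def infsum_finite sum.reindex inj_on_def wt_prod)
        also have "\<dots> = wt T f s (\<nu> i) (x i) * (\<Sum>y\<in>E (\<nu> i). wt R g t (\<nu> i) y)"
          by (simp add: sum_distrib_left)
        also have "\<dots> \<le> wt T f s (\<nu> i) (x i) * 1" by (rule mult_left_mono[OF E1[OF n]]) simp
        finally show "(\<Sum>\<^sub>\<infinity>(n, p)\<in>D i. wt TR fg (s + t) n p) \<le> wt T f s (\<nu> i) (x i)" by simp
      qed (rule nonneg_summable_on_complete, simp)+
      also have "\<dots> \<le> ennreal c * 1" using I(3) by simp
      finally show "bowen_pre XY TR fg (Z \<times> A j) (s + t) N (3 * \<epsilon>) \<le> ennreal c * 1" .
    qed simp
    then show "bowen_pre XY TR fg (Z \<times> A j) (s + t) N (3 * \<epsilon>) \<le> 0" by simp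
  qed simp
  then have "bowen_measure XY TR fg (Z \<times> W) (s + t) (3 * \<epsilon>) = 0"
    by (rule bowen_measure_countable_UN) (use A(2) in auto)
  then show "\<exists>\<epsilon>>0. \<epsilon> \<le> \<delta> \<and> bowen_measure XY TR fg (Z \<times> W) (s + t) \<epsilon> = 0"
    using d by (intro exI[of _ \<delta>]) (simp add: \<epsilon>_def)
qed

text \<open>The sum over a fixed level \<open>n\<close> of a packing of a product is controlled by the grid of two
  maximal packings, since no two centres can lie near the same grid point. Losing an exponential
  factor, this suffices for mixed levels.\<close>

lemma packing_prod_upper:
  assumes eqX: "equicontinuous_seq X f" and eqY: "equicontinuous_seq Y g"
    and PZ: "packing_pressure X T f Z < ereal s" and PW: "packing_pressure Y R g W < ereal t"
  shows "packing_pressure XY TR fg (Z \<times> W) \<le> ereal (s + t)"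
proof -
  \<comment> \<open>Smaller exponents that still exceed the pressures leave the gap from which
    \<open>\<eta>\<close> is taken.\<close>
  obtain s' where s': "packing_pressure X T f Z < ereal s'" "s' < s" using ereal_dense2[OF PZ] by auto
  obtain t' where t': "packing_pressure Y R g W < ereal t'" "t' < t" using ereal_dense2[OF PW] by auto
  \<comment> \<open>One third for the oscillation in each factor, one for summing over the
    levels.\<close>
  define \<eta> where "\<eta> = (s - s' + (t - t')) / 3"
  have eta: "\<eta> > 0" using s' t' by (simp add: \<eta>_def)
  have st: "s + t = (s' + \<eta>) + (t' + \<eta>) + \<eta>" by (simp add: \<eta>_def field_simps)
  obtain \<delta>1 where \<delta>1: "\<delta>1 > 0" "\<And>n x y. n \<ge> 1 \<Longrightarrow> x \<in> mspace (X 0) \<Longrightarrow> y \<in> mspace (X 0) \<Longrightarrow>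
      bowen_dist X T n x y < \<delta>1 \<Longrightarrow> \<bar>birkhoff_sum T f n x - birkhoff_sum T f n y\<bar> \<le> real n * \<eta>"
    using A.equicontinuous_birkhoff[OF eqX eta] by blast
  obtain \<delta>2 where \<delta>2: "\<delta>2 > 0" "\<And>n x y. n \<ge> 1 \<Longrightarrow> x \<in> mspace (Y 0) \<Longrightarrow> y \<in> mspace (Y 0) \<Longrightarrow>
      bowen_dist Y R n x y < \<delta>2 \<Longrightarrow> \<bar>birkhoff_sum R g n x - birkhoff_sum R g n y\<bar> \<le> real n * \<eta>"
    using B.equicontinuous_birkhoff[OF eqY eta] by blast
  show ?thesis
    unfolding packing_pressure_crit
  proof (rule crit_limit_leI[OF crit_family_packing])
    fix \<delta> :: real assume d: "\<delta> > 0"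
    \<comment> \<open>The product is packed at scale \<open>2 * \<epsilon>\<close>, which must stay
      below both moduli of equicontinuity and not exceed \<open>\<delta>\<close>.\<close>
    define \<epsilon> where "\<epsilon> = min \<delta> (min \<delta>1 \<delta>2) / 3"
    have e: "\<epsilon> > 0" "2 * \<epsilon> < \<delta>1" "2 * \<epsilon> < \<delta>2" "2 * \<epsilon> \<le> \<delta>" using d \<delta>1(1) \<delta>2(1) by (auto simp: \<epsilon>_def)
    have P0: "packing_measure X T f Z s' \<epsilon> = 0"
      using crit_limit_lessD[OF crit_family_packing s'(1)[unfolded packing_pressure_crit] e(1)] .
    obtain A :: "nat \<Rightarrow> 'a set" and M where A: "\<And>j. A j \<subseteq> mspace (X 0)" "Z \<subseteq> (\<Union>j. A j)"
      "\<And>j. packing_pre X T f (A j) s' (M j) \<epsilon> < 1"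
      using packing_measure_zeroD[OF P0] by blast
    have P0: "packing_measure Y R g W t' \<epsilon> = 0"
      using crit_limit_lessD[OF crit_family_packing t'(1)[unfolded packing_pressure_crit] e(1)] .
    obtain D :: "nat \<Rightarrow> 'b set" and L where D: "\<And>j. D j \<subseteq> mspace (Y 0)" "W \<subseteq> (\<Union>j. D j)"
      "\<And>j. packing_pre Y R g (D j) t' (L j) \<epsilon> < 1"
      using packing_measure_zeroD[OF P0] by blast
    have zero: "packing_premeasure XY TR fg (A i \<times> D j) (s + t) (2 * \<epsilon>) = 0" for i j
    proof (rule packing_premeasure_zeroI[where K = "exp_tail \<eta>" and ?N0.0 = "max 1 (max (M i) (L j))"])
      fix N assume N: "N \<ge> max 1 (max (M i) (L j))"
      have "packing_pre XY TR fg (A i \<times> D j) ((s' + \<eta>) + (t' + \<eta>) + \<eta>) N (2 * \<epsilon>) \<le> 1 * exp_tail \<eta> N"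
      proof (rule C.packing_pre_level_le)
        show "N \<ge> 1" using N by simp
        show "A i \<times> D j \<subseteq> mspace (XY 0)" using A(1) D(1) by auto
        show "0 < 2 * \<epsilon>" using e by simp
        fix n E assume nN: "n \<ge> N" and E: "finite E" "E \<subseteq> A i \<times> D j"
          "disjoint_family_on (\<lambda>x. bowen_cball XY TR n x (2 * \<epsilon>)) E"
        have n: "n \<ge> 1" using nN N by simp
        obtain F where F: "finite F" "F \<subseteq> A i" "disjoint_family_on (\<lambda>x. bowen_cball X T n x \<epsilon>) F"
            "\<forall>x\<in>A i. \<exists>y\<in>F. bowen_dist X T n y x \<le> 2 * \<epsilon>"
          using A.ex_maximal_packing[OF n e(1) A(1)[of i]] by blast
        obtain G where G: "finite G" "G \<subseteq> D j" "disjoint_family_on (\<lambda>x. bowen_cball Y R n x \<epsilon>) G"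
            "\<forall>x\<in>D j. \<exists>y\<in>G. bowen_dist Y R n y x \<le> 2 * \<epsilon>"
          using B.ex_maximal_packing[OF n e(1) D(1)[of j]] by blast
        have "(\<Sum>x\<in>F. wt T f s' n x) \<le> packing_pre X T f (A i) s' (M i) \<epsilon>"
          using N nN by (intro packing_pre_ge_finite F) auto
        then have F1: "(\<Sum>x\<in>F. wt T f s' n x) \<le> 1" using A(3)[of i] by simp
        have "(\<Sum>x\<in>G. wt R g t' n x) \<le> packing_pre Y R g (D j) t' (L j) \<epsilon>"
          using N nN by (intro packing_pre_ge_finite G) auto
        then have G1: "(\<Sum>x\<in>G. wt R g t' n x) \<le> 1" using D(3)[of j] by simp
        obtain c where c: "\<And>x. x \<in> A i \<Longrightarrow> c x \<in> F \<and> bowen_dist X T n (c x) x \<le> 2 * \<epsilon>" using F(4) by metis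
        obtain d where d: "\<And>x. x \<in> D j \<Longrightarrow> d x \<in> G \<and> bowen_dist Y R n (d x) x \<le> 2 * \<epsilon>" using G(4) by metis
        have inj: "inj_on (map_prod c d) E"
        proof (rule inj_onI, rule ccontr)
          fix p q assume pq: "p \<in> E" "q \<in> E" "map_prod c d p = map_prod c d q" "p \<noteq> q"
          have near: "map_prod c d r \<in> bowen_cball XY TR n r (2 * \<epsilon>)" if "r \<in> E" for r
          proof -
            obtain x y where [simp]: "r = (x, y)" by (meson surj_pair)
            have xy: "x \<in> A i" "y \<in> D j" using that E(2) by auto
            have "c x \<in> mspace (X 0)" "d y \<in> mspace (Y 0)"
              using c[OF xy(1)] d[OF xy(2)] F(2) G(2) A(1) D(1) by blast+
            moreover have "bowen_dist X T n x (c x) \<le> 2 * \<epsilon>" "bowen_dist Y R n y (d y) \<le> 2 * \<epsilon>"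
              using c[OF xy(1)] d[OF xy(2)] by (metis bowen_dist_commute)+
            ultimately show ?thesis using n by (simp add: bowen_cball_def bowen_dist_prod_le_iff)
          qed
          show False
            using near[OF pq(1)] near[OF pq(2)] pq(3) disjoint_family_onD[OF E(3) pq(1,2,4)] by auto
        qed
        have "(\<Sum>p\<in>E. wt TR fg ((s' + \<eta>) + (t' + \<eta>)) n p)
            \<le> (\<Sum>p\<in>E. case map_prod c d p of (x, y) \<Rightarrow> wt T f s' n x * wt R g t' n y)"
        proof (rule sum_mono)
          fix p assume p: "p \<in> E"
          obtain x y where [simp]: "p = (x, y)" by (meson surj_pair)
          have xy: "x \<in> A i" "y \<in> D j" using p E(2) by auto
          have m: "c x \<in> mspace (X 0)" "d y \<in> mspace (Y 0)" "x \<in> mspace (X 0)" "y \<in> mspace (Y 0)"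
            using c[OF xy(1)] d[OF xy(2)] F(2) G(2) A(1) D(1) xy by blast+
          have "bowen_dist X T n x (c x) < \<delta>1" "bowen_dist Y R n y (d y) < \<delta>2"
            using c[OF xy(1)] d[OF xy(2)] e by (metis bowen_dist_commute le_less_trans)+
          then have "wt T f (s' + \<eta>) n x \<le> wt T f s' n (c x)" "wt R g (t' + \<eta>) n y \<le> wt R g t' n (d y)"
            using n m by (auto intro!: wt_compare \<delta>1(2) \<delta>2(2))
          then show "wt TR fg ((s' + \<eta>) + (t' + \<eta>)) n p
              \<le> (case map_prod c d p of (x, y) \<Rightarrow> wt T f s' n x * wt R g t' n y)"
            unfolding \<open>p = (x, y)\<close> map_prod_simp prod.case wt_prod by (rule mult_mono) simp_all
        qed
        also have "\<dots> = (\<Sum>(x, y)\<in>map_prod c d ` E. wt T f s' n x * wt R g t' n y)"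
          by (simp add: sum.reindex[OF inj])
        also have "\<dots> \<le> (\<Sum>(x, y)\<in>F \<times> G. wt T f s' n x * wt R g t' n y)"
          using F(1) G(1) E(2) c d by (intro sum_mono2) auto
        also have "\<dots> = (\<Sum>x\<in>F. wt T f s' n x) * (\<Sum>y\<in>G. wt R g t' n y)"
          by (simp add: sum_product sum.cartesian_product)
        also have "\<dots> \<le> 1 * 1" by (intro mult_mono F1 G1) auto
        finally show "(\<Sum>p\<in>E. wt TR fg ((s' + \<eta>) + (t' + \<eta>)) n p) \<le> 1" by simp
      qed
      then show "packing_pre XY TR fg (A i \<times> D j) (s + t) N (2 * \<epsilon>) \<le> exp_tail \<eta> N" by (simp add: st)
    qed (rule exp_tail_tendsto_0[OF eta])
    have "packing_measure XY TR fg (Z \<times> W) (s + t) (2 * \<epsilon>) = 0"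
    proof (rule packing_measure_zeroI[where A = "\<lambda>k. A (fst (prod_decode k)) \<times> D (snd (prod_decode k))"])
      show "Z \<times> W \<subseteq> (\<Union>k. A (fst (prod_decode k)) \<times> D (snd (prod_decode k)))"
      proof (rule subrelI)
        fix z w assume "(z, w) \<in> Z \<times> W"
        then obtain i j where "z \<in> A i" "w \<in> D j" using A(2) D(2) by blast
        then show "(z, w) \<in> (\<Union>k. A (fst (prod_decode k)) \<times> D (snd (prod_decode k)))"
          by (auto intro!: exI[of _ "prod_encode (i, j)"])
      qed
    qed (use A(1) D(1) zero in auto)
    then show "\<exists>\<epsilon>>0. \<epsilon> \<le> \<delta> \<and> packing_measure XY TR fg (Z \<times> W) (s + t) \<epsilon> = 0"
      using e by (intro exI[of _ "2 * \<epsilon>"]) auto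
  qed
qed

text \<open>If the product were null at an exponent below \<open>s + t\<close>, its pieces
  \<open>A j\<close> would carry packings of weight at most 1 only. Packings of sections over the
  centres of a packing in \<open>Z\<close> combine to a packing of \<open>A j\<close>; as each
  section contributes more than 1, the centres have small weight, and their enlarged balls form a
  cheap cover in \<open>Z\<close>.\<close>

lemma packing_prod_lower:
  assumes BZ: "ereal s < bowen_pressure X T f Z" and PW: "ereal t < packing_pressure Y R g W"
  shows "ereal (s + t) \<le> packing_pressure XY TR fg (Z \<times> W)"
proof (rule ccontr)
  assume "\<not> ?thesis"
  then obtain u where u: "packing_pressure XY TR fg (Z \<times> W) < ereal u" "u < s + t"
    using ereal_dense2[of "packing_pressure XY TR fg (Z \<times> W)" "ereal (s + t)"] by (auto simp: not_le)
  \<comment> \<open>Two of the three thirds are spent: one to find a heavy level in a section, one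
    to sum over the levels of the cover.\<close>
  define \<eta> where "\<eta> = (s + t - u) / 3"
  have eta: "\<eta> > 0" using u by (simp add: \<eta>_def)
  obtain \<epsilon>1 where \<epsilon>1: "\<epsilon>1 > 0" "\<And>\<epsilon>. \<epsilon> > 0 \<Longrightarrow> \<epsilon> \<le> \<epsilon>1 \<Longrightarrow> bowen_measure X T f Z s \<epsilon> \<noteq> 0"
    using less_crit_limitD[OF crit_family_bowen BZ[unfolded bowen_pressure_crit]] by blast
  obtain \<epsilon>2 where \<epsilon>2: "\<epsilon>2 > 0" "\<And>\<epsilon>. \<epsilon> > 0 \<Longrightarrow> \<epsilon> \<le> \<epsilon>2 \<Longrightarrow> packing_measure Y R g W t \<epsilon> \<noteq> 0"
    using less_crit_limitD[OF crit_family_packing PW[unfolded packing_pressure_crit]] by blast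
  define \<epsilon> where "\<epsilon> = min (\<epsilon>1 / 3) \<epsilon>2"
  have e: "\<epsilon> > 0" "3 * \<epsilon> \<le> \<epsilon>1" "\<epsilon> \<le> \<epsilon>2" using \<epsilon>1(1) \<epsilon>2(1) by (auto simp: \<epsilon>_def)
  have P0: "packing_measure XY TR fg (Z \<times> W) u \<epsilon> = 0"
    using crit_limit_lessD[OF crit_family_packing u(1)[unfolded packing_pressure_crit] e(1)] .
  obtain A :: "nat \<Rightarrow> ('a \<times> 'b) set" and M where A: "\<And>j. A j \<subseteq> mspace (XY 0)" "Z \<times> W \<subseteq> (\<Union>j. A j)"
    "\<And>j. packing_pre XY TR fg (A j) u (M j) \<epsilon> < 1"
    using packing_measure_zeroD[OF P0] by blast
  define sec where "sec j x = {y. (x, y) \<in> A j}" for j x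
  have secY: "sec j x \<subseteq> mspace (Y 0)" for j x using A(1)[of j] by (auto simp: sec_def)
  \<comment> \<open>Every \<open>x\<close> in \<open>Z\<close> lies in some \<open>S j\<close>,
    since otherwise its sections would decompose \<open>W\<close> into null pieces.\<close>
  define S where "S j = {x \<in> Z. packing_premeasure Y R g (sec j x) t \<epsilon> \<noteq> 0}" for j
  have "Z \<subseteq> (\<Union>j. S j)"
  proof
    fix x assume x: "x \<in> Z"
    show "x \<in> (\<Union>j. S j)"
    proof (rule ccontr)
      assume "x \<notin> (\<Union>j. S j)"
      then have "packing_premeasure Y R g (sec j x) t \<epsilon> = 0" for j using x by (auto simp: S_def)
      moreover have "W \<subseteq> (\<Union>j. sec j x)" using A(2) x by (auto simp: sec_def)
      ultimately have "packing_measure Y R g W t \<epsilon> = 0"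
        by (intro packing_measure_zeroI[where A = "\<lambda>j. sec j x"] secY)
      then show False using \<epsilon>2(2) e by blast
    qed
  qed
  moreover have "bowen_measure X T f (S j) s (3 * \<epsilon>) = 0" for j
  proof (rule bowen_measure_zeroI[where K = "exp_tail \<eta>" and ?N0.0 = "max 1 (M j)"])
    fix N assume N: "N \<ge> max 1 (M j)"
    \<comment> \<open>The condition \<open>1 < ...\<close> negates the bound from which
      \<open>packing_pre_level_le\<close> would make the section null, so every point of
      \<open>S j\<close> has such an \<open>F\<close> at some level from \<open>N\<close>
      on.\<close>
    define H where "H n x F \<longleftrightarrow> finite F \<and> F \<subseteq> sec j x \<and> disjoint_family_on (\<lambda>y. bowen_cball Y R n y \<epsilon>) F \<and>
        1 < (\<Sum>y\<in>F. wt R g (t - \<eta>) n y)" for n x F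
    define A' where "A' n = {x \<in> S j. \<exists>F. H n x F}" for n
    have cover: "S j \<subseteq> (\<Union>n\<in>{N..}. A' n)"
    proof
      fix x assume x: "x \<in> S j"
      show "x \<in> (\<Union>n\<in>{N..}. A' n)"
      proof (rule ccontr)
        assume "x \<notin> (\<Union>n\<in>{N..}. A' n)"
        then have no: "\<not> H n x F" if "n \<ge> N" for n F using x that by (auto simp: A'_def)
        have "packing_premeasure Y R g (sec j x) t \<epsilon> = 0"
        proof (rule packing_premeasure_zeroI[where K = "exp_tail \<eta>" and ?N0.0 = N])
          fix N' assume N': "N' \<ge> N"
          have "packing_pre Y R g (sec j x) (t - \<eta> + \<eta>) N' \<epsilon> \<le> 1 * exp_tail \<eta> N'"
          proof (rule B.packing_pre_level_le[OF _ secY e(1)])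
            show "1 \<le> N'" using N N' by simp
            fix n E assume "n \<ge> N'" "finite E" "E \<subseteq> sec j x"
              "disjoint_family_on (\<lambda>x. bowen_cball Y R n x \<epsilon>) E"
            then show "(\<Sum>y\<in>E. wt R g (t - \<eta>) n y) \<le> 1"
              using no[of n E] N' by (auto simp: H_def not_less)
          qed
          then show "packing_pre Y R g (sec j x) t N' \<epsilon> \<le> exp_tail \<eta> N'" by simp
        qed (rule exp_tail_tendsto_0[OF eta])
        then show False using x by (simp add: S_def)
      qed
    qed
    have "\<exists>E. finite E \<and> E \<subseteq> A' n \<and> disjoint_family_on (\<lambda>x. bowen_cball X T n x \<epsilon>) E \<and>
        (\<forall>x\<in>A' n. \<exists>y\<in>E. bowen_dist X T n y x \<le> 2 * \<epsilon>)" if "n \<ge> N" for n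
      using that N e(1) ZX by (intro A.ex_maximal_packing) (auto simp: A'_def S_def)
    then obtain E where E: "\<And>n. n \<ge> N \<Longrightarrow> finite (E n)" "\<And>n. n \<ge> N \<Longrightarrow> E n \<subseteq> A' n"
        "\<And>n. n \<ge> N \<Longrightarrow> disjoint_family_on (\<lambda>x. bowen_cball X T n x \<epsilon>) (E n)"
        "\<And>n x. n \<ge> N \<Longrightarrow> x \<in> A' n \<Longrightarrow> \<exists>y\<in>E n. bowen_dist X T n y x \<le> 2 * \<epsilon>"
      by metis
    have A'X: "A' n \<subseteq> mspace (X 0)" for n using ZX by (auto simp: A'_def S_def)
    \<comment> \<open>The first \<open>\<eta>\<close> complements \<open>t - \<eta>\<close> to the
      exponent \<open>u\<close> of the product; the second pays for the sum over the levels.\<close>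
    have "bowen_pre X T f (S j) (u - t + \<eta> + \<eta>) N (3 * \<epsilon>) \<le> 1 * exp_tail \<eta> N"
    proof (rule bowen_pre_level_le[OF cover])
      fix n assume n: "n \<ge> N"
      have "A' n \<subseteq> (\<Union>z\<in>E n. bowen_ball X T n z (3 * \<epsilon>))"
      proof
        fix x assume x: "x \<in> A' n"
        then obtain z where "z \<in> E n" "bowen_dist X T n z x \<le> 2 * \<epsilon>" using E(4)[OF n] by blast
        then show "x \<in> (\<Union>z\<in>E n. bowen_ball X T n z (3 * \<epsilon>))"
          using x A'X e(1) by (force simp: bowen_ball_def)
      qed
      then show "finite (E n) \<and> E n \<subseteq> mspace (X 0) \<and> A' n \<subseteq> (\<Union>z\<in>E n. bowen_ball X T n z (3 * \<epsilon>))"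
        using E(1,2)[OF n] A'X by blast
      have "\<exists>F. H n x F" if "x \<in> E n" for x using that E(2)[OF n] by (auto simp: A'_def)
      then obtain F where F: "\<And>x. x \<in> E n \<Longrightarrow> H n x (F x)" by metis
      have "(\<Sum>x\<in>E n. wt T f (u - t + \<eta>) n x) \<le> (\<Sum>x\<in>E n. \<Sum>y\<in>F x. wt TR fg u n (x, y))"
      proof (rule sum_mono)
        fix x assume x: "x \<in> E n"
        have "wt T f (u - t + \<eta>) n x * 1 \<le> wt T f (u - t + \<eta>) n x * (\<Sum>y\<in>F x. wt R g (t - \<eta>) n y)"
          using F[OF x] by (intro mult_left_mono) (auto simp: H_def)
        also have "\<dots> = (\<Sum>y\<in>F x. wt TR fg (u - t + \<eta> + (t - \<eta>)) n (x, y))"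
          by (simp only: wt_prod sum_distrib_left)
        finally show "wt T f (u - t + \<eta>) n x \<le> (\<Sum>y\<in>F x. wt TR fg u n (x, y))" by simp
      qed
      also have "\<dots> = (\<Sum>p\<in>Sigma (E n) F. wt TR fg u n p)"
        using E(1)[OF n] F by (subst sum.Sigma) (auto simp: H_def case_prod_unfold)
      also have "\<dots> \<le> packing_pre XY TR fg (A j) u (M j) \<epsilon>"
      proof (rule packing_pre_ge_finite)
        show "finite (Sigma (E n) F)" using E(1)[OF n] F by (auto simp: H_def)
        show "Sigma (E n) F \<subseteq> A j" using F by (auto simp: H_def sec_def)
        show "M j \<le> n" using n N by simp
        show "disjoint_family_on (\<lambda>p. bowen_cball XY TR n p \<epsilon>) (Sigma (E n) F)"
        proof (unfold disjoint_family_on_def, intro ballI impI)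
          fix p q assume pq: "p \<in> Sigma (E n) F" "q \<in> Sigma (E n) F" "p \<noteq> q"
          obtain x y x' y' where [simp]: "p = (x, y)" "q = (x', y')" by (meson surj_pair)
          have xy: "x \<in> E n" "x' \<in> E n" "y \<in> F x" "y' \<in> F x'" using pq by auto
          \<comment> \<open>Different base points have disjoint balls in the first factor; over one
            base point the packing \<open>F x\<close> keeps the balls apart.\<close>
          have "bowen_cball X T n x \<epsilon> \<inter> bowen_cball X T n x' \<epsilon> = {} \<or>
              bowen_cball Y R n y \<epsilon> \<inter> bowen_cball Y R n y' \<epsilon> = {}"
          proof (cases "x = x'")
            case True
            have dj: "disjoint_family_on (\<lambda>y. bowen_cball Y R n y \<epsilon>) (F x)"
              using F[OF xy(1)] by (simp add: H_def)
            show ?thesis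
              using disjoint_family_onD[OF dj, of y y'] True xy pq(3) by auto
          next
            case False
            then show ?thesis using disjoint_family_onD[OF E(3)[OF n] xy(1,2)] by auto
          qed
          then show "bowen_cball XY TR n p \<epsilon> \<inter> bowen_cball XY TR n q \<epsilon> = {}"
            using n N by (auto simp: bowen_cball_prod Times_Int_Times)
        qed
      qed
      also have "\<dots> \<le> 1" using A(3)[of j] by simp
      finally show "(\<Sum>x\<in>E n. wt T f (u - t + \<eta>) n x) \<le> 1" .
    qed
    moreover have "u - t + \<eta> + \<eta> \<le> s" using eta by (simp add: \<eta>_def field_simps)
    ultimately show "bowen_pre X T f (S j) s N (3 * \<epsilon>) \<le> exp_tail \<eta> N"
      using bowen_pre_antimono[of "u - t + \<eta> + \<eta>" s "3 * \<epsilon>" "3 * \<epsilon>" X T f "S j" N] by simp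
  qed (rule exp_tail_tendsto_0[OF eta])
  ultimately have "bowen_measure X T f Z s (3 * \<epsilon>) = 0"
    by (rule bowen_measure_countable_UN[where A = S, rotated])
  then show False using \<epsilon>1(2)[of "3 * \<epsilon>"] e by simp
qed

text \<open>A cheap cover of \<open>Z \<times> W\<close> yields a cheap cover of \<open>Z\<close>:
  at each level, separated points use disjoint parts of the given cover, and each part has a weight
  bounded below by what a cover of \<open>W\<close> must cost. Equicontinuity of \<open>f\<close>
  transfers the weight from the centre of a ball to the point itself.\<close>

lemma bowen_prod_lower:
  assumes eqX: "equicontinuous_seq X f"
    and BZ: "ereal s < bowen_pressure X T f Z" and BW: "ereal t < bowen_pressure Y R g W"
  shows "ereal (s + t) \<le> bowen_pressure XY TR fg (Z \<times> W)"
proof (rule ccontr)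
  assume "\<not> ?thesis"
  then obtain u where u: "bowen_pressure XY TR fg (Z \<times> W) < ereal u" "u < s + t"
    using ereal_dense2[of "bowen_pressure XY TR fg (Z \<times> W)" "ereal (s + t)"] by (auto simp: not_le)
  \<comment> \<open>Here all three thirds are spent: on the share of a level, on the oscillation of
    \<open>f\<close>, and on the sum over the levels.\<close>
  define \<eta> where "\<eta> = (s + t - u) / 3"
  have eta: "\<eta> > 0" using u by (simp add: \<eta>_def)
  obtain \<epsilon>1 where \<epsilon>1: "\<epsilon>1 > 0" "\<And>\<epsilon>. \<epsilon> > 0 \<Longrightarrow> \<epsilon> \<le> \<epsilon>1 \<Longrightarrow> bowen_measure X T f Z s \<epsilon> \<noteq> 0"
    using less_crit_limitD[OF crit_family_bowen BZ[unfolded bowen_pressure_crit]] by blast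
  obtain \<epsilon>2 where \<epsilon>2: "\<epsilon>2 > 0" "\<And>\<epsilon>. \<epsilon> > 0 \<Longrightarrow> \<epsilon> \<le> \<epsilon>2 \<Longrightarrow> bowen_measure Y R g W t \<epsilon> \<noteq> 0"
    using less_crit_limitD[OF crit_family_bowen BW[unfolded bowen_pressure_crit]] by blast
  obtain \<delta> where \<delta>: "\<delta> > 0" "\<And>n x y. n \<ge> 1 \<Longrightarrow> x \<in> mspace (X 0) \<Longrightarrow> y \<in> mspace (X 0) \<Longrightarrow>
      bowen_dist X T n x y < \<delta> \<Longrightarrow> \<bar>birkhoff_sum T f n x - birkhoff_sum T f n y\<bar> \<le> real n * \<eta>"
    using A.equicontinuous_birkhoff[OF eqX eta] by blast
  define \<epsilon> where "\<epsilon> = min (\<epsilon>1 / 3) (min \<epsilon>2 \<delta>)"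
  have e: "\<epsilon> > 0" "3 * \<epsilon> \<le> \<epsilon>1" "\<epsilon> \<le> \<epsilon>2" "\<epsilon> \<le> \<delta>" using \<epsilon>1(1) \<epsilon>2(1) \<delta>(1) by (auto simp: \<epsilon>_def)
  have BZW: "bowen_measure XY TR fg (Z \<times> W) u \<epsilon> = 0"
    using crit_limit_lessD[OF crit_family_bowen u(1)[unfolded bowen_pressure_crit] e(1)] .
  obtain N1 where N1: "bowen_pre Y R g W t N1 \<epsilon> \<noteq> 0"
    using \<epsilon>2(2)[OF e(1,3)] by (auto simp: bowen_measure_eq_0_iff)
  \<comment> \<open>\<open>bowen_pre\<close> may be infinite, so a positive real below it is fixed;
    as the values increase with the starting level, \<open>q\<close> remains a lower bound from
    \<open>N1\<close> on.\<close>
  obtain q where q: "q > 0" "ennreal q \<le> bowen_pre Y R g W t N1 \<epsilon>"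
  proof (cases "bowen_pre Y R g W t N1 \<epsilon>")
    case (real r)
    then show ?thesis using N1 that[of r] by auto
  next
    case top
    then show ?thesis using that[of 1] by auto
  qed
  \<comment> \<open>With a tail below 1, shares of at most \<open>q * exp (- n \<eta>)\<close> at
    every level would total less than \<open>q\<close>.\<close>
  obtain N2 where N2: "\<And>N. N \<ge> N2 \<Longrightarrow> exp_tail \<eta> N < 1" using exp_tail_less[OF eta, of 1] by auto
  have "bowen_measure X T f Z s (3 * \<epsilon>) = 0"
  proof (rule bowen_measure_zeroI[where K = "\<lambda>_. 0" and ?N0.0 = "max 1 (max N1 N2)"])
    fix N assume "N \<ge> max 1 (max N1 N2)"
    then have N: "N \<ge> 1" "N \<ge> N1" "N \<ge> N2" by auto
    have "bowen_pre X T f Z (u - t + 2 * \<eta> + \<eta>) N (3 * \<epsilon>) = 0"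
    proof (rule ennreal_zeroI_mult[of "exp_tail \<eta> N"])
      show "exp_tail \<eta> N < \<infinity>" by (rule exp_tail_finite[OF eta])
      fix c :: real assume c: "c > 0"
      \<comment> \<open>The budget contains \<open>q\<close> because each separated point brings in
        a factor \<open>q\<close>, which is cancelled at the end.\<close>
      have "bowen_pre XY TR fg (Z \<times> W) u N \<epsilon> < ennreal (q * c)"
        using BZW c q(1) by (simp add: bowen_measure_eq_0_iff)
      then obtain I :: "nat set" and \<nu> p where I: "\<forall>i\<in>I. N \<le> \<nu> i \<and> p i \<in> mspace (XY 0)"
          "Z \<times> W \<subseteq> (\<Union>i\<in>I. bowen_ball XY TR (\<nu> i) (p i) \<epsilon>)"
          "(\<Sum>\<^sub>\<infinity>i\<in>I. wt TR fg u (\<nu> i) (p i)) < ennreal (q * c)"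
        using bowen_pre_lessD[of XY TR fg "Z \<times> W" u N \<epsilon> "ennreal (q * c)"] by auto
      define x where "x i = fst (p i)" for i
      define y where "y i = snd (p i)" for i
      have p: "p i = (x i, y i)" for i by (simp add: x_def y_def)
      have xy: "x i \<in> mspace (X 0)" "y i \<in> mspace (Y 0)" if "i \<in> I" for i
        using I(1) that by (auto simp: p)
      \<comment> \<open>A section is kept as a set of indices of the given cover, so that the parts
        used by different points can be compared.\<close>
      define J where "J n z = {i \<in> I. \<nu> i = n \<and> z \<in> bowen_ball X T n (x i) \<epsilon>}" for n z
      define A' where "A' n = {z \<in> Z. ennreal q * ennreal (exp (- real n * \<eta>)) \<le> (\<Sum>\<^sub>\<infinity>i\<in>J n z. wt R g t n (y i))}" for n
      have A'X: "A' n \<subseteq> mspace (X 0)" for n using ZX by (auto simp: A'_def)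
      text \<open>The balls of the cover whose first factor contains \<open>z\<close> cover \<open>W\<close>, so some level carries
        a definite share of the weight \<open>q\<close>.\<close>
      have cover: "Z \<subseteq> (\<Union>n\<in>{N..}. A' n)"
      proof
        fix z assume z: "z \<in> Z"
        show "z \<in> (\<Union>n\<in>{N..}. A' n)"
        proof (rule ccontr)
          assume "z \<notin> (\<Union>n\<in>{N..}. A' n)"
          then have small: "(\<Sum>\<^sub>\<infinity>i\<in>J n z. wt R g t n (y i)) \<le> ennreal q * ennreal (exp (- real n * \<eta>))"
            if "n \<ge> N" for n using z that by (force simp: A'_def not_le)
          define D where "D n = (\<lambda>i. (n, y i)) ` J n z" for n
          have "ennreal q \<le> bowen_pre Y R g W t N \<epsilon>"
            using q(2) incseqD[OF incseq_bowen_pre[of Y R g W t \<epsilon>] N(2)] by (rule order.trans)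
          also have "\<dots> \<le> (\<Sum>\<^sub>\<infinity>(n, y)\<in>(\<Union>n\<in>{N..}. D n). wt R g t n y)"
          proof (rule bowen_pre_le_countable)
            show "countable (\<Union>n\<in>{N..}. D n)" by (auto simp: D_def intro!: countable_UN)
            show "N \<le> n \<and> w \<in> mspace (Y 0)" if "(n, w) \<in> (\<Union>n\<in>{N..}. D n)" for n w
              using that xy by (auto simp: D_def J_def)
            show "W \<subseteq> (\<Union>(n, w)\<in>(\<Union>n\<in>{N..}. D n). bowen_ball Y R n w \<epsilon>)"
            proof
              fix w assume w: "w \<in> W"
              then obtain i where i: "i \<in> I" "(z, w) \<in> bowen_ball XY TR (\<nu> i) (p i) \<epsilon>" using I(2) z by blast
              have n: "\<nu> i \<ge> N" using I(1) i by auto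
              then have "z \<in> bowen_ball X T (\<nu> i) (x i) \<epsilon>" "w \<in> bowen_ball Y R (\<nu> i) (y i) \<epsilon>"
                using i(2) N(1) by (auto simp: p bowen_ball_prod)
              moreover from this have "(\<nu> i, y i) \<in> (\<Union>n\<in>{N..}. D n)"
                using i(1) n by (auto simp: D_def J_def)
              ultimately show "w \<in> (\<Union>(n, w)\<in>(\<Union>n\<in>{N..}. D n). bowen_ball Y R n w \<epsilon>)" by blast
            qed
          qed
          also have "\<dots> \<le> (\<Sum>\<^sub>\<infinity>n\<in>{N..}. \<Sum>\<^sub>\<infinity>(n, y)\<in>D n. wt R g t n y)"
            by (rule infsum_UNION_le_ennreal)
          also have "\<dots> \<le> (\<Sum>\<^sub>\<infinity>n\<in>{N..}. ennreal q * ennreal (exp (- real n * \<eta>)))"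
          proof (rule infsum_mono)
            fix n assume "n \<in> {N..}"
            then have n: "n \<ge> N" by simp
            have "(\<Sum>\<^sub>\<infinity>(n, y)\<in>D n. wt R g t n y) \<le> (\<Sum>\<^sub>\<infinity>i\<in>J n z. wt R g t n (y i))"
              unfolding D_def using infsum_image_le_ennreal[of "\<lambda>(n, y). wt R g t n y" "\<lambda>i. (n, y i)" "J n z"] by simp
            also note small[OF n]
            finally show "(\<Sum>\<^sub>\<infinity>(n, y)\<in>D n. wt R g t n y) \<le> ennreal q * ennreal (exp (- real n * \<eta>))" .
          qed (rule nonneg_summable_on_complete, simp)+
          also have "\<dots> \<le> ennreal q * exp_tail \<eta> N" unfolding exp_tail_def by (rule infsum_cmult_le_ennreal)
          also have "\<dots> < ennreal q * 1"
            using N2[OF N(3)] q(1) by (intro ennreal_mult_strict_left_mono) auto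
          finally show False by simp
        qed
      qed
      have "\<exists>E. finite E \<and> separated X T (A' n) n (2 * \<epsilon>) E \<and>
          (\<forall>z\<in>A' n. \<exists>z'\<in>E. bowen_dist X T n z z' \<le> 2 * \<epsilon>)" if "n \<ge> N" for n
        using that N e(1) A'X by (intro A.ex_maximal_separated) auto
      then obtain E where E: "\<And>n. n \<ge> N \<Longrightarrow> finite (E n)" "\<And>n. n \<ge> N \<Longrightarrow> separated X T (A' n) n (2 * \<epsilon>) (E n)"
          "\<And>n z. n \<ge> N \<Longrightarrow> z \<in> A' n \<Longrightarrow> \<exists>z'\<in>E n. bowen_dist X T n z z' \<le> 2 * \<epsilon>"
        by metis
      have EA: "E n \<subseteq> A' n" if "n \<ge> N" for n using E(2)[OF that] by (simp add: separated_def)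
      show "bowen_pre X T f Z (u - t + 2 * \<eta> + \<eta>) N (3 * \<epsilon>) \<le> ennreal c * exp_tail \<eta> N"
      proof (rule bowen_pre_level_le[OF cover])
        fix n assume n: "n \<ge> N"
        then have n1: "n \<ge> 1" using N by simp
        have "A' n \<subseteq> (\<Union>z\<in>E n. bowen_ball X T n z (3 * \<epsilon>))"
        proof
          fix z assume z: "z \<in> A' n"
          then obtain z' where "z' \<in> E n" "bowen_dist X T n z z' \<le> 2 * \<epsilon>" using E(3)[OF n] by blast
          then show "z \<in> (\<Union>z\<in>E n. bowen_ball X T n z (3 * \<epsilon>))"
            using z A'X e(1) bowen_dist_commute[of X T n z z'] by (force simp: bowen_ball_def)
        qed
        then show "finite (E n) \<and> E n \<subseteq> mspace (X 0) \<and> A' n \<subseteq> (\<Union>z\<in>E n. bowen_ball X T n z (3 * \<epsilon>))"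
          using E(1)[OF n] EA[OF n] A'X by blast
        \<comment> \<open>A common index would put \<open>x i\<close> within
          \<open>\<epsilon>\<close> of two points that are more than \<open>2 * \<epsilon>\<close>
          apart. Hence no ball of the cover is counted twice.\<close>
        have disj: "disjoint_family_on (J n) (E n)"
        proof (unfold disjoint_family_on_def, intro ballI impI equals0I)
          fix z z' i assume z: "z \<in> E n" "z' \<in> E n" "z \<noteq> z'" and i: "i \<in> J n z \<inter> J n z'"
          have m: "z \<in> mspace (X 0)" "z' \<in> mspace (X 0)" using z EA[OF n] A'X by blast+
          have "bowen_dist X T n z z' \<le> \<epsilon> + \<epsilon>"
          proof (rule A.bowen_dist_triangle[OF n1, of z "x i" z'])
            show "bowen_dist X T n z (x i) \<le> \<epsilon>" "bowen_dist X T n (x i) z' \<le> \<epsilon>"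
              using i bowen_dist_commute[of X T n z "x i"] by (auto simp: J_def bowen_ball_def)
          qed (use i xy m in \<open>auto simp: J_def\<close>)
          then show False using E(2)[OF n] z by (force simp: separated_def)
        qed
        have "ennreal q * (\<Sum>z\<in>E n. wt T f (u - t + 2 * \<eta>) n z)
            = (\<Sum>z\<in>E n. ennreal q * wt T f (u - t + 2 * \<eta>) n z)" by (simp add: sum_distrib_left)
        also have "\<dots> \<le> (\<Sum>z\<in>E n. \<Sum>\<^sub>\<infinity>i\<in>J n z. wt TR fg u (\<nu> i) (p i))"
        proof (rule sum_mono)
          fix z assume zE: "z \<in> E n"
          then have z: "z \<in> A' n" using EA[OF n] by auto
          \<comment> \<open>One shift produces the factor \<open>exp (- real n * \<eta>)\<close> of
            the share in \<open>A' n\<close>; the other is left for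
            \<open>wt_compare\<close>.\<close>
          have s1: "u - t + 2 * \<eta> = (u - t + \<eta>) + \<eta>" by simp
          have "ennreal q * wt T f (u - t + 2 * \<eta>) n z
              = wt T f (u - t + \<eta>) n z * (ennreal q * ennreal (exp (- real n * \<eta>)))"
            unfolding s1 wt_shift by (simp only: mult_ac)
          also have "\<dots> \<le> wt T f (u - t + \<eta>) n z * (\<Sum>\<^sub>\<infinity>i\<in>J n z. wt R g t n (y i))"
            using z by (intro mult_left_mono) (auto simp: A'_def)
          also have "\<dots> \<le> (\<Sum>\<^sub>\<infinity>i\<in>J n z. wt T f (u - t + \<eta>) n z * wt R g t n (y i))"
            by (rule cmult_infsum_le_ennreal)
          also have "\<dots> \<le> (\<Sum>\<^sub>\<infinity>i\<in>J n z. wt TR fg u (\<nu> i) (p i))"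
          proof (rule infsum_mono)
            fix i assume i: "i \<in> J n z"
            have "bowen_dist X T n z (x i) < \<delta>"
              using i e(4) bowen_dist_commute[of X T n z "x i"] by (auto simp: J_def bowen_ball_def)
            then have "wt T f (u - t + \<eta>) n z \<le> wt T f (u - t) n (x i)"
              using i xy z A'X n1 by (intro wt_compare \<delta>(2)) (auto simp: J_def)
            then have "wt T f (u - t + \<eta>) n z * wt R g t n (y i) \<le> wt T f (u - t) n (x i) * wt R g t n (y i)"
              by (rule mult_right_mono) simp
            also have "\<dots> = wt TR fg (u - t + t) n (x i, y i)" by (simp only: wt_prod)
            also have "\<dots> = wt TR fg u (\<nu> i) (p i)" using i by (simp add: p J_def)
            finally show "wt T f (u - t + \<eta>) n z * wt R g t n (y i) \<le> wt TR fg u (\<nu> i) (p i)" .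
          qed (rule nonneg_summable_on_complete, simp)+
          finally show "ennreal q * wt T f (u - t + 2 * \<eta>) n z \<le> (\<Sum>\<^sub>\<infinity>i\<in>J n z. wt TR fg u (\<nu> i) (p i))" .
        qed
        also have "\<dots> \<le> (\<Sum>\<^sub>\<infinity>i\<in>I. wt TR fg u (\<nu> i) (p i))"
          by (rule sum_infsum_disjoint_le_ennreal[OF E(1)[OF n] disj]) (auto simp: J_def)
        also have "\<dots> \<le> ennreal q * ennreal c" using I(3) q(1) c by (simp add: ennreal_mult)
        finally show "(\<Sum>z\<in>E n. wt T f (u - t + 2 * \<eta>) n z) \<le> ennreal c"
          using q(1) by (simp add: ennreal_mult_le_mult_iff)
      qed
    qed
    moreover have "u - t + 2 * \<eta> + \<eta> \<le> s" by (simp add: \<eta>_def field_simps)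
    ultimately show "bowen_pre X T f Z s N (3 * \<epsilon>) \<le> 0"
      using bowen_pre_antimono[of "u - t + 2 * \<eta> + \<eta>" s "3 * \<epsilon>" "3 * \<epsilon>" X T f Z N] by simp
  qed simp
  then show False using \<epsilon>1(2)[of "3 * \<epsilon>"] e by simp
qed

end

section \<open>Exchange of the two factors\<close>

lemma bowen_dist_swap:
  "bowen_dist (prod_spaces Y X) (prod_maps R T) n (prod.swap p) (prod.swap q) =
     bowen_dist (prod_spaces X Y) (prod_maps T R) n p q"
  by (cases p; cases q) (simp add: bowen_dist_def prod_spaces_def max.commute)

lemma bowen_ball_swap:
  "bowen_ball (prod_spaces Y X) (prod_maps R T) n (prod.swap p) e =
     prod.swap ` bowen_ball (prod_spaces X Y) (prod_maps T R) n p e"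
proof -
  have "q \<in> bowen_ball (prod_spaces Y X) (prod_maps R T) n (prod.swap p) e \<longleftrightarrow>
      prod.swap q \<in> bowen_ball (prod_spaces X Y) (prod_maps T R) n p e" for q
    using bowen_dist_swap[of Y X R T n p "prod.swap q"] by (cases q) (auto simp: bowen_ball_def)
  then show ?thesis by (force simp: image_iff)
qed

lemma bowen_cball_swap:
  "bowen_cball (prod_spaces Y X) (prod_maps R T) n (prod.swap p) e =
     prod.swap ` bowen_cball (prod_spaces X Y) (prod_maps T R) n p e"
proof -
  have "q \<in> bowen_cball (prod_spaces Y X) (prod_maps R T) n (prod.swap p) e \<longleftrightarrow>
      prod.swap q \<in> bowen_cball (prod_spaces X Y) (prod_maps T R) n p e" for q
    using bowen_dist_swap[of Y X R T n p "prod.swap q"] by (cases q) (auto simp: bowen_cball_def)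
  then show ?thesis by (force simp: image_iff)
qed

lemma weighted_sum_swap:
  "weighted_sum (prod_maps R T) (dotplus g f) s I n (\<lambda>i. prod.swap (p i)) =
     weighted_sum (prod_maps T R) (dotplus f g) s I n p"
proof -
  have "birkhoff_sum (prod_maps R T) (dotplus g f) m (prod.swap q) =
      birkhoff_sum (prod_maps T R) (dotplus f g) m q" for m q
    by (cases q) (simp add: birkhoff_sum_prod)
  then show ?thesis by (simp add: weighted_sum_def)
qed

text \<open>One inequality is enough: the exchange is an involution, so the same statement with the
  two systems reversed gives equality.\<close>

lemma bowen_pre_swap_le:
  "bowen_pre (prod_spaces Y X) (prod_maps R T) (dotplus g f) (prod.swap ` A) s N \<epsilon> \<le>
     bowen_pre (prod_spaces X Y) (prod_maps T R) (dotplus f g) A s N \<epsilon>"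
  unfolding bowen_pre_def[of "prod_spaces X Y"]
proof (rule Inf_greatest, safe)
  fix I and n :: "nat \<Rightarrow> nat" and p
  assume *: "\<forall>i\<in>I. N \<le> n i \<and> p i \<in> mspace (prod_spaces X Y 0)"
    "A \<subseteq> (\<Union>i\<in>I. bowen_ball (prod_spaces X Y) (prod_maps T R) (n i) (p i) \<epsilon>)"
  have "prod.swap ` A \<subseteq> (\<Union>i\<in>I. bowen_ball (prod_spaces Y X) (prod_maps R T) (n i) (prod.swap (p i)) \<epsilon>)"
    unfolding bowen_ball_swap using *(2) by blast
  moreover have "\<forall>i\<in>I. N \<le> n i \<and> prod.swap (p i) \<in> mspace (prod_spaces Y X 0)"
    using *(1) by auto
  ultimately have "bowen_pre (prod_spaces Y X) (prod_maps R T) (dotplus g f) (prod.swap ` A) s N \<epsilon>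
      \<le> weighted_sum (prod_maps R T) (dotplus g f) s I n (\<lambda>i. prod.swap (p i))"
    unfolding bowen_pre_def by (intro Inf_lower CollectI exI conjI) (rule refl | assumption)+
  then show "bowen_pre (prod_spaces Y X) (prod_maps R T) (dotplus g f) (prod.swap ` A) s N \<epsilon>
      \<le> weighted_sum (prod_maps T R) (dotplus f g) s I n p"
    by (simp add: weighted_sum_swap)
qed

lemma packing_pre_swap_le:
  "packing_pre (prod_spaces X Y) (prod_maps T R) (dotplus f g) A s N \<epsilon> \<le>
     packing_pre (prod_spaces Y X) (prod_maps R T) (dotplus g f) (prod.swap ` A) s N \<epsilon>"
  unfolding packing_pre_def[of "prod_spaces X Y"]
proof (rule Sup_least, safe)
  fix I and n :: "nat \<Rightarrow> nat" and p
  assume *: "\<forall>i\<in>I. N \<le> n i \<and> p i \<in> A"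
    "disjoint_family_on (\<lambda>i. bowen_cball (prod_spaces X Y) (prod_maps T R) (n i) (p i) \<epsilon>) I"
  have "disjoint_family_on (\<lambda>i. bowen_cball (prod_spaces Y X) (prod_maps R T) (n i) (prod.swap (p i)) \<epsilon>) I"
    unfolding bowen_cball_swap using *(2)
    by (rule disjoint_family_on_bisimulation) (auto simp flip: image_Int)
  moreover have "\<forall>i\<in>I. N \<le> n i \<and> prod.swap (p i) \<in> prod.swap ` A" using *(1) by auto
  ultimately have "weighted_sum (prod_maps R T) (dotplus g f) s I n (\<lambda>i. prod.swap (p i))
      \<le> packing_pre (prod_spaces Y X) (prod_maps R T) (dotplus g f) (prod.swap ` A) s N \<epsilon>"
    unfolding packing_pre_def by (intro Sup_upper CollectI exI conjI) (rule refl | assumption)+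
  then show "weighted_sum (prod_maps T R) (dotplus f g) s I n p
      \<le> packing_pre (prod_spaces Y X) (prod_maps R T) (dotplus g f) (prod.swap ` A) s N \<epsilon>"
    by (simp add: weighted_sum_swap)
qed

text \<open>\<open>bowen_prod_upper\<close> and \<open>packing_prod_lower\<close> take the packing
  pressure of the second factor; the exchange gives the versions with that of the first.\<close>

lemma bowen_pressure_swap:
  "bowen_pressure (prod_spaces Y X) (prod_maps R T) (dotplus g f) (W \<times> Z) =
     bowen_pressure (prod_spaces X Y) (prod_maps T R) (dotplus f g) (Z \<times> W)"
proof -
  have "bowen_pre (prod_spaces Y X) (prod_maps R T) (dotplus g f) (W \<times> Z) s N \<epsilon> =
      bowen_pre (prod_spaces X Y) (prod_maps T R) (dotplus f g) (Z \<times> W) s N \<epsilon>" for s N \<epsilon>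
    using bowen_pre_swap_le[of Y X R T g f "Z \<times> W" s N \<epsilon>] bowen_pre_swap_le[of X Y T R f g "W \<times> Z" s N \<epsilon>]
    by (simp add: product_swap)
  then show ?thesis by (simp add: bowen_pressure_def bowen_measure_def)
qed

lemma packing_premeasure_swap:
  "packing_premeasure (prod_spaces Y X) (prod_maps R T) (dotplus g f) (prod.swap ` A) s \<epsilon> =
     packing_premeasure (prod_spaces X Y) (prod_maps T R) (dotplus f g) A s \<epsilon>"
proof -
  have "packing_pre (prod_spaces Y X) (prod_maps R T) (dotplus g f) (prod.swap ` A) s N \<epsilon> =
      packing_pre (prod_spaces X Y) (prod_maps T R) (dotplus f g) A s N \<epsilon>" for N
    using packing_pre_swap_le[of X Y T R f g A s N \<epsilon>] packing_pre_swap_le[of Y X R T g f "prod.swap ` A" s N \<epsilon>]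
    by (simp add: image_image)
  then show ?thesis by (simp add: packing_premeasure_def)
qed

lemma packing_measure_swap_le:
  "packing_measure (prod_spaces Y X) (prod_maps R T) (dotplus g f) (W \<times> Z) s \<epsilon> \<le>
     packing_measure (prod_spaces X Y) (prod_maps T R) (dotplus f g) (Z \<times> W) s \<epsilon>"
  unfolding packing_measure_def[of "prod_spaces X Y"]
proof (rule Inf_greatest, safe)
  fix A :: "nat \<Rightarrow> _"
  assume *: "\<forall>i. A i \<subseteq> mspace (prod_spaces X Y 0)" "Z \<times> W \<subseteq> (\<Union>i. A i)"
  have "W \<times> Z \<subseteq> (\<Union>i. prod.swap ` A i)"
    using image_mono[OF *(2), of prod.swap] by (simp add: product_swap image_UN)
  moreover have "\<forall>i. prod.swap ` A i \<subseteq> mspace (prod_spaces Y X 0)"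
    using *(1) by fastforce
  ultimately have "packing_measure (prod_spaces Y X) (prod_maps R T) (dotplus g f) (W \<times> Z) s \<epsilon> \<le>
      (\<Sum>i. packing_premeasure (prod_spaces Y X) (prod_maps R T) (dotplus g f) (prod.swap ` A i) s \<epsilon>)"
    unfolding packing_measure_def
    by (intro Inf_lower CollectI exI[of _ "\<lambda>i. prod.swap ` A i"] conjI refl)
  then show "packing_measure (prod_spaces Y X) (prod_maps R T) (dotplus g f) (W \<times> Z) s \<epsilon> \<le>
      (\<Sum>i. packing_premeasure (prod_spaces X Y) (prod_maps T R) (dotplus f g) (A i) s \<epsilon>)"
    by (simp add: packing_premeasure_swap)
qed

lemma packing_pressure_swap:
  "packing_pressure (prod_spaces Y X) (prod_maps R T) (dotplus g f) (W \<times> Z) =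
     packing_pressure (prod_spaces X Y) (prod_maps T R) (dotplus f g) (Z \<times> W)"
proof -
  have "packing_measure (prod_spaces Y X) (prod_maps R T) (dotplus g f) (W \<times> Z) s \<epsilon> =
      packing_measure (prod_spaces X Y) (prod_maps T R) (dotplus f g) (Z \<times> W) s \<epsilon>" for s \<epsilon>
    by (intro antisym packing_measure_swap_le)
  then show ?thesis by (simp add: packing_pressure_def)
qed

text \<open>The equality hypothesis turns a mixed sum of a Bowen and a packing pressure into the
  desired one, in the upper bound for the Bowen pressure and the lower bound for the packing
  pressure. Which factor has equal pressures decides whether the factors are exchanged.\<close>

lemma
  assumes sys: "bowen_system X T" "bowen_system Y R"
    and sub: "Z \<subseteq> mspace (X 0)" "W \<subseteq> mspace (Y 0)"
    and equi: "equicontinuous_seq X f" "equicontinuous_seq Y g"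
    and def: "sum_defined (bowen_pressure X T f Z) (bowen_pressure Y R g W)"
      "sum_defined (packing_pressure X T f Z) (packing_pressure Y R g W)"
    and eq: "bowen_pressure X T f Z = packing_pressure X T f Z \<or>
       bowen_pressure Y R g W = packing_pressure Y R g W"
  shows bowen_pressure_prod: "bowen_pressure (prod_spaces X Y) (prod_maps T R) (dotplus f g) (Z \<times> W)
        = bowen_pressure X T f Z + bowen_pressure Y R g W" (is ?B)
    and packing_pressure_prod: "packing_pressure (prod_spaces X Y) (prod_maps T R) (dotplus f g) (Z \<times> W)
        = packing_pressure X T f Z + packing_pressure Y R g W" (is ?P)
proof -
  have comm: "sum_defined b a" if "sum_defined a b" for a b using that by (auto simp: sum_defined_def)
  show ?B
  proof (rule antisym)
    show "bowen_pressure X T f Z + bowen_pressure Y R g W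
        \<le> bowen_pressure (prod_spaces X Y) (prod_maps T R) (dotplus f g) (Z \<times> W)"
      by (rule add_le_erealI[OF def(1)]) (rule bowen_prod_lower[OF sys sub(1) equi(1)])
    show "bowen_pressure (prod_spaces X Y) (prod_maps T R) (dotplus f g) (Z \<times> W)
        \<le> bowen_pressure X T f Z + bowen_pressure Y R g W"
      using eq
    proof
      assume eq: "bowen_pressure Y R g W = packing_pressure Y R g W"
      show ?thesis
        using def(1) unfolding eq by (rule le_add_erealI) (rule bowen_prod_upper[OF sys sub(1)])
    next
      assume eq: "bowen_pressure X T f Z = packing_pressure X T f Z"
      show ?thesis
        using comm[OF def(1)] unfolding eq
        by (subst add.commute, subst bowen_pressure_swap[symmetric], rule le_add_erealI)
           (rule bowen_prod_upper[OF sys(2,1) sub(2)])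
    qed
  qed
  show ?P
  proof (rule antisym)
    show "packing_pressure (prod_spaces X Y) (prod_maps T R) (dotplus f g) (Z \<times> W)
        \<le> packing_pressure X T f Z + packing_pressure Y R g W"
      by (rule le_add_erealI[OF def(2)]) (rule packing_prod_upper[OF sys sub(1) equi])
    show "packing_pressure X T f Z + packing_pressure Y R g W
        \<le> packing_pressure (prod_spaces X Y) (prod_maps T R) (dotplus f g) (Z \<times> W)"
      using eq
    proof
      assume eq: "bowen_pressure X T f Z = packing_pressure X T f Z"
      show ?thesis
        using def(2) unfolding eq[symmetric] by (rule add_le_erealI) (rule packing_prod_lower[OF sys sub(1)])
    next
      assume eq: "bowen_pressure Y R g W = packing_pressure Y R g W"
      show ?thesis
        using comm[OF def(2)] unfolding eq[symmetric]
        by (subst add.commute, subst packing_pressure_swap[symmetric], rule add_le_erealI)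
           (rule packing_prod_lower[OF sys(2,1) sub(2)])
    qed
  qed
qed

theorem corollary6p5:
  fixes X :: "nat \<Rightarrow> 'a metric" and T :: "nat \<Rightarrow> 'a \<Rightarrow> 'a"
    and Y :: "nat \<Rightarrow> 'b metric" and R :: "nat \<Rightarrow> 'b \<Rightarrow> 'b"
    and f :: "nat \<Rightarrow> 'a \<Rightarrow> real" and g :: "nat \<Rightarrow> 'b \<Rightarrow> real"
    and Z :: "'a set" and W :: "'b set"
  assumes "nds X T" and "nds Y R"
    and "Z \<subseteq> mspace (X 0)" and "W \<subseteq> mspace (Y 0)"
    and "f \<in> continuous_seqs X" and "g \<in> continuous_seqs Y"
    and "equicontinuous_seq X f" and "equicontinuous_seq Y g"
  shows
    "(sum_defined (bowen_pressure X T f Z) (bowen_pressure Y R g W) \<and>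
      sum_defined (packing_pressure X T f Z) (packing_pressure Y R g W) \<and>
      (bowen_pressure X T f Z = packing_pressure X T f Z \<or>
       bowen_pressure Y R g W = packing_pressure Y R g W)
      \<longrightarrow>
      bowen_pressure (prod_spaces X Y) (prod_maps T R) (dotplus f g) (Z \<times> W)
        = bowen_pressure X T f Z + bowen_pressure Y R g W \<and>
      packing_pressure (prod_spaces X Y) (prod_maps T R) (dotplus f g) (Z \<times> W)
        = packing_pressure X T f Z + packing_pressure Y R g W)
     \<and>
     (sum_defined (lower_pressure X T f Z) (lower_pressure Y R g W) \<and>
      sum_defined (upper_pressure X T f Z) (upper_pressure Y R g W) \<and>
      (lower_pressure X T f Z = upper_pressure X T f Z \<or>
       lower_pressure Y R g W = upper_pressure Y R g W)
      \<longrightarrow>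
      lower_pressure (prod_spaces X Y) (prod_maps T R) (dotplus f g) (Z \<times> W)
        = lower_pressure X T f Z + lower_pressure Y R g W \<and>
      upper_pressure (prod_spaces X Y) (prod_maps T R) (dotplus f g) (Z \<times> W)
        = upper_pressure X T f Z + upper_pressure Y R g W)"
proof -
  note sys = nds_bowen_system[OF assms(1)] nds_bowen_system[OF assms(2)]
  note * = sys assms(3,4,7,8)
  show ?thesis
    using bowen_pressure_prod[OF *] packing_pressure_prod[OF *]
      lower_pressure_prod[OF *] upper_pressure_prod[OF *] by blast
qed

end
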